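(* Let $\Gamma$ be a totally ordered finitely generated free abelian group, let $a,b\in\Gamma$ with $0<b<a$ (the case $r=0$), and let $\mathcal H_n$ be the Hecke algebra of type $B_n$ over $\mathcal A=\mathbb Z[\Gamma]$ with parameters $\mathbf q=e^a$, $\mathbf Q=e^b$. Assume that for all $y,w\in W_n$ $$y\le_{LR}w\iff Sh(y)\trianglelefteq Sh(w),$$ where $\trianglelefteq$ is the dominance order on partitions of $2n$ (this is part $c^+$ of Conjecture A of Bonnafé–Geck–Iancu–Lam for $r=0$). Then $$\mathrm{span}_{\mathcal A}\{C_w : w\in W_n,\ w\notin W_b\}=J_n .$$
   Context: $W_n$ is the Coxeter group of type $B_n$: permutations $w$ of $\{\pm1,\dots,\pm n\}$ with $w(-i)=-w(i)$, generated by $s_0=(-1,1)$ and $s_i=(i,i+1)(-i,-i-1)$, $1\le i\le n-1$. $W_b\subseteq W_n$ is the set of $w$ such that no reduced expression of $w$ contains three consecutive factors $s_is_js_i$ with $i\in\{1,\dots,n-1\}$, $j\in\{0,\dots,n-1\}$, $|i-j|=1$. $\mathcal H_n$ is the $\mathcal A$-algebra on $T_0,\dots,T_{n-1}$ with $T_iT_{i-1}T_i=T_{i-1}T_iT_{i-1}$ ($2\le i\le n-1$), $T_0T_1T_0T_1=T_1T_0T_1T_0$, $T_iT_j=T_jT_i$ ($|i-j|>1$), $(T_i-\mathbf q)(T_i+\mathbf q^{-1})=0$ ($i\ge1$), $(T_0-\mathbf Q)(T_0+\mathbf Q^{-1})=0$. $T_w=T_{i_1}\cdots T_{i_N}$ for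 a reduced expression $w=s_{i_1}\cdots s_{i_N}$. The bar involution is the ring automorphism with $\overline{T_w}=T_{w^{-1}}^{-1}$, $\overline{e^\gamma}=e^{-\gamma}$. With $\mathcal A_{>0}=\sum_{\gamma>0}\mathbb Z e^\gamma$, $C_w$ is the unique element with $\overline{C_w}=C_w$ and $C_w-T_w\in\bigoplus_{y\in W_n}\mathcal A_{>0}T_y$; $\{C_w\}_{w\in W_n}$ is an $\mathcal A$-basis of $\mathcal H_n$, and $C_{s_0}=C_0:=T_0-\mathbf Q$, $C_{s_i}=C_i:=T_i-\mathbf q$ for $i\ge1$. The preorder $\le_{LR}$ is generated by: $y\le_{LR}w$ if $C_y$ occurs with nonzero coefficient in $C_{s_i}C_w$ or in $C_wC_{s_i}$ for some $i$. $J_n$ is the two-sided ideal of $\mathcal H_n$ generated by $C_1C_2C_1-C_1$ and $C_1C_0C_1-[2]_{\mathbf Q/\mathbf q}C_1$, where $[2]_x=x+x^{-1}$ (generators involving an index $\ge n$ are omitted). $Sh(w)$ is the shape of $w$ under domino insertion with empty core: write $w$ as the word $w(1)w(2)\cdots w(n)$ and insert its letters successively, starting from the empty tableau. To insert $x$ into a domino tableau $T$ with distinct labels ($|x|$ not among them): take the subtableau of dominoes with labels $<|x|$; if $x>0$ add a horizontal domino labelled $|x|$ at the end of the first row, if $x<0$ a vertical domino labelled $|x|$ at the bottom of the first column. Then treat the dominoes $d$ of $T$ with labels $j>|x|$ in increasing order; with $\mu$ the current shape: (1) if $d\cap\mu=\emptyset$ add $d$ unchanged; (2) if $d\cap\mu$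 is a single cell $(k,l)$, add a domino labelled $j$ on the two cells of $(d\cup\{(k+1,l+1)\})\setminus\mu$; (3) if $d\subset\mu$ is horizontal in row $k$, add a horizontal domino labelled $j$ at the end of row $k+1$; (4) if $d\subset\mu$ is vertical in column $l$, add a vertical domino labelled $j$ at the bottom of column $l+1$. $Sh(w)$ is the shape (a partition of $2n$) of the final tableau. *)

theory Defs
  imports "HOL-Algebra.Algebra" "HOL-Library.Poly_Mapping" "HOL-Combinatorics.Permutations"
begin

section \<open>The Coxeter group of type B\<close>

definition W :: "nat \<Rightarrow> (int \<Rightarrow> int) set" where
  "W n = {w. w permutes ({- int n..int n} - {0}) \<and> (\<forall>i. w (- i) = - w i)}"

definition refl_s :: "nat \<Rightarrow> int \<Rightarrow> int" where
  "refl_s i = (if i = 0 then transpose (- 1) 1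
     else transpose (int i) (int i + 1) \<circ> transpose (- int i) (- int i - 1))"

definition word_prod :: "nat list \<Rightarrow> int \<Rightarrow> int" where
  "word_prod ws = foldr (\<lambda>i w. refl_s i \<circ> w) ws id"

definition reduced_expr :: "nat \<Rightarrow> (int \<Rightarrow> int) \<Rightarrow> nat list \<Rightarrow> bool" where
  "reduced_expr n w ws \<longleftrightarrow> set ws \<subseteq> {..<n} \<and> word_prod ws = w \<and>
     (\<forall>vs. set vs \<subseteq> {..<n} \<and> word_prod vs = w \<longrightarrow> length ws \<le> length vs)"

text \<open>The middle index \<open>j\<close> may be \<open>0\<close>, the outer index \<open>i\<close> may not.\<close>

definition Wb :: "nat \<Rightarrow> (int \<Rightarrow> int) set" where
  "Wb n = {w \<in> W n. \<not> (\<exists>us vs i j. reduced_expr n w (us @ [i, j, i] @ vs) \<and>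
     1 \<le> i \<and> i < n \<and> j < n \<and> \<bar>int i - int j\<bar> = 1)}"


section \<open>Domino insertion with empty core\<close>

text \<open>
  A domino tableau is a finite partial map from labels to dominoes. A domino is a set of two
  adjacent cells, and a cell is a pair (row, column), both counted from \<open>0\<close>.
\<close>

type_synonym cell = "nat \<times> nat"
type_synonym tableau = "nat \<rightharpoonup> cell set"

definition tab_shape :: "tableau \<Rightarrow> cell set" where
  "tab_shape T = \<Union> (ran T)"

definition row_len :: "cell set \<Rightarrow> nat \<Rightarrow> nat" where
  "row_len \<mu> k = card {l. (k, l) \<in> \<mu>}"

definition col_len :: "cell set \<Rightarrow> nat \<Rightarrow> nat" where
  "col_len \<mu> l = card {k. (k, l) \<in> \<mu>}"

definition domino_at_row :: "cell set \<Rightarrow> nat \<Rightarrow> cell set" where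
  "domino_at_row \<mu> k = {(k, row_len \<mu> k), (k, row_len \<mu> k + 1)}"

definition domino_at_col :: "cell set \<Rightarrow> nat \<Rightarrow> cell set" where
  "domino_at_col \<mu> l = {(col_len \<mu> l, l), (col_len \<mu> l + 1, l)}"

text \<open>The new position of a domino \<open>d\<close> when the current shape is \<open>\<mu>\<close>.\<close>

definition bump :: "cell set \<Rightarrow> cell set \<Rightarrow> cell set" where
  "bump \<mu> d =
     (if d \<inter> \<mu> = {} then d
      else if is_singleton (d \<inter> \<mu>) then
        (case the_elem (d \<inter> \<mu>) of (k, l) \<Rightarrow> (d \<union> {(k + 1, l + 1)}) - \<mu>)
      else if is_singleton (fst ` d) then domino_at_row \<mu> (the_elem (fst ` d) + 1)
      else domino_at_col \<mu> (the_elem (snd ` d) + 1))"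

definition domino_insert :: "int \<Rightarrow> tableau \<Rightarrow> tableau" where
  "domino_insert x T =
     (let m = nat \<bar>x\<bar>;
          S = T |` {..<m};
          \<mu> = tab_shape S;
          S' = S(m \<mapsto> (if x > 0 then domino_at_row \<mu> 0 else domino_at_col \<mu> 0))
      in fold (\<lambda>j U. U(j \<mapsto> bump (tab_shape U) (the (T j))))
           (sorted_list_of_set {j \<in> dom T. m < j}) S')"

definition P_tableau :: "nat \<Rightarrow> (int \<Rightarrow> int) \<Rightarrow> tableau" where
  "P_tableau n w = fold domino_insert (map (\<lambda>i. w (int i)) [1..<n + 1]) Map.empty"

text \<open>
  Partitions are given as the sequence of their parts (row lengths), eventually \<open>0\<close>.
\<close>

definition Sh :: "nat \<Rightarrow> (int \<Rightarrow> int) \<Rightarrow> nat \<Rightarrow> nat" where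
  "Sh n w = row_len (tab_shape (P_tableau n w))"

definition dominance_le :: "(nat \<Rightarrow> nat) \<Rightarrow> (nat \<Rightarrow> nat) \<Rightarrow> bool" (infix "\<unlhd>" 50) where
  "\<kappa> \<unlhd> \<mu> \<longleftrightarrow> (\<forall>k. (\<Sum>i<k. \<kappa> i) \<le> (\<Sum>i<k. \<mu> i))"


section \<open>The Hecke algebra of type B\<close>

definition fg_free_group :: "'g::ab_group_add itself \<Rightarrow> bool" where
  "fg_free_group _ \<longleftrightarrow> (\<exists>S :: nat set. finite S \<and>
     free_Abelian_group S \<cong> \<lparr>carrier = (UNIV :: 'g set), monoid.mult = (+), one = 0\<rparr>)"

text \<open>
  The group ring of \<open>\<Gamma>\<close> over the integers consists of the finitely supported functions on
  \<open>\<Gamma>\<close>, whose multiplication in the theory \<open>Poly_Mapping\<close> is convolution.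
\<close>

type_synonym 'g group_ring = "'g \<Rightarrow>\<^sub>0 int"

definition ee :: "'g \<Rightarrow> 'g group_ring" where
  "ee \<gamma> = Poly_Mapping.single \<gamma> 1"

definition A_pos :: "'g::linordered_ab_group_add group_ring set" where
  "A_pos = {c. \<forall>\<gamma>\<in>Poly_Mapping.keys c. 0 < \<gamma>}"

text \<open>
  The free algebra over the group ring on letters indexed by natural numbers is the monoid
  algebra of the free monoid, here written additively because that is how the convolution
  product of \<open>Poly_Mapping\<close> expects it.
\<close>

datatype free_word = Free_Word (letters: "nat list")

instantiation free_word :: monoid_add
begin
definition zero_free_word :: free_word where "0 = Free_Word []"
definition plus_free_word :: "free_word \<Rightarrow> free_word \<Rightarrow> free_word" where
  "u + v = Free_Word (letters u @ letters v)"
instance by standard (simp_all add: zero_free_word_def plus_free_word_def)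
end

type_synonym 'g free_alg = "free_word \<Rightarrow>\<^sub>0 'g group_ring"

definition free_algebra :: "nat \<Rightarrow> 'g::linordered_ab_group_add free_alg ring" where
  "free_algebra n = \<lparr>carrier = {p. \<forall>v\<in>Poly_Mapping.keys p. set (letters v) \<subseteq> {..<n}},
     monoid.mult = (*), one = 1, ring.zero = 0, ring.add = (+)\<rparr>"

definition free_gen :: "nat \<Rightarrow> 'g::linordered_ab_group_add free_alg" where
  "free_gen i = Poly_Mapping.single (Free_Word [i]) 1"

definition free_const :: "'g::linordered_ab_group_add group_ring \<Rightarrow> 'g free_alg" where
  "free_const c = Poly_Mapping.single 0 c"

lemma ring_free_algebra: "ring (free_algebra n)"
proof (rule ringI)
  show "abelian_group (free_algebra n :: 'a free_alg ring)"
  proof (rule abelian_groupI)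
    fix x :: "'a free_alg" assume "x \<in> carrier (free_algebra n)"
    then show "\<exists>y\<in>carrier (free_algebra n). y \<oplus>\<^bsub>free_algebra n\<^esub> x = \<zero>\<^bsub>free_algebra n\<^esub>"
      by (intro bexI[of _ "- x"]) (auto simp: free_algebra_def keys_minus)
  qed (use Poly_Mapping.keys_add in \<open>fastforce simp: free_algebra_def add_ac\<close>)+
  show "Group.monoid (free_algebra n :: 'a free_alg ring)"
  proof (rule monoidI)
    fix x y :: "'a free_alg"
    assume "x \<in> carrier (free_algebra n)" "y \<in> carrier (free_algebra n)"
    then show "x \<otimes>\<^bsub>free_algebra n\<^esub> y \<in> carrier (free_algebra n)"
      using keys_mult[of x y] by (fastforce simp: free_algebra_def plus_free_word_def)
  next
    have "Poly_Mapping.keys (1 :: 'a free_alg) \<subseteq> {0}"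
      by (simp flip: single_one)
    then show "\<one>\<^bsub>free_algebra n\<^esub> \<in> carrier (free_algebra n :: 'a free_alg ring)"
      by (auto simp: free_algebra_def zero_free_word_def)
  qed (auto simp: free_algebra_def mult.assoc)
qed (auto simp: free_algebra_def algebra_simps)

text \<open>Below, \<open>a\<close> and \<open>b\<close> are the exponents with \<open>q = e\<^sup>a\<close> and \<open>Q = e\<^sup>b\<close>.\<close>

definition param :: "'g \<Rightarrow> 'g \<Rightarrow> nat \<Rightarrow> 'g" where
  "param a b i = (if i = 0 then b else a)"

definition hecke_relators ::
    "nat \<Rightarrow> 'g::linordered_ab_group_add \<Rightarrow> 'g \<Rightarrow> 'g free_alg set" where
  "hecke_relators n a b =
     {free_gen i * free_gen (i - 1) * free_gen i
        - free_gen (i - 1) * free_gen i * free_gen (i - 1) |i. 2 \<le> i \<and> i < n}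
   \<union> (if 1 < n then {free_gen 0 * free_gen 1 * free_gen 0 * free_gen 1
        - free_gen 1 * free_gen 0 * free_gen 1 * free_gen 0} else {})
   \<union> {free_gen i * free_gen j - free_gen j * free_gen i |i j.
        i < n \<and> j < n \<and> 1 < \<bar>int i - int j\<bar>}
   \<union> {(free_gen i - free_const (ee (param a b i)))
        * (free_gen i + free_const (ee (- param a b i))) |i. i < n}"

definition hecke_ideal ::
    "nat \<Rightarrow> 'g::linordered_ab_group_add \<Rightarrow> 'g \<Rightarrow> 'g free_alg set" where
  "hecke_ideal n a b = Idl\<^bsub>free_algebra n\<^esub> (hecke_relators n a b)"

definition hecke :: "nat \<Rightarrow> 'g::linordered_ab_group_add \<Rightarrow> 'g \<Rightarrow> 'g free_alg set ring" where
  "hecke n a b = free_algebra n Quot hecke_ideal n a b"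

definition hecke_gen ::
    "nat \<Rightarrow> 'g::linordered_ab_group_add \<Rightarrow> 'g \<Rightarrow> nat \<Rightarrow> 'g free_alg set" where
  "hecke_gen n a b i = hecke_ideal n a b +>\<^bsub>free_algebra n\<^esub> free_gen i"

definition hecke_const ::
    "nat \<Rightarrow> 'g::linordered_ab_group_add \<Rightarrow> 'g \<Rightarrow> 'g group_ring \<Rightarrow> 'g free_alg set" where
  "hecke_const n a b c = hecke_ideal n a b +>\<^bsub>free_algebra n\<^esub> free_const c"

definition hecke_smult ::
    "nat \<Rightarrow> 'g::linordered_ab_group_add \<Rightarrow> 'g \<Rightarrow> 'g group_ring \<Rightarrow> 'g free_alg set
      \<Rightarrow> 'g free_alg set" where
  "hecke_smult n a b c h = hecke_const n a b c \<otimes>\<^bsub>hecke n a b\<^esub> h"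

definition A_span ::
    "nat \<Rightarrow> 'g::linordered_ab_group_add \<Rightarrow> 'g \<Rightarrow> 'g free_alg set set \<Rightarrow> 'g free_alg set set" where
  "A_span n a b S = {\<Oplus>\<^bsub>hecke n a b\<^esub>x\<in>F. hecke_smult n a b (c x) x |F c. finite F \<and> F \<subseteq> S}"

text \<open>By Matsumoto's theorem the following does not depend on the reduced expression.\<close>

definition T_basis ::
    "nat \<Rightarrow> 'g::linordered_ab_group_add \<Rightarrow> 'g \<Rightarrow> (int \<Rightarrow> int) \<Rightarrow> 'g free_alg set" where
  "T_basis n a b w = foldr (\<lambda>i h. hecke_gen n a b i \<otimes>\<^bsub>hecke n a b\<^esub> h)
     (SOME ws. reduced_expr n w ws) \<one>\<^bsub>hecke n a b\<^esub>"

text \<open>Extensionality only fixes the irrelevant values outside the carrier.\<close>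

definition is_bar ::
    "nat \<Rightarrow> 'g::linordered_ab_group_add \<Rightarrow> 'g \<Rightarrow> ('g free_alg set \<Rightarrow> 'g free_alg set) \<Rightarrow> bool" where
  "is_bar n a b f \<longleftrightarrow>
     f \<in> ring_iso (hecke n a b) (hecke n a b) \<and> f \<in> extensional (carrier (hecke n a b)) \<and>
     (\<forall>\<gamma>. f (hecke_const n a b (ee \<gamma>)) = hecke_const n a b (ee (- \<gamma>))) \<and>
     (\<forall>w\<in>W n. f (T_basis n a b w) = inv\<^bsub>hecke n a b\<^esub> (T_basis n a b (inv_into UNIV w)))"

definition bar ::
    "nat \<Rightarrow> 'g::linordered_ab_group_add \<Rightarrow> 'g \<Rightarrow> 'g free_alg set \<Rightarrow> 'g free_alg set" where
  "bar n a b = (THE f. is_bar n a b f)"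

definition C_basis ::
    "nat \<Rightarrow> 'g::linordered_ab_group_add \<Rightarrow> 'g \<Rightarrow> (int \<Rightarrow> int) \<Rightarrow> 'g free_alg set" where
  "C_basis n a b w = (THE c. c \<in> carrier (hecke n a b) \<and> bar n a b c = c \<and>
     (\<exists>p. (\<forall>y\<in>W n. p y \<in> A_pos) \<and>
        c \<ominus>\<^bsub>hecke n a b\<^esub> T_basis n a b w =
          (\<Oplus>\<^bsub>hecke n a b\<^esub>y\<in>W n. hecke_smult n a b (p y) (T_basis n a b y))))"

text \<open>\<open>C_occurs n a b y h\<close>: the coefficient of \<open>C\<^sub>y\<close> in \<open>h\<close> is nonzero.\<close>

definition C_occurs ::
    "nat \<Rightarrow> 'g::linordered_ab_group_add \<Rightarrow> 'g \<Rightarrow> (int \<Rightarrow> int) \<Rightarrow> 'g free_alg set \<Rightarrow> bool" where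
  "C_occurs n a b y h \<longleftrightarrow> (\<exists>c.
     h = (\<Oplus>\<^bsub>hecke n a b\<^esub>z\<in>W n. hecke_smult n a b (c z) (C_basis n a b z)) \<and> c y \<noteq> 0)"

definition lr_step ::
    "nat \<Rightarrow> 'g::linordered_ab_group_add \<Rightarrow> 'g \<Rightarrow> (int \<Rightarrow> int) \<Rightarrow> (int \<Rightarrow> int) \<Rightarrow> bool" where
  "lr_step n a b y w \<longleftrightarrow> y \<in> W n \<and> w \<in> W n \<and> (\<exists>i<n.
     C_occurs n a b y (C_basis n a b (refl_s i) \<otimes>\<^bsub>hecke n a b\<^esub> C_basis n a b w) \<or>
     C_occurs n a b y (C_basis n a b w \<otimes>\<^bsub>hecke n a b\<^esub> C_basis n a b (refl_s i)))"

definition le_LR ::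
    "nat \<Rightarrow> 'g::linordered_ab_group_add \<Rightarrow> 'g \<Rightarrow> (int \<Rightarrow> int) \<Rightarrow> (int \<Rightarrow> int) \<Rightarrow> bool" where
  "le_LR n a b = (lr_step n a b)\<^sup>*\<^sup>*"

definition C_gen ::
    "nat \<Rightarrow> 'g::linordered_ab_group_add \<Rightarrow> 'g \<Rightarrow> nat \<Rightarrow> 'g free_alg set" where
  "C_gen n a b i = hecke_gen n a b i \<ominus>\<^bsub>hecke n a b\<^esub> hecke_const n a b (ee (param a b i))"

text \<open>
  Here \<open>[2]\<close> is taken at \<open>Q/q = e\<^sup>b\<^sup>-\<^sup>a\<close>. A generator is present only if all its indices are
  smaller than \<open>n\<close>.
\<close>

definition J_ideal ::
    "nat \<Rightarrow> 'g::linordered_ab_group_add \<Rightarrow> 'g \<Rightarrow> 'g free_alg set set" where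
  "J_ideal n a b = (let H = hecke n a b; C = C_gen n a b in
     Idl\<^bsub>H\<^esub> ((if 2 < n then {C 1 \<otimes>\<^bsub>H\<^esub> C 2 \<otimes>\<^bsub>H\<^esub> C 1 \<ominus>\<^bsub>H\<^esub> C 1} else {})
       \<union> (if 1 < n then {C 1 \<otimes>\<^bsub>H\<^esub> C 0 \<otimes>\<^bsub>H\<^esub> C 1
            \<ominus>\<^bsub>H\<^esub> hecke_smult n a b (ee (b - a) + ee (a - b)) (C 1)} else {})))"

end

theory Submission
  imports Defs "HOL-Library.Function_Algebras"
begin

text \<open>
  The Hecke algebra acts faithfully on the functions on the Coxeter group, with \<open>T\<^sub>w\<close>
  corresponding to the indicator function \<open>delta w\<close>, so that bar involution,
  Kazhdan-Lusztig basis and two-sided ideals can be studied in this module. The element \<open>C\<^sub>w\<close>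
  is \<open>T\<^sub>w\<close> plus a combination of \<open>T\<^sub>y\<close> with \<open>y\<close> shorter than \<open>w\<close>.

  The generators of the ideal \<open>J\<close> are \<open>C\<^sub>w\<close> for \<open>w = s\<^sub>1 s\<^sub>0 s\<^sub>1\<close> and \<open>w = s\<^sub>1 s\<^sub>2 s\<^sub>1\<close>. Let \<open>D\<close> be
  the set of elements below one of these in the preorder; then the span of the \<open>C\<^sub>w\<close> with
  \<open>w \<in> D\<close> is an ideal that contains \<open>J\<close>. Modulo \<open>J\<close>, every \<open>T\<^sub>w\<close> with \<open>w\<close> outside \<open>Wb\<close> is a
  combination of shorter ones, so \<open>J\<close> and the \<open>T\<^sub>w\<close> with \<open>w \<in> Wb\<close> span the algebra. By triangularity
  an element of the span of the \<open>C\<^sub>w\<close> with \<open>w \<in> D\<close> vanishes if all its coefficients at \<open>T\<^sub>w\<close> with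
  \<open>w \<in> D\<close> do. Hence, once \<open>D\<close> is known to be disjoint from \<open>Wb\<close>, it is the complement of \<open>Wb\<close>
  and the span equals \<open>J\<close>.

  For the disjointness, star operations (which go down in the preorder) reduce any element of
  \<open>Wb\<close> to a product of distinct commuting generators. The domino tableau of such a product has
  at most two rows, whereas those of \<open>s\<^sub>1 s\<^sub>0 s\<^sub>1\<close> and \<open>s\<^sub>1 s\<^sub>2 s\<^sub>1\<close> have three. As the preorder is
  the dominance order of the shapes, no element of \<open>Wb\<close> is below one of these two.
\<close>

section \<open>The Coxeter group of type B\<close>

text \<open>Two obstacles shape the proof. The Hecke algebra is given as a quotient of a free
  algebra, where the independence of the \<open>T_w\<close> is not visible; it comes out of the
  action at \<open>delta id\<close>, once left and right multiplication are known to commute there.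
  The other obstacle is that the parameters differ. A star operation from \<open>w\<close> to
  \<open>refl_s j \<circ> w\<close> through \<open>C_i\<close> produces a coefficient that is
  \<open>ee (param a b j - param a b i)\<close> up to \<open>A_pos\<close>. For \<open>i > 0\<close>
  the exponent is at most 0 and the coefficient cannot vanish; for \<open>i = 0\<close>,
  \<open>j = 1\<close> it is \<open>a - b > 0\<close> and nothing can be concluded. So only
  operations with \<open>i > 0\<close> are allowed, and a word can be stuck on one side without its
  letters commuting, as \<open>[1, 0]\<close> shows. Operations on both sides repair this: in a
  stuck word for an element of \<open>Wb\<close>, the largest letter that is not free to move to the
  front is preceded by a larger one, and this cannot happen in both directions.\<close>

text \<open>The reflection \<open>refl_s i\<close> exchanges \<open>lo i\<close> with \<open>hi i\<close>, and \<open>- lo i\<close> with \<open>- hi i\<close>.\<close>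

definition lo :: "nat \<Rightarrow> int" where "lo i = (if i = 0 then - 1 else int i)"

definition hi :: "nat \<Rightarrow> int" where "hi i = int i + 1"

abbreviation winv :: "(int \<Rightarrow> int) \<Rightarrow> int \<Rightarrow> int" where "winv w \<equiv> inv_into UNIV w"

text \<open>For \<open>i = 0\<close> and \<open>w\<close> in \<open>W n\<close> this says
  \<open>winv w 1 < 0\<close>; the choice \<open>lo 0 = - 1\<close> lets one formula serve both
  kinds of generators.\<close>

definition ldesc :: "nat \<Rightarrow> (int \<Rightarrow> int) \<Rightarrow> bool" where
  "ldesc i w \<longleftrightarrow> winv w (hi i) < winv w (lo i)"

lemma refl_s_apply:
  "refl_s i x = (if x = lo i then hi i else if x = hi i then lo i
     else if x = - lo i then - hi i else if x = - hi i then - lo i else x)"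
  by (auto simp: refl_s_def lo_def hi_def transpose_def)

lemma refl_refl [simp]: "refl_s i (refl_s i x) = x"
  by (auto simp: refl_s_apply lo_def hi_def)

lemma refl_comp_refl [simp]: "refl_s i \<circ> refl_s i = id"
  by auto

lemma refl_refl_comp [simp]: "refl_s i \<circ> (refl_s i \<circ> w) = w" "(w \<circ> refl_s i) \<circ> refl_s i = w"
  by auto

lemma winv_refl_s [simp]: "winv (refl_s i) = refl_s i"
  by (rule inv_unique_comp) auto

lemma W_bij: "w \<in> W n \<Longrightarrow> bij w"
  by (auto simp: W_def permutes_bij)

lemma W_odd: "w \<in> W n \<Longrightarrow> w (- i) = - w i"
  by (auto simp: W_def)

lemma W_id [simp]: "id \<in> W n"
  by (auto simp: W_def permutes_id)

lemma W_comp [intro]: "u \<in> W n \<Longrightarrow> v \<in> W n \<Longrightarrow> u \<circ> v \<in> W n"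
  by (auto simp: W_def intro: permutes_compose)

lemma W_winv [intro]: "w \<in> W n \<Longrightarrow> winv w \<in> W n"
proof -
  assume w: "w \<in> W n"
  have "winv w (- i) = - winv w i" for i
    using W_bij[OF w] W_odd[OF w, of "winv w i"]
    by (metis bij_inv_eq_iff)
  then show ?thesis
    using w by (auto simp: W_def permutes_inv)
qed

lemma winv_winv [simp]: "w \<in> W n \<Longrightarrow> winv (winv w) = w"
  by (simp add: W_bij inv_inv_eq)

lemma winv_comp: "u \<in> W n \<Longrightarrow> v \<in> W n \<Longrightarrow> winv (u \<circ> v) = winv v \<circ> winv u"
  by (simp add: W_bij o_inv_distrib)

lemma winv_o [simp]: "w \<in> W n \<Longrightarrow> winv w \<circ> w = id" "w \<in> W n \<Longrightarrow> w \<circ> winv w = id"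
  using W_bij[of w n] by (auto simp: fun_eq_iff bij_is_inj bij_is_surj surj_f_inv_f)

lemma finite_W [simp]: "finite (W n)"
  by (rule finite_subset[OF _ finite_permutations[of "{- int n..int n} - {0}"]]) (auto simp: W_def)

lemma refl_W [intro]: "i < n \<Longrightarrow> refl_s i \<in> W n"
proof -
  assume "i < n"
  then have "refl_s i x = x" if "x \<notin> {- int n..int n} - {0}" for x
    using that by (auto simp: refl_s_apply lo_def hi_def split: if_splits)
  moreover have "\<exists>!x. refl_s i x = y" for y
    by (metis refl_refl)
  moreover have "refl_s i (- x) = - refl_s i x" for x
    by (auto simp: refl_s_apply lo_def hi_def split: if_splits)
  ultimately show ?thesis
    unfolding W_def permutes_def by blast
qed

lemma refl_comp_W [simp]: "i < n \<Longrightarrow> refl_s i \<circ> w \<in> W n \<longleftrightarrow> w \<in> W n"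
  using refl_W[of i n] W_comp[of "refl_s i" n] refl_refl_comp(1)[of i w] by metis

lemma W_comp_refl [simp]: "i < n \<Longrightarrow> w \<circ> refl_s i \<in> W n \<longleftrightarrow> w \<in> W n"
  using refl_W[of i n] W_comp[of _ n "refl_s i"] refl_refl_comp(2)[of w i] by metis

lemma winv_refl_comp: "i < n \<Longrightarrow> w \<in> W n \<Longrightarrow> winv (refl_s i \<circ> w) = winv w \<circ> refl_s i"
  using winv_comp[of "refl_s i" n w] refl_W[of i n] by simp

lemma winv_comp_refl: "i < n \<Longrightarrow> w \<in> W n \<Longrightarrow> winv (w \<circ> refl_s i) = refl_s i \<circ> winv w"
  using winv_comp[of w n "refl_s i"] refl_W[of i n] by simp

lemma winv_eq_iff: "w \<in> W n \<Longrightarrow> winv w x = winv w y \<longleftrightarrow> x = y"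
  using W_bij[OF W_winv[of w n]] by (auto simp: bij_def inj_def)

lemma W_eq_iff: "w \<in> W n \<Longrightarrow> w x = w y \<longleftrightarrow> x = y"
  using W_bij[of w n] by (auto simp: bij_def inj_def)

lemma lo_less_hi: "lo i < hi i"
  by (auto simp: lo_def hi_def)

section \<open>Left descents, words and the exchange property\<close>

lemma ldesc_refl_comp:
  assumes "i < n" "w \<in> W n"
  shows "ldesc i (refl_s i \<circ> w) \<longleftrightarrow> \<not> ldesc i w"
proof -
  have "winv w (lo i) \<noteq> winv w (hi i)"
    using lo_less_hi[of i] by (simp add: winv_eq_iff[OF assms(2)])
  then show ?thesis
    by (auto simp: ldesc_def winv_refl_comp[OF assms] refl_s_apply)
qed

lemma not_ldesc_id [simp]: "\<not> ldesc i id"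
  using lo_less_hi[of i] by (simp add: ldesc_def)

lemma word_prod_simps [simp]:
  "word_prod [] = id" "word_prod (i # ws) = refl_s i \<circ> word_prod ws"
  by (auto simp: word_prod_def)

lemma word_prod_append [simp]: "word_prod (us @ vs) = word_prod us \<circ> word_prod vs"
  by (induction us) auto

lemma word_prod_W [intro]: "set ws \<subseteq> {..<n} \<Longrightarrow> word_prod ws \<in> W n"
  by (induction ws) auto

lemma winv_word_prod: "set ws \<subseteq> {..<n} \<Longrightarrow> winv (word_prod ws) = word_prod (rev ws)"
proof (induction ws)
  case (Cons i ws)
  then have i: "i < n" and ws: "set ws \<subseteq> {..<n}" by auto
  have "winv (word_prod (i # ws)) = winv (word_prod ws) \<circ> refl_s i"
    unfolding word_prod_simps using winv_refl_comp[OF i word_prod_W[OF ws]] .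
  then show ?case
    by (simp only: Cons.IH[OF ws] rev.simps word_prod_append word_prod_simps comp_id)
qed simp

text \<open>
  A simple reflection reverses the order of exactly one pair of integers up to sign. Hence if
  right multiplication creates the left descent \<open>i\<close>, then it is also left multiplication by
  \<open>refl_s i\<close>. This is the condition from which Bourbaki derives the exchange property.
\<close>

lemma refl_s_reverses:
  assumes "x < y" "x \<noteq> 0" "y \<noteq> 0" "refl_s k y < refl_s k x"
  shows "x = lo k \<and> y = hi k \<or> x = - hi k \<and> y = - lo k"
  using assms by (auto simp: refl_s_apply lo_def hi_def split: if_splits)

lemma W_nz: "w \<in> W n \<Longrightarrow> w x = 0 \<longleftrightarrow> x = 0"
  using W_odd[of w n 0] W_eq_iff[of w n x 0] by auto

lemma ldesc_created:
  assumes w: "w \<in> W n" and "i < n" "k < n" and "\<not> ldesc i w" "ldesc i (w \<circ> refl_s k)"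
  shows "refl_s i \<circ> w = w \<circ> refl_s k"
proof -
  define x y where "x = winv w (lo i)" and "y = winv w (hi i)"
  have wxy: "w x = lo i" "w y = hi i"
    using W_bij[OF w] by (simp_all add: x_def y_def bij_is_surj surj_f_inv_f)
  have "x \<noteq> y"
    using wxy lo_less_hi[of i] by auto
  then have "x < y"
    using assms(4) by (auto simp: ldesc_def x_def y_def)
  moreover have "x \<noteq> 0" "y \<noteq> 0"
    using wxy W_nz[OF w, of x] W_nz[OF w, of y] by (auto simp: lo_def hi_def split: if_splits)
  moreover have "refl_s k y < refl_s k x"
    using assms(5) by (auto simp: ldesc_def x_def y_def winv_comp_refl[OF \<open>k < n\<close> w])
  ultimately have *: "x = lo k \<and> y = hi k \<or> x = - hi k \<and> y = - lo k"
    by (rule refl_s_reverses)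
  have "refl_s i (w z) = w (refl_s k z)" for z
  proof (cases "z \<in> {x, y, - x, - y}")
    case True
    have "w (refl_s k x) = w y" "w (refl_s k y) = w x"
      "w (refl_s k (- x)) = w (- y)" "w (refl_s k (- y)) = w (- x)"
      using * by (auto simp: refl_s_apply lo_def hi_def add.commute)
    moreover have "refl_s i (w x) = w y" "refl_s i (w y) = w x"
      "refl_s i (w (- x)) = w (- y)" "refl_s i (w (- y)) = w (- x)"
      unfolding W_odd[OF w] wxy by (auto simp: refl_s_apply lo_def hi_def)
    ultimately show ?thesis using True by auto
  next
    case False
    then have "w z \<notin> {w x, w y, w (- x), w (- y)}"
      unfolding insert_iff W_eq_iff[OF w] by simp
    then have "refl_s i (w z) = w z"
      unfolding W_odd[OF w] wxy by (auto simp: refl_s_apply)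
    moreover have "refl_s k z = z"
      using False * by (auto simp: refl_s_apply)
    ultimately show ?thesis by simp
  qed
  then show ?thesis by auto
qed

lemma ldesc_right_mult:
  assumes w: "w \<in> W n" and "i < n" "k < n" and "refl_s i \<circ> w \<noteq> w \<circ> refl_s k"
  shows "ldesc i (w \<circ> refl_s k) \<longleftrightarrow> ldesc i w"
proof
  assume "ldesc i (w \<circ> refl_s k)"
  then show "ldesc i w" using ldesc_created[OF assms(1-3)] assms(4) by auto
next
  assume *: "ldesc i w"
  show "ldesc i (w \<circ> refl_s k)"
  proof (rule ccontr)
    assume "\<not> ldesc i (w \<circ> refl_s k)"
    with * have "refl_s i \<circ> (w \<circ> refl_s k) = (w \<circ> refl_s k) \<circ> refl_s k"
      using assms(1-3) by (intro ldesc_created[of "w \<circ> refl_s k" n]) auto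
    then have "refl_s i \<circ> (w \<circ> refl_s k) = w" by simp
    then have "w \<circ> refl_s k = refl_s i \<circ> w" by (metis refl_refl_comp(1))
    with assms(4) show False by simp
  qed
qed

text \<open>The last letter either leaves a descent that the prefix already has, or it creates the
  descent. In the second case \<open>ldesc_created\<close> turns left multiplication by
  \<open>refl_s i\<close> into deletion of that letter.\<close>

lemma exchange:
  assumes "set ws \<subseteq> {..<n}" "i < n" "ldesc i (word_prod ws)"
  shows "\<exists>us k vs. ws = us @ k # vs \<and> refl_s i \<circ> word_prod ws = word_prod (us @ vs)"
  using assms
proof (induction ws rule: rev_induct)
  case (snoc k ws)
  show ?case
  proof (cases "ldesc i (word_prod ws)")
    case True
    then obtain us l vs where "ws = us @ l # vs" "refl_s i \<circ> word_prod ws = word_prod (us @ vs)"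
      using snoc.IH snoc.prems by (metis le_sup_iff set_append)
    then have "ws @ [k] = us @ l # (vs @ [k]) \<and>
        refl_s i \<circ> word_prod (ws @ [k]) = word_prod (us @ (vs @ [k]))"
      by (simp add: o_assoc)
    then show ?thesis by blast
  next
    case False
    have "refl_s i \<circ> word_prod ws = word_prod ws \<circ> refl_s k"
    proof (rule ldesc_created[OF _ _ _ False])
      show "ldesc i (word_prod ws \<circ> refl_s k)"
        using snoc.prems(3) by (simp only: word_prod_append word_prod_simps comp_id)
    qed (use snoc.prems in \<open>auto intro: word_prod_W\<close>)
    then have "refl_s i \<circ> word_prod (ws @ [k]) = word_prod (ws @ [])"
      by (metis append_Nil2 comp_assoc id_comp refl_refl_comp(2) word_prod_append word_prod_simps)
    then show ?thesis by blast
  qed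
qed simp

text \<open>Without descents the inverse \<open>v\<close> of \<open>w\<close> is positive at 1 and
  strictly increasing on \<open>1, ..., n\<close>. Counting up from 1 gives
  \<open>k \<le> v k\<close>, counting down from the bound \<open>n\<close> gives the reverse
  inequality.\<close>

lemma no_ldesc_imp_id:
  assumes w: "w \<in> W n" and "\<And>i. i < n \<Longrightarrow> \<not> ldesc i w"
  shows "w = id"
proof -
  define v where "v = winv w"
  have v: "v \<in> W n" using w by (auto simp: v_def)
  have step: "v (lo i) < v (hi i)" if "i < n" for i
    using assms(2)[OF that] W_eq_iff[OF v, of "lo i" "hi i"] lo_less_hi[of i]
    by (auto simp: ldesc_def v_def)
  have rng: "v x \<in> {- int n..int n}" if "x \<in> {- int n..int n} - {0}" for x
    using that v by (auto simp: W_def dest: permutes_in_image[of v _ x])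
  have ge: "v (int k) \<ge> int k" if "1 \<le> k" "k \<le> n" for k
    using that
  proof (induction k rule: nat_induct_at_least)
    case base
    then show ?case using step[of 0] W_odd[OF v, of 1] by (simp add: lo_def hi_def)
  next
    case (Suc k)
    then show ?case using step[of k] by (simp add: lo_def hi_def add.commute)
  qed
  have le: "v (int (n - k)) \<le> int (n - k)" if "k < n" for k
    using that
  proof (induction k)
    case 0
    then show ?case using rng[of "int n"] by auto
  next
    case (Suc k)
    then have "v (int (n - Suc k)) < v (int (n - k))"
      using step[of "n - Suc k"] by (simp add: lo_def hi_def Suc_diff_Suc of_nat_diff)
    then show ?case using Suc by auto
  qed
  have pos: "v (int k) = int k" if "1 \<le> k" "k \<le> n" for k
    using ge[OF that] le[of "n - k"] that by auto
  have "v x = x" for x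
  proof -
    consider "x = 0" | "x \<in> {1..int n}" | "x \<in> {- int n..- 1}" | "x \<notin> {- int n..int n}"
      by (cases "x = 0"; cases "x > 0") auto
    then show ?thesis
    proof cases
      case 1 then show ?thesis using W_nz[OF v] by simp
    next
      case 2 then show ?thesis using pos[of "nat x"] by auto
    next
      case 3 then show ?thesis using pos[of "nat (- x)"] W_odd[OF v, of x] by auto
    next
      case 4 then show ?thesis using v by (auto simp: W_def permutes_def)
    qed
  qed
  then have "v = id" by auto
  then show ?thesis using winv_winv[OF w] by (simp add: v_def)
qed

text \<open>No length is available yet as an induction measure, so the sum \<open>f\<close> takes
  its place. Removing a descent pairs larger values of \<open>winv w\<close> with larger positions
  and thus raises \<open>f\<close>, as in the rearrangement inequality; an element outside the
  generated subgroup with maximal \<open>f\<close> cannot exist.\<close>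

lemma W_generated:
  assumes "w \<in> W n"
  shows "\<exists>ws. set ws \<subseteq> {..<n} \<and> word_prod ws = w"
proof (rule ccontr)
  define B where "B = {w \<in> W n. \<nexists>ws. set ws \<subseteq> {..<n} \<and> word_prod ws = w}"
  define f where "f w = (\<Sum>i\<in>{- int n..int n}. winv w i * i)" for w
  assume "\<not> ?thesis"
  then have "B \<noteq> {}" "finite B" using assms by (auto simp: B_def)
  then have "Max (f ` B) \<in> f ` B" by (intro Max_in) auto
  then obtain u where "u \<in> B" "f u = Max (f ` B)" by auto
  then have u: "u \<in> B" "\<And>v. v \<in> B \<Longrightarrow> f v \<le> f u"
    using \<open>finite B\<close> by auto
  have uW: "u \<in> W n" using u by (simp add: B_def)
  have "u \<noteq> id"
  proof
    assume "u = id"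
    then have "set [] \<subseteq> {..<n} \<and> word_prod [] = u" by simp
    then show False using u(1) unfolding B_def by blast
  qed
  then obtain k where k: "k < n" "ldesc k u" using no_ldesc_imp_id[OF uW] by blast
  let ?v = "refl_s k \<circ> u"
  have "?v \<in> B"
  proof -
    have "word_prod ws \<noteq> ?v" if "set ws \<subseteq> {..<n}" for ws
    proof
      assume "word_prod ws = ?v"
      then have "word_prod (k # ws) = u" by (metis refl_refl_comp(1) word_prod_simps(2))
      moreover have "set (k # ws) \<subseteq> {..<n}" using that k by auto
      ultimately show False using u(1) unfolding B_def by blast
    qed
    then show ?thesis using uW k by (auto simp: B_def)
  qed
  have bb: "bij_betw (refl_s k) {- int n..int n} {- int n..int n}"
    using k(1) by (intro bij_betwI[where g = "refl_s k"]) (auto simp: refl_s_apply lo_def hi_def)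
  have "f ?v = (\<Sum>i\<in>{- int n..int n}. winv u (refl_s k i) * i)"
    by (simp add: f_def winv_refl_comp[OF k(1) uW])
  also have "\<dots> = (\<Sum>i\<in>{- int n..int n}. winv u i * refl_s k i)"
    by (rule sum.reindex_bij_betw[OF bb, of "\<lambda>i. winv u i * refl_s k i", simplified])
  finally have "f ?v - f u = (\<Sum>i\<in>{- int n..int n}. winv u i * (refl_s k i - i))"
    by (simp add: f_def algebra_simps flip: sum_subtractf)
  also have "\<dots> = (\<Sum>i\<in>{lo k, hi k, - lo k, - hi k}. winv u i * (refl_s k i - i))"
    using k(1) by (intro sum.mono_neutral_right) (auto simp: refl_s_apply lo_def hi_def split: if_splits)
  \<comment> \<open>For \<open>k = 0\<close> the four positions collapse to two, so that the sum has
    to be evaluated separately.\<close>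
  also have "\<dots> > 0"
  proof (cases "k = 0")
    case True
    then have "lo k = - 1" "hi k = 1" "refl_s k 1 = - 1" "refl_s k (- 1) = 1"
      by (auto simp: refl_s_apply lo_def hi_def)
    moreover have "{- 1, 1, - 1::int} = {- 1, 1}" by auto
    ultimately show ?thesis using k(2) W_odd[OF W_winv[OF uW], of 1] by (simp add: ldesc_def)
  next
    case False
    define x y where "x = winv u (lo k)" and "y = winv u (hi k)"
    have "winv u (- lo k) = - x" "winv u (- hi k) = - y"
      using W_odd[OF W_winv[OF uW]] by (simp_all add: x_def y_def)
    moreover have "refl_s k (lo k) - lo k = 1" "refl_s k (hi k) - hi k = - 1"
      "refl_s k (- lo k) - (- lo k) = - 1" "refl_s k (- hi k) - (- hi k) = 1"
      using False by (auto simp: refl_s_apply lo_def hi_def)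
    moreover have "distinct [lo k, hi k, - lo k, - hi k]"
      using False by (auto simp: lo_def hi_def)
    ultimately have "(\<Sum>i\<in>{lo k, hi k, - lo k, - hi k}. winv u i * (refl_s k i - i)) = 2 * (x - y)"
      by (simp flip: x_def y_def)
    then show ?thesis using k(2) by (simp add: ldesc_def x_def y_def)
  qed
  finally show False using u(2)[OF \<open>?v \<in> B\<close>] by simp
qed

section \<open>Length and reduced expressions\<close>

definition len :: "nat \<Rightarrow> (int \<Rightarrow> int) \<Rightarrow> nat" where
  "len n w = (LEAST k. \<exists>ws. set ws \<subseteq> {..<n} \<and> word_prod ws = w \<and> length ws = k)"

lemma len_le: "set ws \<subseteq> {..<n} \<Longrightarrow> len n (word_prod ws) \<le> length ws"
  unfolding len_def by (rule Least_le) auto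

lemma ex_word:
  assumes "w \<in> W n"
  shows "\<exists>ws. set ws \<subseteq> {..<n} \<and> word_prod ws = w \<and> length ws = len n w"
  unfolding len_def by (rule LeastI_ex) (use W_generated[OF assms] in auto)

lemma reduced_expr_iff:
  assumes "w \<in> W n"
  shows "reduced_expr n w ws \<longleftrightarrow> set ws \<subseteq> {..<n} \<and> word_prod ws = w \<and> length ws = len n w"
  using ex_word[OF assms] len_le unfolding reduced_expr_def by (metis le_antisym)

lemma reduced_exprD:
  assumes "reduced_expr n w ws"
  shows "w \<in> W n" "set ws \<subseteq> {..<n}" "word_prod ws = w" "length ws = len n w"
proof -
  show 1: "w \<in> W n" "set ws \<subseteq> {..<n}" "word_prod ws = w"
    using assms by (auto simp: reduced_expr_def)
  show "length ws = len n w" using assms reduced_expr_iff[OF 1(1)] by blast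
qed

lemma ex_reduced: "w \<in> W n \<Longrightarrow> \<exists>ws. reduced_expr n w ws"
  using ex_word reduced_expr_iff by blast

lemma len_refl_le:
  assumes "i < n" "w \<in> W n"
  shows "len n (refl_s i \<circ> w) \<le> len n w + 1"
proof -
  obtain ws where "set ws \<subseteq> {..<n}" "word_prod ws = w" "length ws = len n w"
    using ex_word[OF assms(2)] by blast
  then show ?thesis using len_le[of "i # ws" n] assms(1) by auto
qed

text \<open>Exchange deletes a letter from a shortest word. The length cannot drop by more than one,
  because multiplying by \<open>refl_s i\<close> again restores \<open>w\<close>.\<close>

lemma len_ldesc:
  assumes "i < n" "w \<in> W n" "ldesc i w"
  shows "len n w = len n (refl_s i \<circ> w) + 1"
proof -
  obtain ws where ws: "set ws \<subseteq> {..<n}" "word_prod ws = w" "length ws = len n w"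
    using ex_word[OF assms(2)] by blast
  obtain us k vs where "ws = us @ k # vs" "refl_s i \<circ> word_prod ws = word_prod (us @ vs)"
    using exchange[OF ws(1) assms(1)] assms(3) ws(2) by auto
  then have "len n (refl_s i \<circ> w) < len n w"
    using ws len_le[of "us @ vs" n] by auto
  moreover have "len n w \<le> len n (refl_s i \<circ> w) + 1"
    using len_refl_le[of i n "refl_s i \<circ> w"] assms by simp
  ultimately show ?thesis by simp
qed

lemma len_not_ldesc:
  assumes "i < n" "w \<in> W n" "\<not> ldesc i w"
  shows "len n (refl_s i \<circ> w) = len n w + 1"
  using len_ldesc[of i n "refl_s i \<circ> w"] assms by (simp add: ldesc_refl_comp)

lemma ldesc_iff_len: "i < n \<Longrightarrow> w \<in> W n \<Longrightarrow> ldesc i w \<longleftrightarrow> len n (refl_s i \<circ> w) < len n w"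
  using len_ldesc len_not_ldesc by (metis less_add_one less_imp_not_less)

lemma len_id [simp]: "len n id = 0"
  using len_le[of "[]" n] by simp

lemma len_eq_0: "w \<in> W n \<Longrightarrow> len n w = 0 \<longleftrightarrow> w = id"
  using ex_word[of w n] by auto

lemma reduced_Nil [simp]: "reduced_expr n id []"
  by (simp add: reduced_expr_def)

text \<open>Reducedness becomes a chain of descents, so that explicit short words can be checked by
  comparing values of \<open>winv w\<close>.\<close>

lemma reduced_Cons_iff:
  "reduced_expr n w (i # ws) \<longleftrightarrow>
     i < n \<and> w \<in> W n \<and> ldesc i w \<and> reduced_expr n (refl_s i \<circ> w) ws"
proof
  assume *: "reduced_expr n w (i # ws)"
  note r = reduced_exprD[OF *]
  have i: "i < n" and ws: "set ws \<subseteq> {..<n}" using r by auto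
  have eq: "word_prod ws = refl_s i \<circ> w" using r(3) by auto
  have "len n (refl_s i \<circ> w) < len n w" using len_le[OF ws] r(4) eq by auto
  then have d: "ldesc i w" using ldesc_iff_len i r(1) by blast
  then have "length ws = len n (refl_s i \<circ> w)" using len_ldesc[OF i r(1)] r(4) by simp
  then show "i < n \<and> w \<in> W n \<and> ldesc i w \<and> reduced_expr n (refl_s i \<circ> w) ws"
    using i r(1) d ws eq reduced_expr_iff[of "refl_s i \<circ> w" n ws] by simp
next
  assume *: "i < n \<and> w \<in> W n \<and> ldesc i w \<and> reduced_expr n (refl_s i \<circ> w) ws"
  note r = reduced_exprD[of n "refl_s i \<circ> w" ws]
  show "reduced_expr n w (i # ws)"
    using * r len_ldesc[of i n w] reduced_expr_iff[of w n "i # ws"] by auto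
qed

lemma reduced_append_right: "reduced_expr n w (us @ vs) \<Longrightarrow> reduced_expr n (word_prod vs) vs"
proof (induction us arbitrary: w)
  case Nil
  then show ?case using reduced_exprD by fastforce
qed (auto simp: reduced_Cons_iff)

lemma reduced_rev:
  assumes "reduced_expr n w ws"
  shows "reduced_expr n (winv w) (rev ws)"
  unfolding reduced_expr_def
proof (intro conjI allI impI)
  note r = reduced_exprD[OF assms]
  show "set (rev ws) \<subseteq> {..<n}" "word_prod (rev ws) = winv w"
    using r winv_word_prod by auto
  fix vs assume vs: "set vs \<subseteq> {..<n} \<and> word_prod vs = winv w"
  then have "word_prod (rev vs) = w" using winv_word_prod[of vs n] winv_winv[OF r(1)] by simp
  then show "length (rev ws) \<le> length vs"
    using assms vs unfolding reduced_expr_def by (metis length_rev set_rev)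
qed

lemma len_winv: "w \<in> W n \<Longrightarrow> len n (winv w) = len n w"
  using ex_reduced[of w n] reduced_rev[of n w] reduced_exprD(4) by (metis length_rev)

section \<open>Braid moves and Matsumoto's theorem\<close>

inductive braid :: "nat list \<Rightarrow> nat list \<Rightarrow> bool" where
  braid_refl: "braid ws ws"
| braid_trans: "braid us vs \<Longrightarrow> braid vs ws \<Longrightarrow> braid us ws"
| braid_Cons: "braid us vs \<Longrightarrow> braid (i # us) (i # vs)"
| braid_comm: "1 < \<bar>int i - int j\<bar> \<Longrightarrow> braid (i # j # ws) (j # i # ws)"
| braid_3: "\<bar>int i - int j\<bar> = 1 \<Longrightarrow> 0 < i \<Longrightarrow> 0 < j \<Longrightarrow> braid (i # j # i # ws) (j # i # j # ws)"
| braid_4: "braid (0 # 1 # 0 # 1 # ws) (1 # 0 # 1 # 0 # ws)"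
| braid_4': "braid (1 # 0 # 1 # 0 # ws) (0 # 1 # 0 # 1 # ws)"

lemma winv_refl_comp_apply:
  "i < n \<Longrightarrow> w \<in> W n \<Longrightarrow> winv (refl_s i \<circ> w) x = winv w (refl_s i x)"
  by (simp add: winv_refl_comp)

lemma ldesc_comm:
  assumes "i < n" "w \<in> W n" "1 < \<bar>int i - int j\<bar>"
  shows "ldesc j (refl_s i \<circ> w) \<longleftrightarrow> ldesc j w"
proof -
  have "refl_s i (lo j) = lo j" "refl_s i (hi j) = hi j"
    using assms(3) by (auto simp: refl_s_apply lo_def hi_def split: if_splits)
  then show ?thesis by (simp add: ldesc_def winv_refl_comp_apply[OF assms(1,2)])
qed

text \<open>The two descents make \<open>winv w\<close> decreasing on three consecutive numbers.
  Sorting them takes three adjacent swaps, and each swap removes a descent.\<close>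

lemma two_ldesc_3:
  assumes "w \<in> W n" "i < n" "j < n" "0 < i" "0 < j" "\<bar>int i - int j\<bar> = 1" "ldesc i w" "ldesc j w"
  shows "ldesc j (refl_s i \<circ> w)" "ldesc i (refl_s j \<circ> (refl_s i \<circ> w))"
proof -
  have iw: "refl_s i \<circ> w \<in> W n" using assms(1,2) by simp
  note ap = winv_refl_comp_apply[OF assms(2,1)] winv_refl_comp_apply[OF assms(3) iw]
  have "j = i + 1 \<or> i = j + 1" using assms(6) by auto
  then have *: "refl_s i (lo j) = lo j \<and> refl_s i (hi j) = hi i \<and> hi j = lo i
       \<and> refl_s i (refl_s j (lo i)) = lo j \<and> refl_s i (refl_s j (hi i)) = lo i \<or>
     refl_s i (lo j) = lo i \<and> refl_s i (hi j) = hi j \<and> lo j = hi i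
       \<and> refl_s i (refl_s j (lo i)) = hi i \<and> refl_s i (refl_s j (hi i)) = hi j"
    using assms(4,5) by (auto simp: refl_s_apply lo_def hi_def)
  then show "ldesc j (refl_s i \<circ> w)"
    using assms(7,8) unfolding ldesc_def ap by auto
  show "ldesc i (refl_s j \<circ> (refl_s i \<circ> w))"
    using * assms(7,8) unfolding ldesc_def ap by auto
qed

text \<open>The hypotheses amount to \<open>winv w 2 < winv w 1 < 0\<close>, and every descent in
  question is decided by the signs and the order of these two values.\<close>

lemma two_ldesc_4:
  assumes "w \<in> W n" "1 < n" "ldesc 0 w" "ldesc 1 w"
  shows "ldesc 1 (refl_s 0 \<circ> w)" "ldesc 0 (refl_s 1 \<circ> (refl_s 0 \<circ> w))"
    "ldesc 1 (refl_s 0 \<circ> (refl_s 1 \<circ> (refl_s 0 \<circ> w)))"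
    "ldesc 0 (refl_s 1 \<circ> w)" "ldesc 1 (refl_s 0 \<circ> (refl_s 1 \<circ> w))"
    "ldesc 0 (refl_s 1 \<circ> (refl_s 0 \<circ> (refl_s 1 \<circ> w)))"
proof -
  have n0: "0 < n" and n1: "1 < n" using assms(2) by auto
  note ap = winv_refl_comp_apply[OF n0] winv_refl_comp_apply[OF n1, unfolded One_nat_def]
  define x y where "x = winv w 1" and "y = winv w 2"
  have neg: "winv w (- 1) = - x" "winv w (- 2) = - y"
    using W_odd[OF W_winv[OF assms(1)]] by (simp_all add: x_def y_def)
  have lh: "lo 0 = - 1" "hi 0 = 1" "lo (Suc 0) = 1" "hi (Suc 0) = 2" by (auto simp: lo_def hi_def)
  have r: "refl_s 0 1 = - 1" "refl_s 0 (- 1) = 1" "refl_s 0 2 = 2" "refl_s 0 (- 2) = - 2"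
    "refl_s (Suc 0) 1 = 2" "refl_s (Suc 0) 2 = 1" "refl_s (Suc 0) (- 1) = - 2" "refl_s (Suc 0) (- 2) = - 1"
    by (auto simp: refl_s_apply lh)
  have "y < x" "x < - x" using assms(3,4) neg by (auto simp: ldesc_def lh x_def y_def)
  then show "ldesc 1 (refl_s 0 \<circ> w)" "ldesc 0 (refl_s 1 \<circ> (refl_s 0 \<circ> w))"
    "ldesc 1 (refl_s 0 \<circ> (refl_s 1 \<circ> (refl_s 0 \<circ> w)))"
    "ldesc 0 (refl_s 1 \<circ> w)" "ldesc 1 (refl_s 0 \<circ> (refl_s 1 \<circ> w))"
    "ldesc 0 (refl_s 1 \<circ> (refl_s 0 \<circ> (refl_s 1 \<circ> w)))"
    using n0 n1 assms(1) neg by (simp_all add: ldesc_def ap lh r flip: x_def y_def)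
qed

lemma two_ldesc_reduced_3:
  assumes "w \<in> W n" "i < n" "j < n" "0 < i" "0 < j" "\<bar>int i - int j\<bar> = 1" "ldesc i w" "ldesc j w"
    and "reduced_expr n (refl_s i \<circ> (refl_s j \<circ> (refl_s i \<circ> w))) ws"
  shows "reduced_expr n w (i # j # i # ws)"
  using two_ldesc_3[OF assms(1-8)] assms by (simp add: reduced_Cons_iff)

lemma refl_s_fixes: "x \<notin> {lo i, hi i, - lo i, - hi i} \<Longrightarrow> refl_s i x = x"
  by (simp add: refl_s_apply)

lemma refl_s_moves:
  "refl_s i (lo i) = hi i" "refl_s i (hi i) = lo i"
  "refl_s i (- lo i) = - hi i" "refl_s i (- hi i) = - lo i"
  by (auto simp: refl_s_apply lo_def hi_def)

lemma refl_braid_3_aux: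
  assumes "0 < i" "j = Suc i"
  shows "refl_s i (refl_s j (refl_s i x)) = refl_s j (refl_s i (refl_s j x))"
proof -
  define k where "k = int i"
  have k: "k > 0" using assms by (simp add: k_def)
  have l: "lo i = k" "hi i = k + 1" "lo j = k + 1" "hi j = k + 2"
    using assms by (auto simp: lo_def hi_def k_def)
  note m = refl_s_moves[of i, unfolded l] refl_s_moves[of j, unfolded l]
  have f: "refl_s i (k + 2) = k + 2" "refl_s i (- (k + 2)) = - (k + 2)"
    "refl_s j k = k" "refl_s j (- k) = - k"
    by (rule refl_s_fixes; use k in \<open>simp add: l\<close>)+
  show ?thesis
  proof (cases "x \<in> {k, k + 1, k + 2, - k, - (k + 1), - (k + 2)}")
    case True
    then show ?thesis by (elim insertE emptyE) (simp_all only: m f)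
  next
    case False
    then have "refl_s i x = x" "refl_s j x = x" by (auto simp: refl_s_apply l)
    then show ?thesis by simp
  qed
qed

lemma refl_braid_3:
  assumes "0 < i" "0 < j" "\<bar>int i - int j\<bar> = 1"
  shows "refl_s i \<circ> (refl_s j \<circ> (refl_s i \<circ> w)) = refl_s j \<circ> (refl_s i \<circ> (refl_s j \<circ> w))"
proof -
  have "j = Suc i \<or> i = Suc j" using assms by auto
  then have "refl_s i (refl_s j (refl_s i x)) = refl_s j (refl_s i (refl_s j x))" for x
    using refl_braid_3_aux[OF assms(1)] refl_braid_3_aux[OF assms(2)] by metis
  then show ?thesis by auto
qed

lemma refl_comm:
  assumes "1 < \<bar>int i - int j\<bar>"
  shows "refl_s i \<circ> (refl_s j \<circ> w) = refl_s j \<circ> (refl_s i \<circ> w)"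
proof -
  have *: "refl_s i (refl_s j x) = refl_s j (refl_s i x)"
    if x: "x \<in> {lo i, hi i, - lo i, - hi i}" and ij: "1 < \<bar>int i - int j\<bar>" for x i j
  proof -
    have "refl_s i x \<in> {lo i, hi i, - lo i, - hi i}"
      using x by (elim insertE emptyE) (simp_all add: refl_s_moves)
    then have "refl_s j (refl_s i x) = refl_s i x \<and> refl_s j x = x"
      using x ij unfolding insert_iff empty_iff by (intro conjI refl_s_fixes; auto simp: lo_def hi_def split: if_splits)
    then show ?thesis by simp
  qed
  have "refl_s i (refl_s j x) = refl_s j (refl_s i x)" for x
  proof (cases "x \<in> {lo i, hi i, - lo i, - hi i} \<or> x \<in> {lo j, hi j, - lo j, - hi j}")
    case True
    then show ?thesis
    proof
      assume "x \<in> {lo j, hi j, - lo j, - hi j}"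
      then show ?thesis by (rule *[symmetric]) (use assms in simp)
    qed (rule *[OF _ assms])
  next
    case False
    then show ?thesis using refl_s_fixes by metis
  qed
  then show ?thesis by auto
qed

lemma refl_braid_4:
  "refl_s 0 \<circ> (refl_s 1 \<circ> (refl_s 0 \<circ> (refl_s 1 \<circ> w)))
    = refl_s 1 \<circ> (refl_s 0 \<circ> (refl_s 1 \<circ> (refl_s 0 \<circ> w)))"
proof -
  have l: "lo 0 = - 1" "hi 0 = 1" "lo 1 = 1" "hi 1 = 2" by (auto simp: lo_def hi_def)
  note m = refl_s_moves[of 0, unfolded l] refl_s_moves[of 1, unfolded l]
  have f: "refl_s 0 2 = 2" "refl_s 0 (- 2) = - 2" by (auto simp: refl_s_apply l)
  have "refl_s 0 (refl_s 1 (refl_s 0 (refl_s 1 x))) = refl_s 1 (refl_s 0 (refl_s 1 (refl_s 0 x)))" for x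
  proof (cases "x \<in> {1, 2, - 1, - 2}")
    case True
    then show ?thesis by (elim insertE emptyE) (simp_all only: m f)
  next
    case False
    then have "refl_s 0 x = x" "refl_s 1 x = x" by (auto simp: refl_s_apply lo_def hi_def)
    then show ?thesis by simp
  qed
  then show ?thesis by auto
qed

text \<open>Two left descents split off the longest element of the dihedral group that the two
  reflections generate, and its two reduced words are the two sides of a braid move.\<close>

lemma two_ldesc:
  assumes w: "w \<in> W n" and ij: "i < n" "j < n" "i \<noteq> j" and d: "ldesc i w" "ldesc j w"
  shows "\<exists>us vs. reduced_expr n w (i # us) \<and> reduced_expr n w (j # vs) \<and> braid (i # us) (j # vs)"
proof -
  consider "1 < \<bar>int i - int j\<bar>" | "\<bar>int i - int j\<bar> = 1" "0 < i" "0 < j"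
    | "i = 0 \<and> j = 1" | "i = 1 \<and> j = 0"
    using ij by linarith
  then show ?thesis
  proof cases
    case 1
    obtain ws where ws: "reduced_expr n (refl_s j \<circ> (refl_s i \<circ> w)) ws"
      using ex_reduced[of "refl_s j \<circ> (refl_s i \<circ> w)" n] w ij by auto
    have "1 < \<bar>int j - int i\<bar>" using 1 by simp
    then have "reduced_expr n w (i # j # ws)" "reduced_expr n w (j # i # ws)"
      using ldesc_comm[OF ij(1) w 1] ldesc_comm[OF ij(2) w, of i] w ij d ws refl_comm[OF 1, of w]
      by (simp_all add: reduced_Cons_iff)
    then show ?thesis using braid_comm[OF 1] by blast
  next
    case 2
    obtain ws where ws: "reduced_expr n (refl_s i \<circ> (refl_s j \<circ> (refl_s i \<circ> w))) ws"
      using ex_reduced[of "refl_s i \<circ> (refl_s j \<circ> (refl_s i \<circ> w))" n] w ij by auto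
    have ji: "\<bar>int j - int i\<bar> = 1" using 2 by simp
    have "reduced_expr n w (i # j # i # ws)"
      by (rule two_ldesc_reduced_3) (use w ij 2 d ws in auto)
    moreover have "reduced_expr n w (j # i # j # ws)"
      using two_ldesc_reduced_3[OF w ij(2,1) 2(3,2) ji d(2,1)] ws refl_braid_3[OF 2(2,3,1), of w] by simp
    ultimately show ?thesis using braid_3[OF 2] by blast
  next
    case 3
    obtain ws where ws: "reduced_expr n (refl_s 1 \<circ> (refl_s 0 \<circ> (refl_s 1 \<circ> (refl_s 0 \<circ> w)))) ws"
      using ex_reduced[of "refl_s 1 \<circ> (refl_s 0 \<circ> (refl_s 1 \<circ> (refl_s 0 \<circ> w)))" n] w ij 3 by auto
    have "reduced_expr n w (0 # 1 # 0 # 1 # ws)" "reduced_expr n w (1 # 0 # 1 # 0 # ws)"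
      using two_ldesc_4[OF w] ws refl_braid_4[of w] w ij 3 d by (auto simp: reduced_Cons_iff)
    then show ?thesis using braid_4 3 by blast
  next
    case 4
    obtain ws where ws: "reduced_expr n (refl_s 1 \<circ> (refl_s 0 \<circ> (refl_s 1 \<circ> (refl_s 0 \<circ> w)))) ws"
      using ex_reduced[of "refl_s 1 \<circ> (refl_s 0 \<circ> (refl_s 1 \<circ> (refl_s 0 \<circ> w)))" n] w ij 4 by auto
    have "reduced_expr n w (0 # 1 # 0 # 1 # ws)" "reduced_expr n w (1 # 0 # 1 # 0 # ws)"
      using two_ldesc_4[OF w] ws refl_braid_4[of w] w ij 4 d by (auto simp: reduced_Cons_iff)
    then show ?thesis using braid_4' 4 by blast
  qed
qed

text \<open>Words with equal first letters are compared through their tails, which belong to a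
  shorter element. For different first letters \<open>two_ldesc\<close> supplies a bridge: two words
  with these first letters that differ by one move.\<close>

theorem matsumoto:
  assumes "reduced_expr n w us" "reduced_expr n w vs"
  shows "braid us vs"
  using assms
proof (induction "len n w" arbitrary: w us vs)
  case 0
  then have "us = []" "vs = []" using reduced_exprD(4) by fastforce+
  then show ?case by (simp add: braid_refl)
next
  case (Suc l)
  have w: "w \<in> W n" using Suc.prems reduced_exprD by blast
  obtain i us' j vs' where eq: "us = i # us'" "vs = j # vs'"
    using Suc.hyps(2) reduced_exprD(4)[OF Suc.prems(1)] reduced_exprD(4)[OF Suc.prems(2)]
    by (metis length_Suc_conv)
  have tails: "braid (k # xs) (k # ys)"
    if "reduced_expr n w (k # xs)" "reduced_expr n w (k # ys)" for k xs ys
  proof -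
    have "l = len n (refl_s k \<circ> w)"
      using that(1) Suc.hyps(2) len_ldesc[of k n w] by (auto simp: reduced_Cons_iff)
    then show ?thesis
      using Suc.hyps(1)[of "refl_s k \<circ> w" xs ys] that by (auto simp: reduced_Cons_iff intro: braid_Cons)
  qed
  show ?case
  proof (cases "i = j")
    case True
    then show ?thesis using tails Suc.prems eq by simp
  next
    case False
    obtain us'' vs'' where *: "reduced_expr n w (i # us'')" "reduced_expr n w (j # vs'')"
      "braid (i # us'') (j # vs'')"
      using two_ldesc[OF w _ _ False] Suc.prems by (auto simp: eq reduced_Cons_iff)
    show ?thesis
      using tails[OF Suc.prems(1)[unfolded eq] *(1)] tails[OF *(2) Suc.prems(2)[unfolded eq]] *(3)
      by (auto simp: eq intro: braid_trans)
  qed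
qed

section \<open>Right descents and conjugate generators\<close>

lemma ldesc_winv_iff:
  assumes "i < n" "w \<in> W n"
  shows "ldesc i (winv w) \<longleftrightarrow> len n (w \<circ> refl_s i) < len n w"
proof -
  have "len n (refl_s i \<circ> winv w) = len n (w \<circ> refl_s i)"
    using len_winv[of "w \<circ> refl_s i" n] assms by (simp add: winv_comp_refl)
  then show ?thesis using ldesc_iff_len[of i n "winv w"] assms len_winv[of w n] by auto
qed

text \<open>\<open>refl_s 0\<close> sends every number to itself or to its negative, whereas
  \<open>refl_s j\<close> with \<open>j > 0\<close> sends \<open>j\<close> to \<open>j + 1\<close>,
  and conjugation in \<open>W n\<close> preserves this difference. Generators conjugate in this way
  therefore have the same parameter.\<close>

lemma refl_conj_0:
  assumes "w \<in> W n" "refl_s i \<circ> w = w \<circ> refl_s k"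
  shows "i = 0 \<longleftrightarrow> k = 0"
proof -
  have *: "j = 0" if "v \<in> W n" "refl_s 0 \<circ> v = v \<circ> refl_s j" for v j
  proof (rule ccontr)
    assume "j \<noteq> 0"
    then have "refl_s j (int j) = int j + 1" by (simp add: refl_s_apply lo_def hi_def)
    then have "refl_s 0 (v (int j)) = v (int j + 1)" using that(2) by (metis comp_apply)
    moreover have "refl_s 0 (v (int j)) \<in> {v (int j), v (- int j)}"
      using W_odd[OF that(1), of "int j"] by (auto simp: refl_s_apply lo_def hi_def)
    ultimately have "int j + 1 = int j \<or> int j + 1 = - int j"
      using W_eq_iff[OF that(1)] by fastforce
    then show False by simp
  qed
  have "refl_s k \<circ> winv w = winv w \<circ> refl_s i"
  proof -
    have iw: "winv w (w x) = x" "w (winv w x) = x" for x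
      using winv_o[OF assms(1)] by (metis comp_apply id_apply)+
    have "refl_s k (winv w x) = winv w (refl_s i x)" for x
      using fun_cong[OF assms(2), of "winv w x"] iw by (metis comp_apply)
    then show ?thesis by auto
  qed
  then show ?thesis using *[OF assms(1)] *[OF W_winv[OF assms(1)]] assms(2) by metis
qed

section \<open>The coefficient ring\<close>

definition barA :: "'g::linordered_ab_group_add group_ring \<Rightarrow> 'g group_ring" where
  "barA c = Poly_Mapping.map_key uminus c"

lemma inj_uminus_ab: "inj (uminus :: 'g::ab_group_add \<Rightarrow> 'g)"
  by (rule injI) simp

lemma lookup_barA [simp]: "Poly_Mapping.lookup (barA c) \<gamma> = Poly_Mapping.lookup c (- \<gamma>)"
  unfolding barA_def by (subst map_key.rep_eq) (simp_all add: inj_uminus_ab)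

lemma barA_simps [simp]:
  "barA 0 = 0" "barA (c + d) = barA c + barA d" "barA (c - d) = barA c - barA d"
  "barA (- c) = - barA c" "barA (barA c) = c"
  by (rule poly_mapping_eqI; simp add: lookup_add lookup_minus)+

lemma barA_single [simp]: "barA (Poly_Mapping.single \<gamma> k) = Poly_Mapping.single (- \<gamma>) k"
  by (rule poly_mapping_eqI) (auto simp: lookup_single when_def)

lemma poly_mapping_single_induct [case_names zero single add]:
  fixes c :: "'a \<Rightarrow>\<^sub>0 'b::comm_monoid_add"
  assumes "P 0" "\<And>\<gamma> k. P (Poly_Mapping.single \<gamma> k)" "\<And>c d. P c \<Longrightarrow> P d \<Longrightarrow> P (c + d)"
  shows "P c"
proof -
  have "P (\<Sum>\<gamma>\<in>S. Poly_Mapping.single \<gamma> (Poly_Mapping.lookup c \<gamma>))" for S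
    by (induction S rule: infinite_finite_induct) (auto intro: assms)
  moreover have "c = (\<Sum>\<gamma>\<in>Poly_Mapping.keys c. Poly_Mapping.single \<gamma> (Poly_Mapping.lookup c \<gamma>))"
    by (rule poly_mapping_eqI)
      (auto simp: lookup_sum lookup_single when_def in_keys_iff)
  ultimately show ?thesis by metis
qed

lemma barA_mult [simp]: "barA (c * d) = barA c * barA d"
proof (induction c rule: poly_mapping_single_induct)
  case (single \<gamma> k)
  show ?case
    by (induction d rule: poly_mapping_single_induct) (simp_all add: mult_single distrib_left)
qed (simp_all add: distrib_right)

lemma ee_0 [simp]: "ee 0 = 1"
  by (simp add: ee_def)

lemma barA_1 [simp]: "barA 1 = 1"
  by (simp flip: single_one)

lemma ee_add: "ee \<gamma> * ee \<delta> = ee (\<gamma> + \<delta>)"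
  by (simp add: ee_def mult_single)

lemma barA_ee [simp]: "barA (ee \<gamma>) = ee (- \<gamma>)"
  by (simp add: ee_def)

lemma A_pos_iff: "c \<in> A_pos \<longleftrightarrow> (\<forall>\<gamma>\<le>0. Poly_Mapping.lookup c \<gamma> = 0)"
  unfolding A_pos_def mem_Collect_eq Ball_def in_keys_iff by (metis linorder_not_less)

lemma A_pos_0 [simp]: "0 \<in> A_pos"
  by (simp add: A_pos_iff)

lemma A_pos_add [intro]: "c \<in> A_pos \<Longrightarrow> d \<in> A_pos \<Longrightarrow> c + d \<in> A_pos"
  by (simp add: A_pos_iff lookup_add)

lemma A_pos_diff [intro]: "c \<in> A_pos \<Longrightarrow> d \<in> A_pos \<Longrightarrow> c - d \<in> A_pos"
  by (simp add: A_pos_iff lookup_minus)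

lemma A_pos_uminus [intro]: "c \<in> A_pos \<Longrightarrow> - c \<in> A_pos"
  by (simp add: A_pos_iff)

lemma A_pos_ee [intro]: "0 < \<gamma> \<Longrightarrow> ee \<gamma> \<in> A_pos"
  by (auto simp: A_pos_iff ee_def lookup_single when_def)

lemma lookup_ee_mult:
  fixes c :: "'g::linordered_ab_group_add group_ring"
  shows "Poly_Mapping.lookup (ee \<gamma> * c) \<delta> = Poly_Mapping.lookup c (\<delta> - \<gamma>)"
proof (induction c rule: poly_mapping_single_induct)
  case (single \<epsilon> k)
  have "\<gamma> + \<epsilon> = \<delta> \<longleftrightarrow> \<epsilon> = \<delta> - \<gamma>" using eq_diff_eq[of \<epsilon> \<delta> \<gamma>] by (simp add: add.commute)
  then show ?case by (simp add: ee_def mult_single lookup_single when_def)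
qed (simp_all add: distrib_left lookup_add)

lemma A_pos_ee_mult [intro]: "0 \<le> \<gamma> \<Longrightarrow> c \<in> A_pos \<Longrightarrow> ee \<gamma> * c \<in> A_pos"
  by (auto simp: A_pos_iff lookup_ee_mult)

lemma ee_plus_A_pos: "\<gamma> \<le> 0 \<Longrightarrow> c \<in> A_pos \<Longrightarrow> ee \<gamma> + c \<noteq> 0"
proof
  assume *: "\<gamma> \<le> 0" "c \<in> A_pos" "ee \<gamma> + c = 0"
  have "Poly_Mapping.lookup (ee \<gamma> + c) \<gamma> = 1"
    using *(1,2) by (simp add: lookup_add ee_def A_pos_iff)
  then show False unfolding *(3) by simp
qed

text \<open>The support lies among the positive exponents and is symmetric under negation, hence it
  is empty.\<close>

lemma A_pos_bar_inv:
  assumes "c \<in> A_pos" "barA c = c"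
  shows "c = 0"
proof (rule poly_mapping_eqI)
  fix \<gamma>
  have "Poly_Mapping.lookup c \<gamma> = Poly_Mapping.lookup c (- \<gamma>)"
    using assms(2) by (metis lookup_barA)
  then show "Poly_Mapping.lookup c \<gamma> = Poly_Mapping.lookup 0 \<gamma>"
    using assms(1) by (cases "\<gamma> \<le> 0") (auto simp: A_pos_iff)
qed

text \<open>The nonpositive part of \<open>c\<close> is completed symmetrically. The mirror images
  that are added have positive exponents, so they only change the remainder within
  \<open>A_pos\<close>.\<close>

lemma ex_bar_inv: "\<exists>m. barA m = m \<and> c - m \<in> A_pos"
proof (induction c rule: poly_mapping_single_induct)
  case zero
  show ?case by (rule exI[of _ 0]) simp
next
  case (single \<gamma> k)
  consider "\<gamma> > 0" | "\<gamma> = 0" | "\<gamma> < 0" by force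
  then show ?case
  proof cases
    case 1
    then show ?thesis by (intro exI[of _ 0]) (auto simp: A_pos_iff lookup_single when_def)
  next
    case 2
    then show ?thesis by (intro exI[of _ "Poly_Mapping.single 0 k"]) simp
  next
    case 3
    then show ?thesis
      by (intro exI[of _ "Poly_Mapping.single \<gamma> k + Poly_Mapping.single (- \<gamma>) k"])
        (auto simp: A_pos_iff lookup_add lookup_minus lookup_single when_def add.commute)
  qed
next
  case (add c d)
  then obtain m m' where "barA m = m" "c - m \<in> A_pos" "barA m' = m'" "d - m' \<in> A_pos" by blast
  then show ?case by (intro exI[of _ "m + m'"]) (use A_pos_add in \<open>fastforce simp: algebra_simps\<close>)
qed


section \<open>The regular representation\<close>

type_synonym 'g wfun = "(int \<Rightarrow> int) \<Rightarrow> 'g group_ring"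

definition sc :: "'g::linordered_ab_group_add group_ring \<Rightarrow> 'g wfun \<Rightarrow> 'g wfun" where
  "sc c f = (\<lambda>z. c * f z)"

definition delta :: "(int \<Rightarrow> int) \<Rightarrow> 'g::linordered_ab_group_add wfun" where
  "delta w = (\<lambda>z. if z = w then 1 else 0)"

definition lin :: "('g::linordered_ab_group_add wfun \<Rightarrow> 'g wfun) \<Rightarrow> bool" where
  "lin P \<longleftrightarrow> (\<forall>f g. P (f + g) = P f + P g) \<and> (\<forall>c f. P (sc c f) = sc c (P f))"

lemma sc_apply [simp]: "sc c f z = c * f z"
  by (simp add: sc_def)

lemma minus_fun_app [simp]: "(f - g) x = f x - g x" for f g :: "'a \<Rightarrow> 'b::group_add"
  by (simp add: fun_diff_def)

lemma sum_fun_app: "(sum f S) z = (\<Sum>x\<in>S. f x z)" for f :: "'a \<Rightarrow> 'b \<Rightarrow> 'c::comm_monoid_add"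
  by (induction S rule: infinite_finite_induct) auto

lemma sc_simps:
  "sc c (f + g) = sc c f + sc c g" "sc c (f - g) = sc c f - sc c g" "sc c (sc d f) = sc (c * d) f"
  "sc 1 f = f" "sc 0 f = 0" "sc c 0 = 0" "sc (- c) f = - sc c f" "sc (c + d) f = sc c f + sc d f"
  "sc (c - d) f = sc c f - sc d f" "sc c (- f) = - sc c f"
  by (auto simp: fun_eq_iff algebra_simps)

lemma sc_sum: "sc c (sum f S) = (\<Sum>x\<in>S. sc c (f x))"
  by (rule ext) (simp add: sum_fun_app sum_distrib_left)

lemma lin_add: "lin P \<Longrightarrow> P (f + g) = P f + P g"
  and lin_sc: "lin P \<Longrightarrow> P (sc c f) = sc c (P f)"
  by (auto simp: lin_def)

lemma lin_0: "lin P \<Longrightarrow> P 0 = 0"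
  using lin_sc[of P 0 0] by (simp add: sc_simps)

lemma lin_uminus: "lin P \<Longrightarrow> P (- f) = - P f"
  using lin_sc[of P "- 1" f] by (simp add: sc_simps)

lemma lin_diff: "lin P \<Longrightarrow> P (f - g) = P f - P g"
  using lin_add[of P f "- g"] lin_uminus[of P g] by simp

lemma lin_sum: "lin P \<Longrightarrow> P (sum f S) = (\<Sum>x\<in>S. P (f x))"
  by (induction S rule: infinite_finite_induct) (auto simp: lin_0 lin_add)

lemma lin_ident [intro]: "lin (\<lambda>f. f)"
  by (simp add: lin_def)

lemma lin_comp_add [intro]: "lin P \<Longrightarrow> lin Q \<Longrightarrow> lin (\<lambda>f. P f + Q f)"
  and lin_comp_diff [intro]: "lin P \<Longrightarrow> lin Q \<Longrightarrow> lin (\<lambda>f. P f - Q f)"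
  and lin_comp_sc [intro]: "lin P \<Longrightarrow> lin (\<lambda>f. sc c (P f))"
  by (auto simp: lin_def fun_eq_iff algebra_simps)

lemma lin_comp: "lin P \<Longrightarrow> lin Q \<Longrightarrow> lin (\<lambda>f. P (Q f))"
  by (auto simp: lin_def)

lemma delta_apply: "delta w z = (if z = w then 1 else 0)"
  by (simp add: delta_def)

locale hecke_B =
  fixes n :: nat and a b :: "'g::linordered_ab_group_add"
  assumes b_pos: "0 < b" and b_less_a: "b < a"
begin

lemma a_pos: "0 < a"
  using b_pos b_less_a by (rule less_trans)

lemma param_pos: "0 < param a b i"
  using a_pos b_pos by (simp add: param_def)

definition qq :: "nat \<Rightarrow> 'g group_ring" where "qq i = ee (param a b i)"

definition qi :: "nat \<Rightarrow> 'g group_ring" where "qi i = ee (- param a b i)"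

definition xi :: "nat \<Rightarrow> 'g group_ring" where "xi i = qq i - qi i"

lemma qq_qi [simp]: "qq i * qi i = 1" "qi i * qq i = 1"
  by (simp_all add: qq_def qi_def ee_add)

lemma qq_qi_assoc [simp]: "qq i * (qi i * c) = c" "qi i * (qq i * c) = c"
  by (simp_all add: mult.assoc[symmetric])

lemma barA_qq [simp]: "barA (qq i) = qi i" "barA (qi i) = qq i" "barA (xi i) = - xi i"
  by (simp_all add: qq_def qi_def xi_def)

lemma qq_A_pos [intro]: "qq i \<in> A_pos"
  using param_pos by (auto simp: qq_def)

lemma qq_mult_A_pos [intro]: "c \<in> A_pos \<Longrightarrow> qq i * c \<in> A_pos"
  using param_pos[of i] by (auto simp: qq_def)

definition EW :: "'g wfun set" where "EW = {f. \<forall>w. w \<notin> W n \<longrightarrow> f w = 0}"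

text \<open>Left multiplication by \<open>T_i\<close> read off on coefficients:
  \<open>T_i T_z\<close> is \<open>T_{s z}\<close>, plus \<open>xi i\<close> times
  \<open>T_z\<close> when \<open>i\<close> is a left descent of \<open>z\<close>.\<close>

definition Lop :: "nat \<Rightarrow> 'g wfun \<Rightarrow> 'g wfun" where
  "Lop i f = (\<lambda>z. f (refl_s i \<circ> z) + (if ldesc i z then xi i * f z else 0))"

text \<open>The anti-automorphism that sends \<open>T_w\<close> to the basis element of the inverse
  of \<open>w\<close>. Conjugation by it turns left multiplication into right
  multiplication.\<close>

definition iota :: "'g wfun \<Rightarrow> 'g wfun" where
  "iota f = (\<lambda>z. if z \<in> W n then f (winv z) else 0)"

definition Rop :: "nat \<Rightarrow> 'g wfun \<Rightarrow> 'g wfun" where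
  "Rop i f = iota (Lop i (iota f))"

text \<open>By the quadratic relation the inverse of \<open>T_i\<close> is
  \<open>T_i - xi i\<close>.\<close>

definition Linv :: "nat \<Rightarrow> 'g wfun \<Rightarrow> 'g wfun" where
  "Linv i f = Lop i f - sc (xi i) f"

lemma EW_eqI: "f \<in> EW \<Longrightarrow> g \<in> EW \<Longrightarrow> (\<And>z. z \<in> W n \<Longrightarrow> f z = g z) \<Longrightarrow> f = g"
  by (auto simp: fun_eq_iff EW_def) metis

lemma EW_add [intro]: "f \<in> EW \<Longrightarrow> g \<in> EW \<Longrightarrow> f + g \<in> EW"
  and EW_diff [intro]: "f \<in> EW \<Longrightarrow> g \<in> EW \<Longrightarrow> f - g \<in> EW"
  and EW_sc [intro]: "f \<in> EW \<Longrightarrow> sc c f \<in> EW"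
  and EW_0 [intro, simp]: "0 \<in> EW"
  and EW_delta [intro]: "w \<in> W n \<Longrightarrow> delta w \<in> EW"
  and EW_L [intro]: "i < n \<Longrightarrow> f \<in> EW \<Longrightarrow> Lop i f \<in> EW"
  and EW_iota [intro]: "iota f \<in> EW"
  by (auto simp: EW_def delta_apply Lop_def iota_def)

lemma EW_R [intro]: "Rop i f \<in> EW"
  by (auto simp: Rop_def)

lemma EW_Linv [intro]: "i < n \<Longrightarrow> f \<in> EW \<Longrightarrow> Linv i f \<in> EW"
  by (auto simp: Linv_def)

lemma EW_sum [intro]: "(\<And>x. x \<in> S \<Longrightarrow> f x \<in> EW) \<Longrightarrow> sum f S \<in> EW"
  by (induction S rule: infinite_finite_induct) auto

lemma lin_Lop [intro]: "lin (Lop i)"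
  by (auto simp: lin_def Lop_def fun_eq_iff algebra_simps)

lemma lin_iota [intro]: "lin iota"
  by (auto simp: lin_def iota_def fun_eq_iff)

lemma lin_Rop [intro]: "lin (Rop i)"
  unfolding Rop_def[abs_def] by (rule lin_comp[OF lin_iota lin_comp[OF lin_Lop lin_iota]])

lemma lin_Linv [intro]: "lin (Linv i)"
  unfolding Linv_def[abs_def] by (intro lin_comp_diff lin_comp_sc lin_ident lin_Lop)

lemma EW_expand:
  assumes "f \<in> EW"
  shows "f = (\<Sum>w\<in>W n. sc (f w) (delta w))"
proof (rule EW_eqI[OF assms])
  show "(\<Sum>w\<in>W n. sc (f w) (delta w)) \<in> EW" by auto
  show "f z = (\<Sum>w\<in>W n. sc (f w) (delta w)) z" if "z \<in> W n" for z
    using that by (simp add: sum_fun_app delta_apply if_distrib cong: if_cong)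
qed

lemma lin_eqI:
  assumes "lin P" "lin Q" "\<And>w. w \<in> W n \<Longrightarrow> P (delta w) = Q (delta w)" "f \<in> EW"
  shows "P f = Q f"
proof -
  have "P (\<Sum>w\<in>W n. sc (f w) (delta w)) = Q (\<Sum>w\<in>W n. sc (f w) (delta w))"
    unfolding lin_sum[OF assms(1)] lin_sum[OF assms(2)] lin_sc[OF assms(1)] lin_sc[OF assms(2)]
    by (rule sum.cong) (simp_all add: assms(3))
  then show ?thesis using EW_expand[OF assms(4)] by simp
qed

lemma L_delta:
  assumes "i < n" "w \<in> W n"
  shows "Lop i (delta w) = delta (refl_s i \<circ> w) + (if ldesc i w then sc (xi i) (delta w) else 0)"
proof
  fix z
  have "refl_s i \<circ> z = w \<longleftrightarrow> z = refl_s i \<circ> w" by (metis refl_refl_comp(1))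
  then show "Lop i (delta w) z
      = (delta (refl_s i \<circ> w) + (if ldesc i w then sc (xi i) (delta w) else 0)) z"
    by (auto simp: Lop_def delta_apply)
qed

lemma iota_delta [simp]: "w \<in> W n \<Longrightarrow> iota (delta w) = delta (winv w)"
proof
  fix z
  assume "w \<in> W n"
  then show "iota (delta w) z = delta (winv w) z"
    using winv_winv[of w n] winv_winv[of z n] W_winv[of w n] by (auto simp: iota_def delta_apply)
qed

lemma iota_iota [simp]: "f \<in> EW \<Longrightarrow> iota (iota f) = f"
  by (rule EW_eqI[OF EW_iota]) (auto simp: iota_def)

lemma R_delta:
  assumes "i < n" "w \<in> W n"
  shows "Rop i (delta w)
    = delta (w \<circ> refl_s i) + (if ldesc i (winv w) then sc (xi i) (delta w) else 0)"
  using assms L_delta[OF assms(1) W_winv[OF assms(2)]]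
  by (simp add: Rop_def lin_add[OF lin_iota] lin_sc[OF lin_iota] lin_0[OF lin_iota]
      W_winv winv_refl_comp)

lemma iota_L: "f \<in> EW \<Longrightarrow> iota (Lop i f) = Rop i (iota f)"
  by (simp add: Rop_def)

lemma L_quad:
  assumes "i < n" "f \<in> EW"
  shows "Lop i (Lop i f) = f + sc (xi i) (Lop i f)"
proof (rule lin_eqI[OF _ _ _ assms(2)])
  show "lin (\<lambda>f. Lop i (Lop i f))" "lin (\<lambda>f. f + sc (xi i) (Lop i f))"
    by (intro lin_comp[OF lin_Lop] lin_comp_add lin_comp_sc lin_ident lin_Lop)+
  fix w assume w: "w \<in> W n"
  then show "Lop i (Lop i (delta w)) = delta w + sc (xi i) (Lop i (delta w))"
    using assms(1)
    by (simp add: L_delta ldesc_refl_comp lin_add[OF lin_Lop] lin_sc[OF lin_Lop] lin_0[OF lin_Lop]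
        sc_simps)
qed

text \<open>This is associativity of the algebra in disguise. If
  \<open>refl_s i \<circ> w = w \<circ> refl_s j\<close>, both operators act on the same pair of
  basis vectors, and their parameters agree by \<open>refl_conj_0\<close>. Otherwise neither
  multiplication affects the descent that the other one tests.\<close>

lemma LR_comm:
  assumes "i < n" "j < n" "f \<in> EW"
  shows "Lop i (Rop j f) = Rop j (Lop i f)"
proof (rule lin_eqI[OF _ _ _ assms(3)])
  show "lin (\<lambda>f. Lop i (Rop j f))" "lin (\<lambda>f. Rop j (Lop i f))"
    by (intro lin_comp[OF lin_Lop lin_Rop] lin_comp[OF lin_Rop lin_Lop])+
  fix w assume w: "w \<in> W n"
  note s = L_delta R_delta lin_add[OF lin_Lop] lin_sc[OF lin_Lop] lin_0[OF lin_Lop]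
    lin_add[OF lin_Rop] lin_sc[OF lin_Rop] lin_0[OF lin_Rop]
  show "Lop i (Rop j (delta w)) = Rop j (Lop i (delta w))"
  proof (cases "refl_s i \<circ> w = w \<circ> refl_s j")
    case True
    have "param a b i = param a b j"
      using refl_conj_0[OF w True] by (simp add: param_def)
    then have "xi i = xi j" by (simp add: xi_def qq_def qi_def)
    moreover have "ldesc j (winv w) \<longleftrightarrow> ldesc i w"
      using ldesc_winv_iff[OF assms(2) w] ldesc_iff_len[OF assms(1) w] True by simp
    moreover have "ldesc i (w \<circ> refl_s j) \<longleftrightarrow> \<not> ldesc i w"
      using True ldesc_refl_comp[OF assms(1) w] by simp
    moreover have "ldesc j (winv (refl_s i \<circ> w)) \<longleftrightarrow> \<not> ldesc j (winv w)"
      using ldesc_refl_comp[OF assms(2), of "winv w"] w assms True by (simp add: winv_comp_refl W_winv)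
    moreover have "refl_s i \<circ> (w \<circ> refl_s j) = (refl_s i \<circ> w) \<circ> refl_s j" by (simp add: o_assoc)
    ultimately show ?thesis
      using assms(1,2) w True by (simp add: s add.commute add.left_commute)
  next
    case False
    have "ldesc i (w \<circ> refl_s j) \<longleftrightarrow> ldesc i w"
      by (rule ldesc_right_mult[OF w assms(1,2) False])
    moreover have "ldesc j (winv (refl_s i \<circ> w)) \<longleftrightarrow> ldesc j (winv w)"
    proof -
      have "refl_s j \<circ> winv w \<noteq> winv w \<circ> refl_s i"
      proof
        assume "refl_s j \<circ> winv w = winv w \<circ> refl_s i"
        then have "winv (w \<circ> refl_s j) = winv (refl_s i \<circ> w)"
          using w assms by (simp add: winv_comp_refl winv_refl_comp)
        then show False using False w assms winv_winv
          by (metis W_comp_refl refl_comp_W)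
      qed
      then show ?thesis
        using ldesc_right_mult[OF W_winv[OF w] assms(2,1)] w assms(1) by (simp add: winv_refl_comp)
    qed
    moreover have "refl_s i \<circ> (w \<circ> refl_s j) = (refl_s i \<circ> w) \<circ> refl_s j" by (simp add: o_assoc)
    ultimately show ?thesis
      using assms(1,2) w by (auto simp: s sc_simps mult.commute add.commute add.left_commute)
  qed
qed

text \<open>
  The vectors \<open>delta w\<close> are generated from \<open>delta id\<close> by the right operators. An operator that
  commutes with the latter is therefore determined by its value at \<open>delta id\<close>.
\<close>

lemma comm_right_eqI:
  assumes "lin P" "lin Q"
    and "\<And>j f. j < n \<Longrightarrow> f \<in> EW \<Longrightarrow> P (Rop j f) = Rop j (P f)"
    and "\<And>j f. j < n \<Longrightarrow> f \<in> EW \<Longrightarrow> Q (Rop j f) = Rop j (Q f)"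
    and "P (delta id) = Q (delta id)" and "f \<in> EW"
  shows "P f = Q f"
proof (rule lin_eqI[OF assms(1,2) _ assms(6)])
  fix w assume "w \<in> W n"
  then show "P (delta w) = Q (delta w)"
  proof (induction "len n w" arbitrary: w)
    case 0
    then have "w = id" using len_eq_0[OF 0(2)] by metis
    then show ?case using assms(5) by (simp only:)
  next
    case (Suc l)
    then have "winv w \<noteq> id"
      by (metis W_winv len_id len_winv nat.distinct(1))
    then obtain j where j: "j < n" "ldesc j (winv w)"
      using no_ldesc_imp_id[of "winv w" n] Suc.prems by blast
    define v where "v = w \<circ> refl_s j"
    have v: "v \<in> W n" "w = v \<circ> refl_s j" "\<not> ldesc j (winv v)"
      using j Suc.prems ldesc_refl_comp[of j n "winv w"] by (auto simp: v_def winv_comp_refl)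
    have "len n w = len n v + 1"
      using len_ldesc[OF j(1) W_winv[OF Suc.prems] j(2)] len_winv[OF Suc.prems] len_winv[OF v(1)]
        j Suc.prems by (simp add: v_def winv_comp_refl)
    then have "P (delta v) = Q (delta v)" using Suc v by simp
    moreover have "delta w = Rop j (delta v)" using R_delta[OF j(1) v(1)] v by simp
    ultimately show ?case using assms(3,4)[OF j(1) EW_delta[OF v(1)]] by simp
  qed
qed

section \<open>Operators of words\<close>

definition Lw :: "nat list \<Rightarrow> 'g wfun \<Rightarrow> 'g wfun" where "Lw ws f = foldr Lop ws f"

definition Liw :: "nat list \<Rightarrow> 'g wfun \<Rightarrow> 'g wfun" where "Liw ws f = foldr Linv ws f"

lemma Lw_simps [simp]: "Lw [] f = f" "Lw (i # ws) f = Lop i (Lw ws f)" "Lw (us @ vs) f = Lw us (Lw vs f)"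
  by (simp_all add: Lw_def)

lemma Liw_simps [simp]:
  "Liw [] f = f" "Liw (i # ws) f = Linv i (Liw ws f)" "Liw (us @ vs) f = Liw us (Liw vs f)"
  by (simp_all add: Liw_def)

lemma EW_Lw [intro]: "set ws \<subseteq> {..<n} \<Longrightarrow> f \<in> EW \<Longrightarrow> Lw ws f \<in> EW"
  by (induction ws) auto

lemma EW_Liw [intro]: "set ws \<subseteq> {..<n} \<Longrightarrow> f \<in> EW \<Longrightarrow> Liw ws f \<in> EW"
  by (induction ws) auto

lemma lin_Lw [intro]: "lin (Lw ws)"
  by (induction ws) (auto simp: lin_def lin_add[OF lin_Lop] lin_sc[OF lin_Lop])

lemma lin_Liw [intro]: "lin (Liw ws)"
  by (induction ws) (auto simp: lin_def lin_add[OF lin_Linv] lin_sc[OF lin_Linv])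

lemma LwR_comm: "set ws \<subseteq> {..<n} \<Longrightarrow> j < n \<Longrightarrow> f \<in> EW \<Longrightarrow> Lw ws (Rop j f) = Rop j (Lw ws f)"
  by (induction ws) (auto simp: LR_comm EW_Lw)

lemma Lw_delta:
  assumes "reduced_expr n w ws" "v \<in> W n" "len n (w \<circ> v) = len n w + len n v"
  shows "Lw ws (delta v) = delta (w \<circ> v)"
  using assms
proof (induction ws arbitrary: w)
  case Nil
  then have "w = id" using reduced_exprD(3) by fastforce
  then show ?case by simp
next
  case (Cons i ws)
  note r = Cons.prems(1)[unfolded reduced_Cons_iff]
  define u where "u = refl_s i \<circ> w"
  have u: "u \<in> W n" "w = refl_s i \<circ> u" "len n w = len n u + 1" "i < n" "reduced_expr n u ws"
    using r len_ldesc[of i n w] by (auto simp: u_def)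
  have uv: "u \<circ> v \<in> W n" using u Cons.prems by blast
  have wv: "w \<circ> v = refl_s i \<circ> (u \<circ> v)" using u by (simp add: o_assoc)
  have le: "len n (u \<circ> v) \<le> len n u + len n v"
    using ex_word[OF u(1)] ex_word[OF Cons.prems(2)] len_le[of "_ @ _" n]
    by (metis (no_types, lifting) le_sup_iff length_append set_append word_prod_append)
  have le': "len n (w \<circ> v) \<le> len n (u \<circ> v) + 1"
    using len_refl_le[OF u(4) uv] wv by simp
  have len: "len n (u \<circ> v) = len n u + len n v" "len n (w \<circ> v) = len n (u \<circ> v) + 1"
    using le le' u(3) Cons.prems(3) by (auto simp: comp_def)
  have "\<not> ldesc i (u \<circ> v)"
    using len(2) ldesc_iff_len[OF u(4) uv] wv by auto
  then show ?case
    using Cons.IH[OF u(5) Cons.prems(2) len(1)] L_delta[OF u(4) uv] wv by (simp add: comp_def)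
qed

lemma Lw_delta_id: "reduced_expr n w ws \<Longrightarrow> Lw ws (delta id) = delta w"
  using Lw_delta[of w ws id] by simp

text \<open>No braid relation has to be expanded. Operators of left multiplication commute with
  every \<open>Rop j\<close>, so it is enough to compare values at \<open>delta id\<close>, where
  both words give \<open>delta w\<close>.\<close>

lemma L_relation:
  assumes "reduced_expr n w us" "reduced_expr n w vs" "f \<in> EW"
  shows "Lw us f = Lw vs f"
proof (rule comm_right_eqI[OF lin_Lw lin_Lw _ _ _ assms(3)])
  show "Lw us (delta id) = Lw vs (delta id)"
    using assms(1,2) by (simp add: Lw_delta_id)
qed (use assms reduced_exprD in \<open>auto simp: LwR_comm\<close>)

end

section \<open>Semilinear maps and the bar involution on coefficient functions\<close>

definition slin :: "('g::linordered_ab_group_add wfun \<Rightarrow> 'g wfun) \<Rightarrow> bool" where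
  "slin P \<longleftrightarrow> (\<forall>f g. P (f + g) = P f + P g) \<and> (\<forall>c f. P (sc c f) = sc (barA c) (P f))"

lemma slin_add: "slin P \<Longrightarrow> P (f + g) = P f + P g"
  and slin_sc: "slin P \<Longrightarrow> P (sc c f) = sc (barA c) (P f)"
  by (auto simp: slin_def)

lemma slin_0: "slin P \<Longrightarrow> P 0 = 0"
  using slin_sc[of P 0 0] by (simp add: sc_simps)

lemma slin_diff: "slin P \<Longrightarrow> P (f - g) = P f - P g"
  using slin_add[of P f "sc (- 1) g"] slin_sc[of P "- 1" g] by (simp add: sc_simps)

lemma slin_sum: "slin P \<Longrightarrow> P (sum f S) = (\<Sum>x\<in>S. P (f x))"
  by (induction S rule: infinite_finite_induct) (auto simp: slin_0 slin_add)

lemma slin_lin: "slin P \<Longrightarrow> lin Q \<Longrightarrow> slin (\<lambda>f. P (Q f))"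
  and lin_slin: "lin Q \<Longrightarrow> slin P \<Longrightarrow> slin (\<lambda>f. Q (P f))"
  and slin_slin: "slin P \<Longrightarrow> slin R \<Longrightarrow> lin (\<lambda>f. P (R f))"
  by (auto simp: slin_def lin_def)

context hecke_B
begin

lemma slin_eqI:
  assumes "slin P" "slin Q" "\<And>w. w \<in> W n \<Longrightarrow> P (delta w) = Q (delta w)" "f \<in> EW"
  shows "P f = Q f"
proof -
  have "P (\<Sum>w\<in>W n. sc (f w) (delta w)) = Q (\<Sum>w\<in>W n. sc (f w) (delta w))"
    unfolding slin_sum[OF assms(1)] slin_sum[OF assms(2)] slin_sc[OF assms(1)] slin_sc[OF assms(2)]
    by (rule sum.cong) (simp_all add: assms(3))
  then show ?thesis using EW_expand[OF assms(4)] by simp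
qed

lemma Linv_L [simp]: "i < n \<Longrightarrow> f \<in> EW \<Longrightarrow> Linv i (Lop i f) = f"
  by (simp add: Linv_def L_quad)

lemma L_Linv [simp]: "i < n \<Longrightarrow> f \<in> EW \<Longrightarrow> Lop i (Linv i f) = f"
  by (simp add: Linv_def lin_diff[OF lin_Lop] lin_sc[OF lin_Lop] L_quad)

lemma Lw_rev_Liw: "set ws \<subseteq> {..<n} \<Longrightarrow> f \<in> EW \<Longrightarrow> Lw (rev ws) (Liw ws f) = f"
  by (induction ws) (auto simp: EW_Liw)

lemma Liw_Lw_rev: "set ws \<subseteq> {..<n} \<Longrightarrow> f \<in> EW \<Longrightarrow> Liw ws (Lw (rev ws) f) = f"
  by (induction ws arbitrary: f) (auto simp: EW_Lw EW_L)

lemma Linv_relation: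
  assumes "reduced_expr n w us" "reduced_expr n w vs" "f \<in> EW"
  shows "Liw us f = Liw vs f"
proof -
  have s: "set us \<subseteq> {..<n}" "set vs \<subseteq> {..<n}" using assms reduced_exprD by blast+
  have e: "Liw us f \<in> EW" using s(1) assms(3) by (rule EW_Liw)
  have "Liw us f = Liw vs (Lw (rev vs) (Liw us f))"
    using Liw_Lw_rev[OF s(2) e] by simp
  also have "Lw (rev vs) (Liw us f) = Lw (rev us) (Liw us f)"
    using L_relation[OF reduced_rev[OF assms(2)] reduced_rev[OF assms(1)] e] .
  also have "\<dots> = f" by (rule Lw_rev_Liw[OF s(1) assms(3)])
  finally show ?thesis .
qed

text \<open>The same choice of a reduced word as in \<open>T_basis\<close>, so that the coordinates
  of \<open>T_basis n a b w\<close> can be read off directly.\<close>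

definition red_word :: "(int \<Rightarrow> int) \<Rightarrow> nat list" where
  "red_word w = (SOME ws. reduced_expr n w ws)"

lemma reduced_red_word: "w \<in> W n \<Longrightarrow> reduced_expr n w (red_word w)"
  unfolding red_word_def by (rule someI_ex) (rule ex_reduced)

text \<open>Inverting \<open>T_{w^{-1}}\<close> reverses the reversed word, so the bar image of
  \<open>T_w\<close> is the product of the inverses of the generators in the order of a reduced word
  of \<open>w\<close>.\<close>

definition bar_fn :: "'g wfun \<Rightarrow> 'g wfun" where
  "bar_fn f = (\<Sum>w\<in>W n. sc (barA (f w)) (Liw (red_word w) (delta id)))"

lemma slin_bar_fn [intro]: "slin bar_fn"
  by (simp add: slin_def bar_fn_def sc_sum sc_simps sum.distrib)

lemmas bar_fn_simps = slin_add[OF slin_bar_fn] slin_sc[OF slin_bar_fn] slin_diff[OF slin_bar_fn]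
  slin_0[OF slin_bar_fn] slin_sum[OF slin_bar_fn]

lemma EW_delta_id [simp]: "delta id \<in> EW"
  by (intro EW_delta) simp

lemma EW_bar_fn [intro]: "bar_fn f \<in> EW"
  unfolding bar_fn_def by (intro EW_sum EW_sc EW_Liw EW_delta_id reduced_exprD(2)[OF reduced_red_word])

lemma bar_fn_delta:
  assumes "reduced_expr n w ws"
  shows "bar_fn (delta w) = Liw ws (delta id)"
proof -
  have w: "w \<in> W n" using assms reduced_exprD by blast
  have "bar_fn (delta w) = (\<Sum>v\<in>W n. if v = w then Liw (red_word v) (delta id) else 0)"
    unfolding bar_fn_def by (rule sum.cong) (auto simp: delta_apply sc_simps)
  also have "\<dots> = Liw (red_word w) (delta id)" using w by simp
  also have "\<dots> = Liw ws (delta id)"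
    by (rule Linv_relation[OF reduced_red_word[OF w] assms EW_delta_id])
  finally show ?thesis .
qed

lemma bar_fn_delta_id [simp]: "bar_fn (delta id) = delta id"
  using bar_fn_delta[OF reduced_Nil] by simp

text \<open>If multiplication by \<open>refl_s i\<close> increases the length, prepending
  \<open>i\<close> to a reduced word settles the claim. At a descent the same equation for the
  shorter element is solved for its other side with \<open>L_Linv\<close>.\<close>

lemma bar_fn_L:
  assumes i: "i < n" and "f \<in> EW"
  shows "bar_fn (Lop i f) = Linv i (bar_fn f)"
proof (rule slin_eqI[OF _ _ _ assms(2)])
  show "slin (\<lambda>f. bar_fn (Lop i f))" "slin (\<lambda>f. Linv i (bar_fn f))"
    by (rule slin_lin[OF slin_bar_fn lin_Lop] lin_slin[OF lin_Linv slin_bar_fn])+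
  have up: "bar_fn (delta (refl_s i \<circ> v)) = Linv i (bar_fn (delta v))"
    if "v \<in> W n" "\<not> ldesc i v" for v
  proof -
    have "reduced_expr n (refl_s i \<circ> v) (i # red_word v)"
      using that i reduced_red_word[of v] by (simp add: reduced_Cons_iff ldesc_refl_comp)
    then show ?thesis using bar_fn_delta[OF reduced_red_word[OF that(1)]] bar_fn_delta by simp
  qed
  fix w assume w: "w \<in> W n"
  show "bar_fn (Lop i (delta w)) = Linv i (bar_fn (delta w))"
  proof (cases "ldesc i w")
    case True
    define v where "v = refl_s i \<circ> w"
    have v: "v \<in> W n" "\<not> ldesc i v" "w = refl_s i \<circ> v"
      using w i True by (auto simp: v_def ldesc_refl_comp)
    have "bar_fn (delta w) = Linv i (bar_fn (delta v))" using up[OF v(1,2)] v(3) by simp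
    then have "Lop i (bar_fn (delta w)) = bar_fn (delta v)" using i by (simp add: EW_bar_fn)
    then show ?thesis
      using True L_delta[OF i w] by (simp add: bar_fn_simps Linv_def sc_simps flip: v_def)
  next
    case False
    then show ?thesis using up[OF w] L_delta[OF i w] by simp
  qed
qed

lemma bar_fn_Linv:
  assumes "i < n" "f \<in> EW"
  shows "bar_fn (Linv i f) = Lop i (bar_fn f)"
  using bar_fn_L[OF assms] by (simp add: Linv_def bar_fn_simps sc_simps)

lemma bar_fn_Liw: "set ws \<subseteq> {..<n} \<Longrightarrow> f \<in> EW \<Longrightarrow> bar_fn (Liw ws f) = Lw ws (bar_fn f)"
  by (induction ws) (auto simp: bar_fn_Linv EW_Liw)

lemma bar_fn_bar_fn [simp]:
  assumes "f \<in> EW"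
  shows "bar_fn (bar_fn f) = f"
proof (rule lin_eqI[OF _ lin_ident _ assms])
  show "lin (\<lambda>f. bar_fn (bar_fn f))" by (rule slin_slin[OF slin_bar_fn slin_bar_fn])
  fix w assume w: "w \<in> W n"
  note r = reduced_red_word[OF w]
  show "bar_fn (bar_fn (delta w)) = delta w"
    using bar_fn_Liw[OF reduced_exprD(2)[OF r] EW_delta_id] by (simp add: bar_fn_delta[OF r] Lw_delta_id[OF r])
qed

text \<open>Each factor \<open>T_i - xi i\<close> raises the length by at most one, and the full
  length \<open>len n w\<close> is reached only along the word itself. This is the triangularity of
  the bar map.\<close>

lemma Liw_top:
  assumes "reduced_expr n w ws" "u \<in> W n" "len n w \<le> len n u"
  shows "Liw ws (delta id) u = (if u = w then 1 else 0)"
proof -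
  define e where "e = (delta id :: 'g wfun)"
  have "Liw ws e u = (if u = w then 1 else 0)"
    using assms
  proof (induction ws arbitrary: w u)
    case Nil
    then have "w = id" using reduced_exprD(3)[OF Nil(1)] by simp
    then show ?case by (simp only: Liw_simps e_def delta_apply)
  next
    case (Cons i ws)
    note r = Cons.prems(1)[unfolded reduced_Cons_iff]
    define v where "v = refl_s i \<circ> w"
    have v: "reduced_expr n v ws" "len n w = len n v + 1" "i < n"
      using r len_ldesc[of i n w] by (auto simp: v_def)
    have "Liw ws e u = 0"
      using Cons.IH[OF v(1) Cons.prems(2)] Cons.prems(3) v(2) by auto
    moreover have "len n v \<le> len n (refl_s i \<circ> u)"
      using len_refl_le[of i n "refl_s i \<circ> u"] v(2,3) Cons.prems by simp
    then have "Liw ws e (refl_s i \<circ> u) = (if refl_s i \<circ> u = v then 1 else 0)"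
      by (rule Cons.IH[OF v(1), rotated]) (use Cons.prems(2) v(3) refl_comp_W[of i n u] in \<open>simp add: comp_def\<close>)
    moreover have "refl_s i \<circ> u = v \<longleftrightarrow> u = w"
      unfolding v_def by (metis refl_refl_comp(1))
    ultimately show ?case by (simp add: Linv_def Lop_def)
  qed
  then show ?thesis by (simp add: e_def)
qed

lemma bar_fn_top:
  assumes "u \<in> W n" "\<And>y. y \<in> W n \<Longrightarrow> len n u < len n y \<Longrightarrow> f y = 0"
  shows "bar_fn f u = barA (f u)"
proof -
  have "bar_fn f u = (\<Sum>w\<in>W n. if w = u then barA (f u) else 0)"
    unfolding bar_fn_def sum_fun_app
  proof (rule sum.cong)
    fix w assume w: "w \<in> W n"
    show "sc (barA (f w)) (Liw (red_word w) (delta id)) u = (if w = u then barA (f u) else 0)"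
    proof (cases "len n u < len n w")
      case True
      then show ?thesis using assms(2)[OF w] by auto
    next
      case False
      then show ?thesis using Liw_top[OF reduced_red_word[OF w] assms(1)] by auto
    qed
  qed simp
  then show ?thesis using assms(1) by simp
qed

text \<open>
  The top coefficients of a bar invariant vector are bar invariant. So they vanish as soon as
  they are positive.
\<close>

lemma bar_inv_eq_0:
  assumes f: "f \<in> EW" "bar_fn f = f"
    and top: "\<And>z. z \<in> W n \<Longrightarrow> f z \<noteq> 0 \<Longrightarrow>
      (\<And>y. y \<in> W n \<Longrightarrow> len n z < len n y \<Longrightarrow> f y = 0) \<Longrightarrow> k \<le> len n z \<Longrightarrow> f z \<in> A_pos"
    and "u \<in> W n" "k \<le> len n u"
  shows "f u = 0"
proof (rule ccontr)
  assume "f u \<noteq> 0"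
  define S where "S = {y \<in> W n. f y \<noteq> 0}"
  have S: "finite S" "u \<in> S" using \<open>f u \<noteq> 0\<close> assms(4) by (auto simp: S_def)
  then have "Max (len n ` S) \<in> len n ` S" by (intro Max_in) auto
  then obtain z where z: "z \<in> S" "len n z = Max (len n ` S)" by auto
  have max: "f y = 0" if "y \<in> W n" "len n z < len n y" for y
  proof (rule ccontr)
    assume "f y \<noteq> 0"
    then have "len n y \<le> len n z" using that S(1) unfolding z(2) by (auto simp: S_def)
    then show False using that by simp
  qed
  have "len n u \<le> len n z" unfolding z(2) using S by (intro Max_ge) auto
  then have "k \<le> len n z" using assms(5) by (rule order_trans[rotated])
  then have "f z \<in> A_pos" using top[of z] max z(1) by (auto simp: S_def)
  moreover have "barA (f z) = f z" using bar_fn_top[of z f] max z(1) f(2) by (auto simp: S_def)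
  ultimately show False using A_pos_bar_inv z(1) by (auto simp: S_def)
qed


section \<open>The Kazhdan-Lusztig basis\<close>

text \<open>The defining conditions of \<open>C_w\<close> together with a bound on lengths, which
  stands in for the Bruhat order in all triangularity arguments.\<close>

definition isKL :: "(int \<Rightarrow> int) \<Rightarrow> 'g wfun \<Rightarrow> bool" where
  "isKL w f \<longleftrightarrow> f \<in> EW \<and> bar_fn f = f \<and> f w = 1 \<and>
     (\<forall>y\<in>W n. y \<noteq> w \<longrightarrow> f y \<in> A_pos \<and> (f y \<noteq> 0 \<longrightarrow> len n y < len n w))"

definition Cop :: "nat \<Rightarrow> 'g wfun \<Rightarrow> 'g wfun" where
  "Cop i f = Lop i f - sc (qq i) f"

lemma lin_Cop [intro]: "lin (Cop i)"
  unfolding Cop_def[abs_def] by (intro lin_comp_diff lin_comp_sc lin_ident lin_Lop)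

lemma EW_Cop [intro]: "i < n \<Longrightarrow> f \<in> EW \<Longrightarrow> Cop i f \<in> EW"
  by (auto simp: Cop_def)

lemma bar_fn_Cop: "i < n \<Longrightarrow> f \<in> EW \<Longrightarrow> bar_fn (Cop i f) = Cop i (bar_fn f)"
  by (simp add: Cop_def bar_fn_simps bar_fn_L Linv_def xi_def sc_simps)

lemma KL_unique:
  assumes "f \<in> EW" "bar_fn f = f" "g \<in> EW" "bar_fn g = g"
    and "\<And>y. y \<in> W n \<Longrightarrow> f y - g y \<in> A_pos"
  shows "f = g"
proof (rule EW_eqI[OF assms(1,3)])
  fix z assume z: "z \<in> W n"
  have "(f - g) z = 0"
  proof (rule bar_inv_eq_0[where k = 0 and f = "f - g"])
    show "f - g \<in> EW" using assms(1,3) by (rule EW_diff)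
    show "bar_fn (f - g) = f - g" by (simp only: bar_fn_simps assms)
  qed (use assms(5) z in auto)
  then show "f z = g z" by simp
qed

text \<open>Downward induction on \<open>d\<close>: the coefficients at length \<open>d\<close> are
  moved into \<open>A_pos\<close> by subtracting bar invariant multiples of Kazhdan-Lusztig elements
  of that length, whose other terms are all shorter.\<close>

lemma ex_bar_inv_positive:
  assumes KLs: "\<And>y. y \<in> W n \<Longrightarrow> len n y < k \<Longrightarrow> \<exists>g. isKL y g"
    and h: "h \<in> EW" "bar_fn h = h" and "d \<le> k"
  shows "\<exists>g\<in>EW. bar_fn g = g \<and> (\<forall>y\<in>W n. k \<le> len n y \<longrightarrow> g y = h y) \<and>
     (\<forall>y\<in>W n. d \<le> len n y \<and> len n y < k \<longrightarrow> g y \<in> A_pos)"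
  using \<open>d \<le> k\<close>
proof (induction rule: inc_induct)
  case base
  then show ?case using h by (intro bexI[of _ h]) auto
next
  case (step d)
  then obtain g where g: "g \<in> EW" "bar_fn g = g" "\<And>y. y \<in> W n \<Longrightarrow> k \<le> len n y \<Longrightarrow> g y = h y"
    "\<And>y. y \<in> W n \<Longrightarrow> Suc d \<le> len n y \<Longrightarrow> len n y < k \<Longrightarrow> g y \<in> A_pos" by blast
  define S where "S = {y \<in> W n. len n y = d}"
  obtain m where m: "\<And>y. barA (m y) = m y" "\<And>y. g y - m y \<in> A_pos"
    using choice[of "\<lambda>y m. barA m = m \<and> g y - m \<in> A_pos"] ex_bar_inv by blast
  obtain K where K: "\<And>y. y \<in> S \<Longrightarrow> isKL y (K y)"
    using bchoice[of S isKL] KLs step.hyps unfolding S_def by blast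
  define g' where "g' = g - (\<Sum>y\<in>S. sc (m y) (K y))"
  have "g' \<in> EW" unfolding g'_def using g(1) K by (auto simp: isKL_def)
  moreover have "bar_fn g' = g'"
    using g(2) K m(1) by (simp add: g'_def bar_fn_simps isKL_def)
  moreover have hi: "g' z = g z" if "z \<in> W n" "d < len n z" for z
  proof -
    have "(\<Sum>y\<in>S. sc (m y) (K y) z) = 0"
    proof (rule sum.neutral, rule ballI)
      fix y assume y: "y \<in> S"
      then have "y \<noteq> z" "\<not> len n z < len n y" using that by (auto simp: S_def)
      then show "sc (m y) (K y) z = 0" using K[OF y] that(1) by (auto simp: isKL_def)
    qed
    then show ?thesis by (simp add: g'_def sum_fun_app)
  qed
  moreover have "g' z \<in> A_pos" if "z \<in> W n" "len n z = d" for z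
  proof -
    have "(\<Sum>y\<in>S. sc (m y) (K y) z) = (\<Sum>y\<in>S. if y = z then m z else 0)"
    proof (rule sum.cong)
      fix y assume y: "y \<in> S"
      then have "\<not> len n z < len n y" using that by (auto simp: S_def)
      then show "sc (m y) (K y) z = (if y = z then m z else 0)"
        using K[OF y] that(1) by (auto simp: isKL_def)
    qed simp
    also have "\<dots> = m z" using that by (simp add: S_def)
    finally show ?thesis using m(2) by (simp add: g'_def sum_fun_app)
  qed
  ultimately have "g' y \<in> A_pos" if "y \<in> W n" "d \<le> len n y" "len n y < k" for y
    using that g(4)[OF that(1)] by (cases "len n y = d") auto
  moreover have "g' y = h y" if "y \<in> W n" "k \<le> len n y" for y
    using that step.hyps hi[OF that(1)] g(3)[OF that] by simp
  ultimately show ?case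
    using \<open>g' \<in> EW\<close> \<open>bar_fn g' = g'\<close> by blast
qed

text \<open>For \<open>w = refl_s i \<circ> v\<close> the product of \<open>C_i\<close> and
  \<open>C_v\<close> has the right leading term and is bar invariant. Its only defects are
  coefficients at elements shorter than \<open>w\<close>, which \<open>ex_bar_inv_positive\<close>
  corrects.\<close>

lemma isKL_exists: "w \<in> W n \<Longrightarrow> \<exists>f. isKL w f"
proof (induction "len n w" arbitrary: w rule: less_induct)
  case less
  show ?case
  proof (cases "w = id")
    case True
    have "isKL w (delta w)" unfolding isKL_def using less.prems bar_fn_delta_id
      by (auto simp: delta_apply True simp del: id_apply)
    then show ?thesis by blast
  next
    case False
    then obtain i where i: "i < n" "ldesc i w" using no_ldesc_imp_id[OF less.prems] by blast
    define v where "v = refl_s i \<circ> w"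
    have v: "v \<in> W n" "len n w = len n v + 1" "w = refl_s i \<circ> v"
      using less.prems i len_ldesc[OF i(1) less.prems i(2)] by (auto simp: v_def)
    obtain c where c: "isKL v c" using less.hyps[of v] v by auto
    define h where "h = Cop i c"
    have h: "h \<in> EW" "bar_fn h = h" using c i by (auto simp: h_def isKL_def bar_fn_Cop)
    have "c w = 0" using c v less.prems unfolding isKL_def by auto
    then have hw: "h w = 1"
      using c i by (simp add: h_def Cop_def Lop_def isKL_def flip: v_def)
    have h0: "h y = 0" if y: "y \<in> W n" "len n w \<le> len n y" "y \<noteq> w" for y
    proof -
      have "c y = 0" using c y v unfolding isKL_def by auto
      moreover have "refl_s i \<circ> y \<noteq> v" using y(3) unfolding v_def by (metis refl_refl_comp(1))
      moreover have "\<not> len n (refl_s i \<circ> y) < len n v"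
        using y(2) v(2) len_refl_le[of i n "refl_s i \<circ> y"] y(1) i(1) by simp
      ultimately show ?thesis
        using c y(1) i(1) by (auto simp: h_def Cop_def Lop_def isKL_def)
    qed
    obtain g where g: "g \<in> EW" "bar_fn g = g" "\<And>y. y \<in> W n \<Longrightarrow> len n w \<le> len n y \<Longrightarrow> g y = h y"
      "\<And>y. y \<in> W n \<Longrightarrow> len n y < len n w \<Longrightarrow> g y \<in> A_pos"
      using ex_bar_inv_positive[of "len n w" h 0] less.hyps h by auto
    have "isKL w g"
      unfolding isKL_def using g hw h0 less.prems by (metis A_pos_0 linorder_not_less order_refl)
    then show ?thesis by blast
  qed
qed

definition KL :: "(int \<Rightarrow> int) \<Rightarrow> 'g wfun" where "KL w = (SOME f. isKL w f)"

lemma isKL_KL: "w \<in> W n \<Longrightarrow> isKL w (KL w)"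
  unfolding KL_def by (rule someI_ex[OF isKL_exists])

lemma KL_facts:
  assumes "w \<in> W n"
  shows "KL w \<in> EW" "bar_fn (KL w) = KL w" "KL w w = 1"
    "\<And>y. y \<in> W n \<Longrightarrow> y \<noteq> w \<Longrightarrow> KL w y \<in> A_pos"
    "\<And>y. y \<in> W n \<Longrightarrow> y \<noteq> w \<Longrightarrow> len n w \<le> len n y \<Longrightarrow> KL w y = 0"
  using isKL_KL[OF assms] by (auto simp: isKL_def)

lemma KL_eqI:
  assumes "w \<in> W n" "f \<in> EW" "bar_fn f = f" "\<And>y. y \<in> W n \<Longrightarrow> (f - delta w) y \<in> A_pos"
  shows "f = KL w"
proof (rule KL_unique[OF assms(2,3) KL_facts(1,2)[OF assms(1)]])
  fix y assume y: "y \<in> W n"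
  show "f y - KL w y \<in> A_pos"
    using assms(4)[OF y] KL_facts(3,4)[OF assms(1)] y
    by (cases "y = w") (auto simp: delta_apply)
qed

lemma KL_minus_delta:
  assumes "w \<in> W n" "y \<in> W n"
  shows "(KL w - delta w) y \<in> A_pos"
  using KL_facts(3,4)[OF assms(1)] assms(2) by (auto simp: delta_apply)

text \<open>Triangularity peels off one length at a time. The last clause, agreement of the top
  coefficients in both bases, is what later detects a single \<open>KL y\<close> inside a
  product.\<close>

lemma KL_expand:
  assumes "f \<in> EW" "\<And>y. y \<in> W n \<Longrightarrow> k \<le> len n y \<Longrightarrow> f y = 0"
  shows "\<exists>m. f = (\<Sum>z\<in>W n. sc (m z) (KL z)) \<and> (\<forall>z\<in>W n. k \<le> len n z \<longrightarrow> m z = 0) \<and>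
    (\<forall>z\<in>W n. len n z + 1 = k \<longrightarrow> m z = f z)"
  using assms
proof (induction k arbitrary: f)
  case 0
  then have "f = 0" by (intro EW_eqI) auto
  then show ?case by (intro exI[of _ "\<lambda>_. 0"]) (simp add: sc_simps)
next
  case (Suc k)
  define S where "S = {y \<in> W n. len n y = k}"
  define f' where "f' = f - (\<Sum>y\<in>S. sc (f y) (KL y))"
  have "f' \<in> EW" using Suc.prems(1) KL_facts(1) unfolding f'_def S_def by auto
  moreover have "f' z = 0" if z: "z \<in> W n" "k \<le> len n z" for z
  proof -
    have "(\<Sum>y\<in>S. sc (f y) (KL y) z) = (\<Sum>y\<in>S. if y = z then f z else 0)"
      using z KL_facts(3,5) by (intro sum.cong) (auto simp: S_def)
    also have "\<dots> = f z"
      using Suc.prems(2)[OF z(1)] z by (auto simp: S_def)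
    finally show ?thesis by (simp add: f'_def sum_fun_app)
  qed
  ultimately obtain m where m: "f' = (\<Sum>z\<in>W n. sc (m z) (KL z))" "\<forall>z\<in>W n. k \<le> len n z \<longrightarrow> m z = 0"
    using Suc.IH[of f'] by blast
  define m' where "m' z = (if len n z = k then f z else m z)" for z
  have "(\<Sum>z\<in>W n. sc (m' z) (KL z))
      = (\<Sum>z\<in>W n. sc (m z) (KL z)) + (\<Sum>z\<in>W n. if z \<in> S then sc (f z) (KL z) else 0)"
    unfolding sum.distrib[symmetric] using m(2)
    by (intro sum.cong) (auto simp: m'_def S_def sc_simps)
  also have "(\<Sum>z\<in>W n. if z \<in> S then sc (f z) (KL z) else 0) = (\<Sum>z\<in>S. sc (f z) (KL z))"
    by (simp add: S_def sum.inter_filter)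
  also have "(\<Sum>z\<in>W n. sc (m z) (KL z)) + (\<Sum>z\<in>S. sc (f z) (KL z)) = f"
    unfolding m(1)[symmetric] f'_def by simp
  finally have "f = (\<Sum>z\<in>W n. sc (m' z) (KL z))" by (rule sym)
  moreover have "\<forall>z\<in>W n. Suc k \<le> len n z \<longrightarrow> m' z = 0" using m(2) by (auto simp: m'_def)
  moreover have "\<forall>z\<in>W n. len n z + 1 = Suc k \<longrightarrow> m' z = f z" by (auto simp: m'_def)
  ultimately show ?case by blast
qed

lemma KL_expand':
  assumes "f \<in> EW"
  shows "\<exists>m. f = (\<Sum>z\<in>W n. sc (m z) (KL z))"
proof -
  have "len n y \<le> Max (len n ` W n)" if "y \<in> W n" for y using that by simp
  then have "f y = 0" if "y \<in> W n" "Suc (Max (len n ` W n)) \<le> len n y" for y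
    using that by fastforce
  then show ?thesis using KL_expand[OF assms, of "Suc (Max (len n ` W n))"] by blast
qed

text \<open>At a longest \<open>z\<close> with \<open>m z\<close> nonzero no other summand
  contributes, so \<open>f z = m z\<close>, and both would be nonzero.\<close>

lemma KL_sum_eq_0:
  assumes "f = (\<Sum>z\<in>W n. sc (m z) (KL z))" "\<And>z. z \<in> W n \<Longrightarrow> m z = 0 \<or> f z = 0"
  shows "f = 0"
proof (rule ccontr)
  assume "f \<noteq> 0"
  define S where "S = {z \<in> W n. m z \<noteq> 0}"
  have "S \<noteq> {}"
  proof
    assume "S = {}"
    then have "f = 0" unfolding assms(1) by (intro sum.neutral) (auto simp: S_def sc_simps)
    with \<open>f \<noteq> 0\<close> show False by simp
  qed
  then have "Max (len n ` S) \<in> len n ` S" by (intro Max_in) (auto simp: S_def)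
  then obtain z where z: "z \<in> S" "len n z = Max (len n ` S)" by auto
  have "sc (m y) (KL y) z = (if y = z then m z else 0)" if y: "y \<in> W n" for y
  proof (cases "m y = 0 \<or> y = z")
    case False
    then have "len n y \<le> len n z" using z(2) y by (auto simp: S_def)
    then show ?thesis using KL_facts(5)[OF y] z(1) False by (auto simp: S_def)
  qed (use KL_facts(3)[OF y] in \<open>auto simp: sc_simps\<close>)
  then have "f z = m z"
    using z(1) unfolding assms(1) sum_fun_app by (simp add: S_def)
  then show False using z(1) assms(2)[of z] by (auto simp: S_def)
qed


end

section \<open>Left multiplication on the Kazhdan-Lusztig basis\<close>

context hecke_B
begin

text \<open>The vector \<open>x\<close> of \<open>(T_i + q^{-1}) C_w\<close> is bar invariant. Of
  \<open>z\<close> and \<open>refl_s i \<circ> z\<close> the longer one carries \<open>qq i\<close>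
  times the coefficient of the other, so a top coefficient sits at a descent; there it lies in
  \<open>A_pos\<close>. Hence \<open>x\<close> vanishes.\<close>

lemma L_KL_ldesc:
  assumes i: "i < n" and w: "w \<in> W n" and d: "ldesc i w"
  shows "Lop i (KL w) = sc (- qi i) (KL w)"
proof -
  note K = KL_facts[OF w]
  define x where "x = Lop i (KL w) + sc (qi i) (KL w)"
  have xE: "x \<in> EW" using K(1) i by (auto simp: x_def)
  have xb: "bar_fn x = x"
    using i K(1,2) by (simp add: x_def bar_fn_simps bar_fn_L Linv_def xi_def sc_simps)
  have xd: "x z = KL w (refl_s i \<circ> z) + qq i * KL w z" if "ldesc i z" for z
    using that by (simp add: x_def Lop_def xi_def algebra_simps)
  have xpos: "x z \<in> A_pos" if z: "z \<in> W n" "ldesc i z" for z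
  proof -
    have "refl_s i \<circ> z \<noteq> w" using d ldesc_refl_comp[OF i z(1)] z(2) by metis
    then have "KL w (refl_s i \<circ> z) \<in> A_pos" using K(4) z(1) i by simp
    moreover have "qq i * KL w z \<in> A_pos"
      using K(3,4) z(1) by (cases "z = w") auto
    ultimately show ?thesis using xd[OF z(2)] by auto
  qed
  have xu: "x (refl_s i \<circ> z) = qq i * x z" if z: "z \<in> W n" "\<not> ldesc i z" for z
  proof -
    have "x (refl_s i \<circ> z) = KL w z + qq i * KL w (refl_s i \<circ> z)"
      using xd[of "refl_s i \<circ> z"] ldesc_refl_comp[OF i z(1)] z(2) by simp
    moreover have "x z = KL w (refl_s i \<circ> z) + qi i * KL w z"
      using z by (simp add: x_def Lop_def)
    ultimately show ?thesis by (simp add: distrib_left)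
  qed
  have "x = 0"
  proof (rule EW_eqI[OF xE])
    fix u assume u: "u \<in> W n"
    have "x u = 0"
    proof (rule bar_inv_eq_0[OF xE xb _ u, of 0])
      fix z assume z: "z \<in> W n" "x z \<noteq> 0" "\<And>y. y \<in> W n \<Longrightarrow> len n z < len n y \<Longrightarrow> x y = 0"
      have "ldesc i z"
      proof (rule ccontr)
        assume nd: "\<not> ldesc i z"
        then have "qq i * x z = 0"
          using z(3)[of "refl_s i \<circ> z"] xu[OF z(1) nd] len_not_ldesc[OF i z(1) nd] z(1) i by simp
        then have "qi i * (qq i * x z) = 0" by (simp only: mult_zero_right)
        then show False using z(2) by (simp only: qq_qi_assoc)
      qed
      then show "x z \<in> A_pos" using xpos z(1) by blast
    qed simp
    then show "x u = 0 u" by simp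
  qed simp
  then show ?thesis by (simp add: x_def sc_simps eq_neg_iff_add_eq_0)
qed

lemma KL_refl_coeff:
  assumes i: "i < n" and w: "w \<in> W n" and d: "ldesc i w"
  shows "KL w (refl_s i \<circ> w) = - qq i"
proof -
  have "Lop i (KL w) w = - qi i"
    using L_KL_ldesc[OF assms] KL_facts(3)[OF w] by simp
  then show ?thesis using d KL_facts(3)[OF w] by (simp add: Lop_def xi_def algebra_simps eq_neg_iff_add_eq_0)
qed

text \<open>
  The coefficient of \<open>KL (refl_s j \<circ> w)\<close> in \<open>Cop i (KL w)\<close> is congruent modulo \<open>A_pos\<close> to
  the power of \<open>e\<close> with exponent \<open>param a b j - param a b i\<close>.
\<close>

lemma Cop_KL_occurs:
  assumes ij: "i < n" "j < n" and w: "w \<in> W n" and d: "\<not> ldesc i w" "ldesc j w" "ldesc i (refl_s j \<circ> w)"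
    and par: "param a b j \<le> param a b i"
  shows "\<exists>m. Cop i (KL w) = (\<Sum>z\<in>W n. sc (m z) (KL z)) \<and> m (refl_s j \<circ> w) \<noteq> 0"
proof -
  define v y where "v = refl_s i \<circ> w" and "y = refl_s j \<circ> w"
  have v: "v \<in> W n" "len n v = len n w + 1" using ij w d(1) len_not_ldesc by (auto simp: v_def)
  have y: "y \<in> W n" "len n w = len n y + 1" using ij w len_ldesc[OF ij(2) w d(2)] by (auto simp: y_def)
  have dy: "ldesc i y" using d(3) by (simp add: y_def)
  note K = KL_facts[OF w]
  \<comment> \<open>Removing the leading term \<open>KL v\<close> leaves a bar invariant vector
    whose coefficients from length \<open>len n w\<close> on lie in \<open>A_pos\<close>, hence
    vanish. Then \<open>y\<close> has the largest length that can still occur, and there the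
    coefficients in the two bases agree.\<close>
  define h g where "h = Cop i (KL w)" and "g = h - KL v"
  have hE: "h \<in> EW" using K(1) ij by (auto simp: h_def)
  have hb: "bar_fn h = h" using bar_fn_Cop[OF ij(1) K(1)] K(2) by (simp add: h_def)
  have gE: "g \<in> EW" using hE KL_facts(1)[OF v(1)] by (auto simp: g_def)
  have gb: "bar_fn g = g" using hb KL_facts(2)[OF v(1)] by (simp add: g_def bar_fn_simps)
  have inj: "refl_s i \<circ> z = w \<longleftrightarrow> z = v" for z unfolding v_def by (metis refl_refl_comp(1))
  have above: "g z = 0" if z: "z \<in> W n" "len n w < len n z" for z
  proof -
    have "z \<noteq> w" using z(2) by auto
    then have 0: "KL w z = 0" using K(5)[OF z(1)] z(2) by simp
    then have hz: "h z = KL w (refl_s i \<circ> z)" by (simp add: h_def Cop_def Lop_def)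
    show ?thesis
    proof (cases "z = v")
      case True
      then have "refl_s i \<circ> z = w" using inj by simp
      then show ?thesis using hz K(3) KL_facts(3)[OF v(1)] True by (simp add: g_def)
    next
      case False
      have "len n w \<le> len n (refl_s i \<circ> z)"
        using len_refl_le[OF ij(1), of "refl_s i \<circ> z"] z ij(1) by simp
      moreover have "refl_s i \<circ> z \<noteq> w" using inj False by simp
      ultimately have "h z = 0" using K(5)[of "refl_s i \<circ> z"] hz z(1) ij(1) by simp
      moreover have "KL v z = 0" using KL_facts(5)[OF v(1) z(1) False] z(2) v(2) by simp
      ultimately show ?thesis by (simp add: g_def)
    qed
  qed
  have level: "g z \<in> A_pos" if z: "z \<in> W n" "len n z = len n w" for z
  proof -
    have "z \<noteq> v" using z v by auto
    then have "KL v z \<in> A_pos" using KL_facts(4)[OF v(1) z(1)] by simp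
    moreover have "h z \<in> A_pos"
    proof (cases "z = w")
      case True
      have "v \<noteq> w" using v(2) by auto
      then have "KL w v = 0" using K(5)[OF v(1)] v(2) by simp
      then have "h z = - qq i" using True d(1) K(3) by (simp add: h_def Cop_def Lop_def flip: v_def)
      then show ?thesis by auto
    next
      case False
      then have "KL w z = 0" using K(5)[OF z(1)] z(2) by simp
      then have "h z = KL w (refl_s i \<circ> z)" by (simp add: h_def Cop_def Lop_def)
      moreover have "refl_s i \<circ> z \<noteq> w" using inj \<open>z \<noteq> v\<close> by simp
      ultimately show ?thesis using K(4)[of "refl_s i \<circ> z"] z(1) ij(1) by simp
    qed
    ultimately show ?thesis by (auto simp: g_def)
  qed
  have g0: "g z = 0" if "z \<in> W n" "len n w \<le> len n z" for z
  proof (rule bar_inv_eq_0[OF gE gb _ that])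
    fix u assume u: "u \<in> W n" "g u \<noteq> 0" "len n w \<le> len n u"
    then show "g u \<in> A_pos" using above level by (cases "len n u = len n w") force+
  qed
  obtain m where m: "g = (\<Sum>z\<in>W n. sc (m z) (KL z))" "\<forall>z\<in>W n. len n z + 1 = len n w \<longrightarrow> m z = g z"
    using KL_expand[OF gE, of "len n w"] g0 by blast
  have "y \<noteq> v" "y \<noteq> w" using v(2) y(2) by auto
  have "m y \<noteq> 0"
  proof -
    have "len n (refl_s i \<circ> y) < len n w" using len_ldesc[OF ij(1) y(1) dy] y(2) by simp
    then have "refl_s i \<circ> y \<noteq> w" by auto
    then have *: "KL w (refl_s i \<circ> y) \<in> A_pos" using K(4)[of "refl_s i \<circ> y"] y(1) ij(1) by simp
    have "KL w y = - qq j" using KL_refl_coeff[OF ij(2) w d(2)] by (simp add: y_def)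
    then have "h y = KL w (refl_s i \<circ> y) + qi i * qq j"
      using dy by (simp add: h_def Cop_def Lop_def xi_def algebra_simps)
    also have "qi i * qq j = ee (param a b j - param a b i)"
      by (simp add: qi_def qq_def ee_add)
    finally have "g y = ee (param a b j - param a b i) + (KL w (refl_s i \<circ> y) - KL v y)"
      by (simp add: g_def comp_def)
    moreover have "KL w (refl_s i \<circ> y) - KL v y \<in> A_pos"
      using * KL_facts(4)[OF v(1) y(1) \<open>y \<noteq> v\<close>] by auto
    ultimately have "g y \<noteq> 0" using par ee_plus_A_pos[of "param a b j - param a b i"] by simp
    then show ?thesis using m(2) y by simp
  qed
  define m' where "m' z = m z + (if z = v then 1 else 0)" for z
  have "(\<Sum>z\<in>W n. sc (m' z) (KL z)) = g + (\<Sum>z\<in>W n. if z = v then KL v else 0)"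
    unfolding m(1) sum.distrib[symmetric] by (intro sum.cong) (auto simp: m'_def sc_simps)
  also have "\<dots> = h" using v(1) by (simp add: g_def)
  finally show ?thesis using \<open>m y \<noteq> 0\<close> \<open>y \<noteq> v\<close>
    by (intro exI[of _ m']) (simp add: m'_def h_def flip: y_def)
qed

section \<open>Inversion and right multiplication\<close>

lemma iota_Liw:
  assumes "set ws \<subseteq> {..<n}"
  shows "iota (Liw ws (delta id)) = Liw (rev ws) (delta id)"
proof -
  define e where "e = (delta id :: 'g wfun)"
  have e: "e \<in> EW" "iota e = e"
    using iota_delta[of id] winv_word_prod[of "[]" n] by (auto simp: e_def)
  have Re: "Rop i e = Lop i e" if "i < n" for i
    using L_delta[OF that W_id] R_delta[OF that W_id] winv_word_prod[of "[]" n] by (simp add: e_def)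
  have LR: "Liw us (Rop i f) = Rop i (Liw us f)" if "set us \<subseteq> {..<n}" "i < n" "f \<in> EW" for us i f
    using that
    by (induction us) (auto simp: Linv_def LR_comm EW_Liw lin_diff[OF lin_Rop] lin_sc[OF lin_Rop])
  have "iota (Liw ws e) = Liw (rev ws) e"
    using assms
  proof (induction ws)
    case Nil
    then show ?case by (simp add: e)
  next
    case (Cons i ws)
    then have i: "i < n" and s: "set (rev ws) \<subseteq> {..<n}" "set ws \<subseteq> {..<n}" by auto
    \<comment> \<open>\<open>iota\<close> turns the outermost left factor into a right one. This
      commutes with the remaining left factors, reaches \<open>delta id\<close>, and becomes a left
      factor again, now the innermost one.\<close>
    have "iota (Liw (i # ws) e) = Rop i (Liw (rev ws) e) - sc (xi i) (Liw (rev ws) e)"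
      using Cons.IH[OF s(2)] EW_Liw[OF s(2) e(1)]
      by (simp add: Linv_def lin_diff[OF lin_iota] lin_sc[OF lin_iota] iota_L)
    also have "\<dots> = Liw (rev ws) (Lop i e - sc (xi i) e)"
      using LR[OF s(1) i e(1)] Re[OF i] by (simp add: lin_diff[OF lin_Liw] lin_sc[OF lin_Liw])
    finally show ?case by (simp only: Liw_simps rev.simps Linv_def)
  qed
  then show ?thesis by (simp add: e_def)
qed

lemma bar_fn_iota:
  assumes "f \<in> EW"
  shows "bar_fn (iota f) = iota (bar_fn f)"
proof (rule slin_eqI[OF _ _ _ assms])
  show "slin (\<lambda>f. bar_fn (iota f))" "slin (\<lambda>f. iota (bar_fn f))"
    by (rule slin_lin[OF slin_bar_fn lin_iota] lin_slin[OF lin_iota slin_bar_fn])+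
  fix w assume w: "w \<in> W n"
  note r = reduced_red_word[OF w]
  show "bar_fn (iota (delta w)) = iota (bar_fn (delta w))"
    using w by (simp add: bar_fn_delta[OF r] bar_fn_delta[OF reduced_rev[OF r]] iota_Liw[OF reduced_exprD(2)[OF r]])
qed

text \<open>\<open>iota\<close> commutes with the bar map and preserves positivity of coefficients.
  Through this symmetry facts about left multiplication yield their right versions.\<close>

lemma iota_KL:
  assumes "w \<in> W n"
  shows "iota (KL w) = KL (winv w)"
proof (rule KL_eqI[OF W_winv[OF assms] EW_iota])
  show "bar_fn (iota (KL w)) = iota (KL w)"
    using bar_fn_iota KL_facts[OF assms] by simp
  fix y assume y: "y \<in> W n"
  have "iota (delta w) = delta (winv w)" using assms by simp
  then have "(iota (KL w) - delta (winv w)) y = (KL w - delta w) (winv y)"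
    using y by (metis (no_types, lifting) iota_def minus_fun_app)
  then show "(iota (KL w) - delta (winv w)) y \<in> A_pos"
    using KL_minus_delta[OF assms W_winv[OF y]] by simp
qed

definition CRop :: "nat \<Rightarrow> 'g wfun \<Rightarrow> 'g wfun" where "CRop i f = Rop i f - sc (qq i) f"

lemma iota_Cop: "f \<in> EW \<Longrightarrow> iota (Cop i f) = CRop i (iota f)"
  by (simp add: Cop_def CRop_def lin_diff[OF lin_iota] lin_sc[OF lin_iota] iota_L)

lemma CRop_KL_occurs:
  assumes ij: "i < n" "j < n" and w: "w \<in> W n"
    and d: "\<not> ldesc i (winv w)" "ldesc j (winv w)" "ldesc i (winv (w \<circ> refl_s j))"
    and par: "param a b j \<le> param a b i"
  shows "\<exists>m. CRop i (KL w) = (\<Sum>z\<in>W n. sc (m z) (KL z)) \<and> m (w \<circ> refl_s j) \<noteq> 0"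
proof -
  have eq: "refl_s j \<circ> winv w = winv (w \<circ> refl_s j)" using ij w by (simp add: winv_comp_refl)
  obtain m where m: "Cop i (KL (winv w)) = (\<Sum>z\<in>W n. sc (m z) (KL z))" "m (refl_s j \<circ> winv w) \<noteq> 0"
    using Cop_KL_occurs[OF ij W_winv[OF w] d(1,2) _ par] d(3) eq by auto
  have "CRop i (KL w) = iota (Cop i (KL (winv w)))"
    using iota_Cop[OF KL_facts(1)[OF W_winv[OF w]]] iota_KL[OF W_winv[OF w]] w by simp
  also have "\<dots> = (\<Sum>z\<in>W n. sc (m z) (KL (winv z)))"
    unfolding m(1) lin_sum[OF lin_iota] lin_sc[OF lin_iota] by (intro sum.cong) (simp_all add: iota_KL)
  also have "\<dots> = (\<Sum>z\<in>W n. sc (m (winv z)) (KL z))"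
    by (rule sum.reindex_bij_witness[of _ winv winv]) auto
  finally show ?thesis
    using m(2) eq by (intro exI[of _ "\<lambda>z. m (winv z)"]) simp
qed

end

section \<open>The Hecke algebra acts faithfully\<close>

text \<open>Collected in order to be removed from the simplifier, so that identities between
  functions are not evaluated at an argument.\<close>

lemmas pointwise = zero_fun_apply plus_fun_apply minus_fun_app sc_apply comp_apply id_apply

lemma single_Free_Word_Cons:
  "Poly_Mapping.single (Free_Word (i # ws)) c = free_gen i * Poly_Mapping.single (Free_Word ws) c"
  by (simp add: free_gen_def mult_single plus_free_word_def)

lemma free_const_mult_single: "free_const c * Poly_Mapping.single v d = Poly_Mapping.single v (c * d)"
  by (simp add: free_const_def mult_single)

lemma single_mult_free_const: "Poly_Mapping.single v d * free_const c = Poly_Mapping.single v (c * d)"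
  by (simp add: free_const_def mult_single mult.commute)

lemma free_const_commute: "free_const c * p = p * free_const c"
proof (induction p rule: poly_mapping_single_induct)
  case (single \<gamma> k)
  then show ?case by (simp add: free_const_mult_single single_mult_free_const)
qed (simp_all add: distrib_left distrib_right)

lemma free_const_left: "p * (free_const c * q) = free_const c * (p * q)"
  by (metis free_const_commute mult.assoc)

lemma free_const_simps:
  "free_const 1 = 1" "free_const 0 = 0" "free_const (c * d) = free_const c * free_const d"
  "free_const (c + d) = free_const c + free_const d" "free_const (c - d) = free_const c - free_const d"
  by (simp_all add: free_const_def mult_single single_add single_diff)

lemma reduced_braid_3:
  assumes "i < n" "j < n" "0 < i" "0 < j" "\<bar>int i - int j\<bar> = 1"
  shows "reduced_expr n (refl_s i \<circ> (refl_s j \<circ> refl_s i)) [i, j, i]"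
proof -
  note ap = winv_refl_comp_apply[OF assms(1)] winv_refl_comp_apply[OF assms(2)]
  have "j = i + 1 \<or> i = j + 1" using assms(5) by auto
  then have "\<not> ldesc j (refl_s i)" "\<not> ldesc i (refl_s j \<circ> refl_s i)"
    using assms by (auto simp: ldesc_def ap refl_W refl_s_apply lo_def hi_def)
  then show ?thesis
    using assms ldesc_refl_comp[of i n id] by (auto simp: reduced_Cons_iff refl_W ldesc_refl_comp)
qed

lemma reduced_comm:
  assumes "i < n" "j < n" "1 < \<bar>int i - int j\<bar>"
  shows "reduced_expr n (refl_s i \<circ> refl_s j) [i, j]"
proof -
  have "\<not> ldesc i (refl_s j)"
    using assms ldesc_comm[of j n id i] by simp
  then show ?thesis
    using assms ldesc_refl_comp[of j n id] by (auto simp: reduced_Cons_iff refl_W ldesc_refl_comp)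
qed

lemma reduced_01:
  assumes "1 < n"
  shows "reduced_expr n (refl_s 0 \<circ> (refl_s 1 \<circ> (refl_s 0 \<circ> refl_s 1))) [0, 1, 0, 1]"
    "reduced_expr n (refl_s 1 \<circ> (refl_s 0 \<circ> (refl_s 1 \<circ> refl_s 0))) [1, 0, 1, 0]"
    "reduced_expr n (refl_s 1 \<circ> (refl_s 0 \<circ> refl_s 1)) [1, 0, 1]"
proof -
  have n: "0 < n" "Suc 0 < n" using assms by auto
  note ap = winv_refl_comp_apply[OF n(1)] winv_refl_comp_apply[OF n(2)]
  have l: "lo 0 = - 1" "hi 0 = 1" "lo (Suc 0) = 1" "hi (Suc 0) = 2" by (auto simp: lo_def hi_def)
  have m: "refl_s 0 1 = - 1" "refl_s 0 (- 1) = 1" "refl_s 0 2 = 2" "refl_s 0 (- 2) = - 2"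
    "refl_s (Suc 0) 1 = 2" "refl_s (Suc 0) 2 = 1" "refl_s (Suc 0) (- 1) = - 2" "refl_s (Suc 0) (- 2) = - 1"
    by (auto simp: refl_s_apply l)
  have d: "\<not> ldesc 0 (refl_s (Suc 0))" "\<not> ldesc (Suc 0) (refl_s 0)"
    "\<not> ldesc (Suc 0) (refl_s 0 \<circ> refl_s (Suc 0))" "\<not> ldesc 0 (refl_s (Suc 0) \<circ> refl_s 0)"
    "\<not> ldesc 0 (refl_s (Suc 0) \<circ> (refl_s 0 \<circ> refl_s (Suc 0)))"
    "\<not> ldesc (Suc 0) (refl_s 0 \<circ> (refl_s (Suc 0) \<circ> refl_s 0))"
    by (simp_all add: ldesc_def ap refl_W n l m)
  show "reduced_expr n (refl_s 0 \<circ> (refl_s 1 \<circ> (refl_s 0 \<circ> refl_s 1))) [0, 1, 0, 1]"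
    "reduced_expr n (refl_s 1 \<circ> (refl_s 0 \<circ> (refl_s 1 \<circ> refl_s 0))) [1, 0, 1, 0]"
    "reduced_expr n (refl_s 1 \<circ> (refl_s 0 \<circ> refl_s 1)) [1, 0, 1]"
    using n d ldesc_refl_comp[of _ n id]
    by (auto simp: reduced_Cons_iff refl_W ldesc_refl_comp[OF n(1)] ldesc_refl_comp[OF n(2)])
qed

context hecke_B
begin

abbreviation F :: "'g free_alg ring" where "F \<equiv> free_algebra n"
abbreviation I :: "'g free_alg set" where "I \<equiv> hecke_ideal n a b"
abbreviation H :: "'g free_alg set ring" where "H \<equiv> hecke n a b"

lemma F_simps [simp]:
  "x \<otimes>\<^bsub>F\<^esub> y = x * y" "x \<oplus>\<^bsub>F\<^esub> y = x + y" "\<one>\<^bsub>F\<^esub> = 1" "\<zero>\<^bsub>F\<^esub> = 0"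
  by (simp_all add: free_algebra_def)

lemma single_in_F [simp]: "set ws \<subseteq> {..<n} \<Longrightarrow> Poly_Mapping.single (Free_Word ws) c \<in> carrier F"
  by (auto simp: free_algebra_def)

lemma in_F_simps [simp]: "i < n \<Longrightarrow> free_gen i \<in> carrier F" "free_const c \<in> carrier F"
  "(0 :: 'g free_alg) \<in> carrier F"
  by (auto simp: free_gen_def free_const_def zero_free_word_def free_algebra_def)

interpretation F: ring F by (rule ring_free_algebra)

lemma in_F_closed:
  "p \<in> carrier F \<Longrightarrow> q \<in> carrier F \<Longrightarrow> p * q \<in> carrier F"
  "p \<in> carrier F \<Longrightarrow> q \<in> carrier F \<Longrightarrow> p + q \<in> carrier F"
  using F.m_closed[of p q] F.a_closed[of p q] by simp_all

lemma F_uminus: "p \<in> carrier F \<Longrightarrow> - p \<in> carrier F \<and> \<ominus>\<^bsub>F\<^esub> p = - p"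
proof -
  assume p: "p \<in> carrier F"
  then have m: "- p \<in> carrier F" by (simp add: free_algebra_def keys_minus)
  have "- p = \<ominus>\<^bsub>F\<^esub> p"
    by (rule F.minus_equality[symmetric]) (use p m in simp_all)
  with m show ?thesis by simp
qed

lemma F_minus: "p \<in> carrier F \<Longrightarrow> q \<in> carrier F \<Longrightarrow> p - q \<in> carrier F \<and> p \<ominus>\<^bsub>F\<^esub> q = p - q"
  using F_uminus[of q] in_F_closed(2)[of p "- q"] by (simp add: a_minus_def)

lemma in_F_sum: "(\<And>x. x \<in> S \<Longrightarrow> f x \<in> carrier F) \<Longrightarrow> sum f S \<in> carrier F"
  by (induction S rule: infinite_finite_induct) (auto intro: in_F_closed)

lemma carrier_F_induct [consumes 1, case_names zero single add]:
  assumes "p \<in> carrier F" "P 0"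
    "\<And>ws c. set ws \<subseteq> {..<n} \<Longrightarrow> P (Poly_Mapping.single (Free_Word ws) c)"
    "\<And>p q. p \<in> carrier F \<Longrightarrow> q \<in> carrier F \<Longrightarrow> P p \<Longrightarrow> P q \<Longrightarrow> P (p + q)"
  shows "P p"
proof -
  have "(\<Sum>v\<in>S. Poly_Mapping.single v (Poly_Mapping.lookup p v)) \<in> carrier F \<and>
      P (\<Sum>v\<in>S. Poly_Mapping.single v (Poly_Mapping.lookup p v))"
    if "S \<subseteq> Poly_Mapping.keys p" for S
    using finite_subset[OF that finite_keys] that
  proof (induction S rule: finite_induct)
    case (insert v S)
    then have "set (letters v) \<subseteq> {..<n}" using assms(1) by (auto simp: free_algebra_def)
    then have "Poly_Mapping.single v c \<in> carrier F \<and> P (Poly_Mapping.single v c)" for c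
      using single_in_F[of "letters v" c] assms(3)[of "letters v" c] by simp
    then show ?case using insert assms(4) in_F_closed by simp
  qed (simp add: assms(2))
  moreover have "p = (\<Sum>v\<in>Poly_Mapping.keys p. Poly_Mapping.single v (Poly_Mapping.lookup p v))"
    by (rule poly_mapping_eqI) (auto simp: lookup_sum lookup_single when_def in_keys_iff)
  ultimately show ?thesis by (metis order_refl)
qed

section \<open>The free algebra acting on coefficient functions\<close>

definition act :: "'g free_alg \<Rightarrow> 'g wfun \<Rightarrow> 'g wfun" where
  "act p f = (\<Sum>v\<in>Poly_Mapping.keys p. sc (Poly_Mapping.lookup p v) (Lw (letters v) f))"

lemma act_superset:
  assumes "finite S" "Poly_Mapping.keys p \<subseteq> S"
  shows "act p f = (\<Sum>v\<in>S. sc (Poly_Mapping.lookup p v) (Lw (letters v) f))"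
  unfolding act_def using assms
  by (intro sum.mono_neutral_left) (auto simp: in_keys_iff sc_simps)

lemma act_add: "act (p + q) f = act p f + act q f"
proof -
  let ?S = "Poly_Mapping.keys p \<union> Poly_Mapping.keys q"
  have "Poly_Mapping.keys (p + q) \<subseteq> ?S" by (rule Poly_Mapping.keys_add)
  then show ?thesis
    using act_superset[of ?S "p + q" f] act_superset[of ?S p f] act_superset[of ?S q f]
    by (simp add: lookup_add sc_simps sum.distrib)
qed

lemma act_0 [simp]: "act 0 f = 0"
  by (simp add: act_def)

lemma act_diff: "act (p - q) f = act p f - act q f"
  using act_add[of "p - q" q f] by simp

lemma act_single [simp]: "act (Poly_Mapping.single v c) f = sc c (Lw (letters v) f)"
  using act_superset[of "{v}" "Poly_Mapping.single v c" f] by simp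

lemma act_gen [simp]: "act (free_gen i) f = Lop i f"
  by (simp add: free_gen_def sc_simps)

lemma act_const [simp]: "act (free_const c) f = sc c f"
  by (simp add: free_const_def zero_free_word_def)

lemma lin_act [intro]: "lin (act p)"
  by (auto simp: lin_def act_def sum.distrib sc_sum sc_simps mult.commute
      lin_add[OF lin_Lw] lin_sc[OF lin_Lw])

lemma act_mult: "act (p * q) f = act p (act q f)"
proof (induction p rule: poly_mapping_single_induct)
  case (single v k)
  show ?case
    by (induction q rule: poly_mapping_single_induct)
      (simp_all add: mult_single plus_free_word_def lin_sc[OF lin_Lw] lin_add[OF lin_Lw] lin_0[OF lin_Lw]
        sc_simps distrib_left act_add del: pointwise)
qed (simp_all add: distrib_right act_add del: pointwise)

lemma EW_act [intro]:
  assumes "p \<in> carrier F" "f \<in> EW"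
  shows "act p f \<in> EW"
  using assms(1) by (induction rule: carrier_F_induct) (auto simp: act_add assms(2) EW_Lw simp del: pointwise)

lemma actR_comm:
  assumes "p \<in> carrier F" "f \<in> EW" "j < n"
  shows "act p (Rop j f) = Rop j (act p f)"
  using assms(1)
  by (induction rule: carrier_F_induct)
    (auto simp: act_add assms LwR_comm lin_0[OF lin_Rop] lin_sc[OF lin_Rop] lin_add[OF lin_Rop]
      simp del: pointwise)

lemma relators_in_F: "hecke_relators n a b \<subseteq> carrier F"
  unfolding hecke_relators_def
  by (auto intro!: in_F_closed F_minus[THEN conjunct1])

text \<open>Every relator except the quadratic ones is a difference of two reduced words of one
  group element, so \<open>L_relation\<close> treats them uniformly.\<close>

lemma act_relator:
  assumes "r \<in> hecke_relators n a b" "f \<in> EW"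
  shows "act r f = 0"
proof -
  have rel: "act (p - q) f = 0"
    if "reduced_expr n w us" "reduced_expr n w vs" "act p f = Lw us f" "act q f = Lw vs f" for p q w us vs
    using L_relation[OF that(1,2) assms(2)] that(3,4) by (simp add: act_diff)
  consider (1) i where "2 \<le> i" "i < n" "r = free_gen i * free_gen (i - 1) * free_gen i
        - free_gen (i - 1) * free_gen i * free_gen (i - 1)"
    | (2) "1 < n" "r = free_gen 0 * free_gen 1 * free_gen 0 * free_gen 1
        - free_gen 1 * free_gen 0 * free_gen 1 * free_gen 0"
    | (3) i j where "i < n" "j < n" "1 < \<bar>int i - int j\<bar>" "r = free_gen i * free_gen j - free_gen j * free_gen i"
    | (4) i where "i < n" "r = (free_gen i - free_const (qq i)) * (free_gen i + free_const (qi i))"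
    using assms(1) unfolding hecke_relators_def qq_def qi_def by (auto split: if_splits)
  then show ?thesis
  proof cases
    case 1
    have e: "refl_s i \<circ> (refl_s (i - 1) \<circ> refl_s i) = refl_s (i - 1) \<circ> (refl_s i \<circ> refl_s (i - 1))"
      using refl_braid_3[of i "i - 1" id] 1 by simp
    show ?thesis unfolding 1
      by (rule rel[OF reduced_braid_3[of i n "i - 1"] reduced_braid_3[of "i - 1" n i, folded e]])
        (use 1 in \<open>auto simp: act_mult\<close>)
  next
    case 2
    note r = reduced_01[OF 2(1)]
    have e: "refl_s 0 \<circ> (refl_s 1 \<circ> (refl_s 0 \<circ> refl_s 1)) = refl_s 1 \<circ> (refl_s 0 \<circ> (refl_s 1 \<circ> refl_s 0))"
      using refl_braid_4[of id] by simp
    show ?thesis unfolding 2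
      by (rule rel[OF r(1)[unfolded e] r(2)]) (simp_all add: act_mult)
  next
    case 3
    have e: "refl_s i \<circ> refl_s j = refl_s j \<circ> refl_s i" using refl_comm[OF 3(3), of id] by simp
    have ji: "1 < \<bar>int j - int i\<bar>" using 3 by simp
    show ?thesis unfolding 3
      by (rule rel[OF reduced_comm[OF 3(1-3)] reduced_comm[OF 3(2,1) ji, folded e]]) (simp_all add: act_mult)
  next
    case 4
    have "act r f = Lop i (Lop i f) + sc (qi i) (Lop i f) - sc (qq i) (Lop i f) - f"
      unfolding 4(2) act_mult act_add act_diff act_gen act_const
      by (simp add: lin_add[OF lin_Lop] lin_sc[OF lin_Lop] sc_simps)
    then show ?thesis using L_quad[OF 4(1) assms(2)] by (simp add: xi_def sc_simps)
  qed
qed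

lemma I_genideal: "I = genideal F (hecke_relators n a b)"
  by (simp add: hecke_ideal_def)

interpretation I: ideal I F
  unfolding I_genideal by (rule F.genideal_ideal[OF relators_in_F])

lemma relator_in_I: "r \<in> hecke_relators n a b \<Longrightarrow> r \<in> I"
  using F.genideal_self[OF relators_in_F] I_genideal by auto

lemma I_add: "p \<in> I \<Longrightarrow> q \<in> I \<Longrightarrow> p + q \<in> I"
  using I.a_closed[of p q] by simp

lemma I_0 [simp]: "0 \<in> I"
  using I.zero_closed by simp

lemma I_mult: "p \<in> I \<Longrightarrow> q \<in> carrier F \<Longrightarrow> q * p \<in> I" "p \<in> I \<Longrightarrow> q \<in> carrier F \<Longrightarrow> p * q \<in> I"
  using I.I_l_closed[of p q] I.I_r_closed[of p q] by simp_all

lemma I_uminus: "p \<in> I \<Longrightarrow> - p \<in> I"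
proof -
  assume "p \<in> I"
  then have "free_const (- 1) * p \<in> I" by (rule I_mult(1)) simp
  moreover have "free_const (- 1) = (- 1 :: 'g free_alg)"
    using free_const_simps(5)[of 0 1] by (simp add: free_const_simps(1,2))
  ultimately show ?thesis by (simp only: mult_minus1)
qed

lemma I_diff: "p \<in> I \<Longrightarrow> q \<in> I \<Longrightarrow> p - q \<in> I"
  using I_add[OF _ I_uminus] by fastforce

lemma I_sum: "(\<And>x. x \<in> S \<Longrightarrow> f x \<in> I) \<Longrightarrow> sum f S \<in> I"
  by (induction S rule: infinite_finite_induct) (auto intro: I_add)

text \<open>The elements of the free algebra that annihilate all of \<open>EW\<close> form a
  two-sided ideal containing the relators.\<close>

lemma act_I:
  assumes "p \<in> I" "f \<in> EW"
  shows "act p f = 0"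
proof -
  let ?K = "{p \<in> carrier F. \<forall>f\<in>EW. act p f = 0}"
  have "ideal ?K F"
  proof (rule idealI[OF ring_free_algebra])
    show "subgroup ?K (add_monoid F)"
    proof
      fix x assume "x \<in> ?K"
      then have "\<ominus>\<^bsub>F\<^esub> x \<in> ?K"
        using F_uminus[of x] act_diff[of 0 x] by auto
      then show "inv\<^bsub>add_monoid F\<^esub> x \<in> ?K" by (simp add: a_inv_def)
    qed (auto simp: act_add in_F_closed)
  next
    fix x y assume *: "x \<in> ?K" "y \<in> carrier F"
    then show "y \<otimes>\<^bsub>F\<^esub> x \<in> ?K" "x \<otimes>\<^bsub>F\<^esub> y \<in> ?K"
      by (auto simp: act_mult in_F_closed EW_act lin_0[OF lin_act])
  qed
  moreover have "hecke_relators n a b \<subseteq> ?K"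
    using relators_in_F act_relator by auto
  ultimately have "I \<subseteq> ?K" unfolding I_genideal by (rule F.genideal_minimal)
  then show ?thesis using assms by auto
qed

lemma braid_set: "braid us vs \<Longrightarrow> set us = set vs"
  by (induction rule: braid.induct) auto

lemma braid_in_I:
  assumes "braid us vs" "set us \<subseteq> {..<n}"
  shows "Poly_Mapping.single (Free_Word us) 1 - Poly_Mapping.single (Free_Word vs) 1 \<in> I"
  using assms
proof (induction rule: braid.induct)
  case (braid_trans us vs ws)
  then have "set vs \<subseteq> {..<n}" using braid_set by simp
  then have "(Poly_Mapping.single (Free_Word us) 1 - Poly_Mapping.single (Free_Word vs) 1) +
      (Poly_Mapping.single (Free_Word vs) 1 - Poly_Mapping.single (Free_Word ws) 1) \<in> I"
    using braid_trans by (intro I_add) auto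
  then show ?case by simp
next
  case (braid_Cons us vs i)
  then have "free_gen i * (Poly_Mapping.single (Free_Word us) 1 - Poly_Mapping.single (Free_Word vs) 1) \<in> I"
    by (intro I_mult) auto
  then show ?case by (simp add: single_Free_Word_Cons right_diff_distrib)
next
  case (braid_comm i j ws)
  then have "free_gen i * free_gen j - free_gen j * free_gen i \<in> I"
    by (intro relator_in_I) (auto simp: hecke_relators_def)
  then have "(free_gen i * free_gen j - free_gen j * free_gen i) * Poly_Mapping.single (Free_Word ws) 1 \<in> I"
    using braid_comm by (intro I_mult) auto
  then show ?case by (simp add: single_Free_Word_Cons left_diff_distrib mult.assoc)
next
  case (braid_3 i j ws)
  have *: "free_gen i * free_gen j * free_gen i - free_gen j * free_gen i * free_gen j \<in> I"
    if "i = Suc j" "0 < j" "i < n" for i j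
  proof (rule relator_in_I)
    have "2 \<le> i" "j = i - 1" using that by auto
    then show "free_gen i * free_gen j * free_gen i - free_gen j * free_gen i * free_gen j \<in> hecke_relators n a b"
      using that(3) unfolding hecke_relators_def by blast
  qed
  have "free_gen i * free_gen j * free_gen i - free_gen j * free_gen i * free_gen j \<in> I"
  proof (cases "i = Suc j")
    case True
    then show ?thesis using *[of i j] braid_3 by auto
  next
    case False
    then have "j = Suc i" using braid_3 by auto
    then have "free_gen j * free_gen i * free_gen j - free_gen i * free_gen j * free_gen i \<in> I"
      using *[of j i] braid_3 by auto
    from I_uminus[OF this] show ?thesis by simp
  qed
  then have "(free_gen i * free_gen j * free_gen i - free_gen j * free_gen i * free_gen j)
      * Poly_Mapping.single (Free_Word ws) 1 \<in> I"
    using braid_3 by (intro I_mult) auto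
  then show ?case by (simp add: single_Free_Word_Cons left_diff_distrib mult.assoc)
next
  case (braid_4 ws)
  then have "free_gen 0 * free_gen 1 * free_gen 0 * free_gen 1
        - free_gen 1 * free_gen 0 * free_gen 1 * free_gen 0 \<in> I"
    by (intro relator_in_I) (auto simp: hecke_relators_def)
  then have "(free_gen 0 * free_gen 1 * free_gen 0 * free_gen 1
        - free_gen 1 * free_gen 0 * free_gen 1 * free_gen 0) * Poly_Mapping.single (Free_Word ws) 1 \<in> I"
    using braid_4 by (intro I_mult) auto
  then show ?case by (simp add: single_Free_Word_Cons left_diff_distrib mult.assoc)
next
  case (braid_4' ws)
  then have "free_gen 0 * free_gen 1 * free_gen 0 * free_gen 1
        - free_gen 1 * free_gen 0 * free_gen 1 * free_gen 0 \<in> I"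
    by (intro relator_in_I) (auto simp: hecke_relators_def)
  then have "(free_gen 0 * free_gen 1 * free_gen 0 * free_gen 1
        - free_gen 1 * free_gen 0 * free_gen 1 * free_gen 0) * Poly_Mapping.single (Free_Word ws) 1 \<in> I"
    using braid_4' by (intro I_mult) auto
  from I_uminus[OF this] show ?case by (simp add: single_Free_Word_Cons left_diff_distrib mult.assoc)
qed simp

section \<open>Normal forms modulo the Hecke ideal\<close>

definition free_lift :: "'g wfun \<Rightarrow> 'g free_alg" where
  "free_lift f = (\<Sum>w\<in>W n. Poly_Mapping.single (Free_Word (red_word w)) (f w))"

lemma free_lift_in_F [simp]: "free_lift f \<in> carrier F"
  unfolding free_lift_def by (intro in_F_sum single_in_F reduced_exprD(2)[OF reduced_red_word])

lemma act_sum: "act (sum g S) f = (\<Sum>x\<in>S. act (g x) f)"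
  by (induction S rule: infinite_finite_induct) (auto simp: act_add simp del: pointwise)

lemma act_free_lift: "f \<in> EW \<Longrightarrow> act (free_lift f) (delta id) = f"
  unfolding free_lift_def act_sum act_single
  using EW_expand[of f] by (simp add: Lw_delta_id[OF reduced_red_word])

lemma free_lift_0 [simp]: "free_lift 0 = 0"
  by (simp add: free_lift_def)

lemma free_lift_add: "free_lift (f + g) = free_lift f + free_lift g"
  by (simp add: free_lift_def single_add sum.distrib)

lemma free_lift_sc: "free_lift (sc c f) = free_const c * free_lift f"
  by (simp add: free_lift_def sum_distrib_left free_const_mult_single)

lemma free_lift_delta: "w \<in> W n \<Longrightarrow> free_lift (delta w) = Poly_Mapping.single (Free_Word (red_word w)) 1"
proof -
  assume w: "w \<in> W n"
  have "free_lift (delta w) = (\<Sum>v\<in>W n. if v = w then Poly_Mapping.single (Free_Word (red_word v)) 1 else 0)"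
    unfolding free_lift_def by (rule sum.cong) (auto simp: delta_apply)
  then show ?thesis using w by simp
qed

lemma free_lift_sum: "free_lift (sum g S) = (\<Sum>x\<in>S. free_lift (g x))"
  by (induction S rule: infinite_finite_induct) (auto simp: free_lift_add simp del: pointwise)

lemma gen_free_lift_delta:
  assumes i: "i < n" and w: "w \<in> W n"
  shows "free_gen i * free_lift (delta w) - free_lift (Lop i (delta w)) \<in> I"
proof -
  have up: "free_gen i * free_lift (delta v) - free_lift (delta (refl_s i \<circ> v)) \<in> I"
    if v: "v \<in> W n" "\<not> ldesc i v" for v
  proof -
    have r: "reduced_expr n (refl_s i \<circ> v) (i # red_word v)"
      using that i reduced_red_word[of v] by (simp add: reduced_Cons_iff ldesc_refl_comp)
    have sv: "refl_s i \<circ> v \<in> W n" using v i by simp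
    have "Poly_Mapping.single (Free_Word (i # red_word v)) 1 -
        Poly_Mapping.single (Free_Word (red_word (refl_s i \<circ> v))) 1 \<in> I"
      by (rule braid_in_I[OF matsumoto[OF r reduced_red_word[OF sv]] reduced_exprD(2)[OF r]])
    then show ?thesis by (simp add: free_lift_delta v sv single_Free_Word_Cons)
  qed
  show ?thesis
  proof (cases "ldesc i w")
    case True
    define v where "v = refl_s i \<circ> w"
    have v: "v \<in> W n" "\<not> ldesc i v" "refl_s i \<circ> v = w"
      using w i True by (auto simp: v_def ldesc_refl_comp)
    let ?g = "free_gen i :: 'g free_alg" and ?t = "free_lift (delta v)" and ?u = "free_lift (delta w)"
    have 1: "?g * ?t - ?u \<in> I" using up[OF v(1,2)] v(3) by simp
    have 2: "(?g - free_const (qq i)) * (?g + free_const (qi i)) \<in> I"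
      by (rule relator_in_I) (use i in \<open>auto simp: hecke_relators_def qq_def qi_def\<close>)
    have q: "(?g - free_const (qq i)) * (?g + free_const (qi i)) = ?g * ?g - free_const (xi i) * ?g - 1"
    proof -
      have "free_const (qq i) * free_const (qi i) = (1 :: 'g free_alg)"
        by (simp flip: free_const_simps)
      then show ?thesis
        by (simp add: algebra_simps xi_def free_const_simps free_const_commute[of _ "?g"])
    qed
    \<comment> \<open>Modulo the ideal \<open>?g * ?t\<close> is \<open>?u\<close> and
      \<open>?g * ?g\<close> is \<open>xi i\<close> times \<open>?g\<close> plus 1; this combination
      cancels all terms except those of the desired rule for \<open>?g * ?u\<close>.\<close>
    have "(?g * ?g - free_const (xi i) * ?g - 1) * ?t - ?g * (?g * ?t - ?u)
        + free_const (xi i) * (?g * ?t - ?u) \<in> I"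
      using I_mult(2)[OF 2[unfolded q] free_lift_in_F] I_mult(1)[OF 1, of ?g] I_mult(1)[OF 1, of "free_const (xi i)"] i
      by (intro I_add I_diff) simp_all
    also have "(?g * ?g - free_const (xi i) * ?g - 1) * ?t - ?g * (?g * ?t - ?u)
        + free_const (xi i) * (?g * ?t - ?u) = ?g * ?u - (?t + free_const (xi i) * ?u)"
      by (simp add: algebra_simps)
    finally show ?thesis
      using L_delta[OF i w] True by (simp add: free_lift_add free_lift_sc flip: v_def)
  next
    case False
    then show ?thesis using up[OF w] L_delta[OF i w] by simp
  qed
qed

lemma gen_free_lift:
  assumes i: "i < n" and f: "f \<in> EW"
  shows "free_gen i * free_lift f - free_lift (Lop i f) \<in> I"
proof -
  let ?f = "\<Sum>w\<in>W n. sc (f w) (delta w)"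
  have "free_gen i * free_lift ?f - free_lift (Lop i ?f)
      = (\<Sum>w\<in>W n. free_const (f w) * (free_gen i * free_lift (delta w) - free_lift (Lop i (delta w))))"
    unfolding lin_sum[OF lin_Lop] lin_sc[OF lin_Lop] free_lift_sum free_lift_sc sum_distrib_left sum_subtractf[symmetric]
    by (intro sum.cong refl) (simp add: right_diff_distrib free_const_left)
  also have "\<dots> \<in> I"
    by (intro I_sum I_mult(1) gen_free_lift_delta i) auto
  finally show ?thesis using EW_expand[OF f] by simp
qed

lemma red_word_id: "red_word id = []"
  using reduced_exprD(4)[OF reduced_red_word[of id]] by simp

text \<open>Modulo the ideal the lifts along chosen reduced words are closed under left
  multiplication by generators, so that they absorb any word letter by letter.\<close>

lemma spanning:
  assumes "p \<in> carrier F"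
  shows "\<exists>f\<in>EW. p - free_lift f \<in> I"
  using assms
proof (induction rule: carrier_F_induct)
  case zero
  show ?case by (rule bexI[of _ 0]) (simp_all del: pointwise)
next
  case (single ws c)
  then show ?case
  proof (induction ws)
    case Nil
    have "free_lift (sc c (delta id)) = Poly_Mapping.single (Free_Word []) c"
      using free_lift_delta[OF W_id] by (simp add: free_lift_sc red_word_id free_const_mult_single)
    then show ?case by (intro bexI[of _ "sc c (delta id)"]) (auto simp del: pointwise)
  next
    case (Cons i ws)
    then obtain f where f: "f \<in> EW" "Poly_Mapping.single (Free_Word ws) c - free_lift f \<in> I" by auto
    have i: "i < n" using Cons.prems by simp
    have "free_gen i * (Poly_Mapping.single (Free_Word ws) c - free_lift f) +
        (free_gen i * free_lift f - free_lift (Lop i f)) \<in> I"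
      using f i by (intro I_add I_mult gen_free_lift) auto
    then have "Poly_Mapping.single (Free_Word (i # ws)) c - free_lift (Lop i f) \<in> I"
      by (simp add: single_Free_Word_Cons right_diff_distrib)
    then show ?case using f i by auto
  qed
next
  case (add p q)
  then obtain f g where f: "f \<in> EW" "p - free_lift f \<in> I" and g: "g \<in> EW" "q - free_lift g \<in> I" by blast
  have "(p + q) - free_lift (f + g) \<in> I"
    using I_add[OF f(2) g(2)] by (simp add: free_lift_add algebra_simps)
  then show ?case using f g by blast
qed

text \<open>Reducing \<open>p\<close> to some \<open>free_lift f\<close> loses nothing, because the
  action at \<open>delta id\<close> recovers \<open>f\<close>. This is the faithfulness of the
  action, and with it the independence of the \<open>T_w\<close>.\<close>

lemma in_I_iff:
  assumes "p \<in> carrier F"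
  shows "p \<in> I \<longleftrightarrow> act p (delta id) = 0"
proof
  assume *: "act p (delta id) = 0"
  obtain f where f: "f \<in> EW" "p - free_lift f \<in> I" using spanning[OF assms] by blast
  have "act (p - free_lift f) (delta id) = 0" using act_I[OF f(2)] by simp
  then have "f = 0" using * act_free_lift[OF f(1)] by (simp add: act_diff)
  then show "p \<in> I" using f(2) by simp
qed (simp add: act_I)

end

section \<open>Coordinates of the Hecke algebra in the basis \<open>T_w\<close>\<close>

context hecke_B
begin

interpretation F: ring F by (rule ring_free_algebra)
interpretation I: ideal I F unfolding I_genideal by (rule F.genideal_ideal[OF relators_in_F])
interpretation H: ring H unfolding hecke_def by (rule I.quotient_is_ring)

definition cl :: "'g free_alg \<Rightarrow> 'g free_alg set" where "cl p = I +>\<^bsub>F\<^esub> p"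

lemma carrier_H: "carrier H = cl ` carrier F"
  by (auto simp: hecke_def FactRing_def A_RCOSETS_def' cl_def)

lemma cl_in_H [simp]: "p \<in> carrier F \<Longrightarrow> cl p \<in> carrier H"
  by (simp add: carrier_H)

lemma H_cases: "U \<in> carrier H \<Longrightarrow> (\<And>p. p \<in> carrier F \<Longrightarrow> U = cl p \<Longrightarrow> P) \<Longrightarrow> P"
  by (auto simp: carrier_H)

lemma cl_mult: "p \<in> carrier F \<Longrightarrow> q \<in> carrier F \<Longrightarrow> cl p \<otimes>\<^bsub>H\<^esub> cl q = cl (p * q)"
  using I.rcoset_mult_add[of p q] by (simp add: hecke_def FactRing_def cl_def)

lemma cl_add: "p \<in> carrier F \<Longrightarrow> q \<in> carrier F \<Longrightarrow> cl p \<oplus>\<^bsub>H\<^esub> cl q = cl (p + q)"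
  using I.a_rcos_sum[of p q] by (simp add: hecke_def FactRing_def cl_def)

lemma cl_1: "\<one>\<^bsub>H\<^esub> = cl 1"
  by (simp add: hecke_def FactRing_def cl_def)

lemma one_in_F [simp]: "(1 :: 'g free_alg) \<in> carrier F"
  using F.one_closed by simp

lemma cl_eq_iff:
  assumes "p \<in> carrier F" "q \<in> carrier F"
  shows "cl p = cl q \<longleftrightarrow> act p (delta id) = act q (delta id)"
proof -
  have "cl p = cl q \<longleftrightarrow> p - q \<in> I"
    using F.quotient_eq_iff_same_a_r_cos[OF I.is_ideal assms] F_minus[OF assms] by (simp add: cl_def)
  then show ?thesis using in_I_iff[of "p - q"] F_minus[OF assms] by (simp add: act_diff)
qed

text \<open>The coordinates of a class are obtained by applying a representative to the vector of
  the unit element. By \<open>cl_eq_iff\<close> the choice of the representative does not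
  matter.\<close>

definition T_coeff :: "'g free_alg set \<Rightarrow> 'g wfun" where
  "T_coeff U = act (SOME p. p \<in> carrier F \<and> U = cl p) (delta id)"

definition from_coeff :: "'g wfun \<Rightarrow> 'g free_alg set" where "from_coeff f = cl (free_lift f)"

lemma T_coeff_cl [simp]:
  assumes "p \<in> carrier F"
  shows "T_coeff (cl p) = act p (delta id)"
proof -
  define q where "q = (SOME q. q \<in> carrier F \<and> cl p = cl q)"
  have "\<exists>q. q \<in> carrier F \<and> cl p = cl q" using assms by blast
  then have q: "q \<in> carrier F \<and> cl p = cl q" unfolding q_def by (rule someI_ex)
  then have "act p (delta id) = act q (delta id)" using cl_eq_iff[OF assms] by blast
  then show ?thesis by (simp only: T_coeff_def q_def)
qed

lemma from_coeff_in_H [simp]: "from_coeff f \<in> carrier H"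
  by (simp add: from_coeff_def)

lemma T_coeff_from_coeff [simp]: "f \<in> EW \<Longrightarrow> T_coeff (from_coeff f) = f"
  by (simp add: from_coeff_def act_free_lift)

lemma EW_T_coeff [intro]: "U \<in> carrier H \<Longrightarrow> T_coeff U \<in> EW"
  by (elim H_cases) (simp add: EW_act)

lemma T_coeff_inj: "U \<in> carrier H \<Longrightarrow> V \<in> carrier H \<Longrightarrow> T_coeff U = T_coeff V \<longleftrightarrow> U = V"
  by (elim H_cases) (simp add: cl_eq_iff)

lemma from_coeff_T_coeff [simp]: "U \<in> carrier H \<Longrightarrow> from_coeff (T_coeff U) = U"
  using T_coeff_inj[of "from_coeff (T_coeff U)" U] by (simp add: EW_T_coeff)

lemma T_coeff_add: "U \<in> carrier H \<Longrightarrow> V \<in> carrier H \<Longrightarrow> T_coeff (U \<oplus>\<^bsub>H\<^esub> V) = T_coeff U + T_coeff V"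
  by (elim H_cases) (simp add: cl_add in_F_closed act_add)

lemma T_coeff_mult: "p \<in> carrier F \<Longrightarrow> U \<in> carrier H \<Longrightarrow> T_coeff (cl p \<otimes>\<^bsub>H\<^esub> U) = act p (T_coeff U)"
  by (elim H_cases) (simp add: cl_mult in_F_closed act_mult)

lemma T_coeff_0 [simp]: "T_coeff \<zero>\<^bsub>H\<^esub> = 0"
  using T_coeff_add[of "\<zero>\<^bsub>H\<^esub>" "\<zero>\<^bsub>H\<^esub>"] by simp

lemma T_coeff_1 [simp]: "T_coeff \<one>\<^bsub>H\<^esub> = delta id"
  using act_const[of 1] by (simp add: cl_1 free_const_simps sc_simps)

lemma T_coeff_uminus:
  assumes "U \<in> carrier H"
  shows "T_coeff (\<ominus>\<^bsub>H\<^esub> U) = - T_coeff U"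
proof -
  have "T_coeff (U \<oplus>\<^bsub>H\<^esub> \<ominus>\<^bsub>H\<^esub> U) = 0" using assms by (simp add: H.r_neg)
  then have "T_coeff U + T_coeff (\<ominus>\<^bsub>H\<^esub> U) = 0" using assms by (simp add: T_coeff_add)
  then show ?thesis by (simp add: add_eq_0_iff)
qed

lemma T_coeff_minus: "U \<in> carrier H \<Longrightarrow> V \<in> carrier H \<Longrightarrow> T_coeff (U \<ominus>\<^bsub>H\<^esub> V) = T_coeff U - T_coeff V"
  by (simp add: a_minus_def T_coeff_add T_coeff_uminus)

lemma hecke_gen_cl: "hecke_gen n a b i = cl (free_gen i)"
  by (simp add: hecke_gen_def cl_def)

lemma hecke_const_cl: "hecke_const n a b c = cl (free_const c)"
  by (simp add: hecke_const_def cl_def)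

lemma gen_in_H [simp]: "i < n \<Longrightarrow> hecke_gen n a b i \<in> carrier H"
  and const_in_H [simp]: "hecke_const n a b c \<in> carrier H"
  by (simp_all add: hecke_gen_cl hecke_const_cl)

lemma smult_in_H [simp]: "U \<in> carrier H \<Longrightarrow> hecke_smult n a b c U \<in> carrier H"
  by (simp add: hecke_smult_def)

lemma T_coeff_gen_mult: "i < n \<Longrightarrow> U \<in> carrier H \<Longrightarrow> T_coeff (hecke_gen n a b i \<otimes>\<^bsub>H\<^esub> U) = Lop i (T_coeff U)"
  by (simp add: hecke_gen_cl T_coeff_mult)

lemma T_coeff_const_mult: "U \<in> carrier H \<Longrightarrow> T_coeff (hecke_const n a b c \<otimes>\<^bsub>H\<^esub> U) = sc c (T_coeff U)"
  by (simp add: hecke_const_cl T_coeff_mult)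

lemma T_coeff_smult: "U \<in> carrier H \<Longrightarrow> T_coeff (hecke_smult n a b c U) = sc c (T_coeff U)"
  by (simp add: hecke_smult_def T_coeff_const_mult)

lemma Rop_delta_id: "i < n \<Longrightarrow> Rop i (delta id) = Lop i (delta id)"
  using L_delta[of i id] R_delta[of i id] winv_word_prod[of "[]" n] by simp

text \<open>The action commutes with \<open>Rop i\<close>, and on \<open>delta id\<close> left and
  right multiplication by a generator agree.\<close>

lemma T_coeff_mult_gen:
  assumes "i < n" "U \<in> carrier H"
  shows "T_coeff (U \<otimes>\<^bsub>H\<^esub> hecke_gen n a b i) = Rop i (T_coeff U)"
proof (rule H_cases[OF assms(2)])
  fix p assume p: "p \<in> carrier F" "U = cl p"
  then show ?thesis
    using assms(1) actR_comm[OF p(1) EW_delta_id assms(1)]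
    by (simp add: hecke_gen_cl T_coeff_mult Rop_delta_id)
qed

lemma T_coeff_mult_const: "U \<in> carrier H \<Longrightarrow> T_coeff (U \<otimes>\<^bsub>H\<^esub> hecke_const n a b c) = sc c (T_coeff U)"
  by (elim H_cases) (simp add: hecke_const_cl T_coeff_mult lin_sc[OF lin_act])

lemma T_coeff_finsum:
  assumes "finite S" "\<And>x. x \<in> S \<Longrightarrow> g x \<in> carrier H"
  shows "(\<Oplus>\<^bsub>H\<^esub>x\<in>S. g x) \<in> carrier H \<and> T_coeff (\<Oplus>\<^bsub>H\<^esub>x\<in>S. g x) = (\<Sum>x\<in>S. T_coeff (g x))"
  using assms
proof (induction S rule: finite_induct)
  case (insert x S)
  then have "g \<in> S \<rightarrow> carrier H" by auto
  then show ?case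
    using insert H.finsum_insert[of S x g] by (simp add: T_coeff_add del: pointwise)
qed (simp del: pointwise)

lemma foldr_gen:
  assumes "set ws \<subseteq> {..<n}"
  shows "foldr (\<lambda>i h. hecke_gen n a b i \<otimes>\<^bsub>H\<^esub> h) ws \<one>\<^bsub>H\<^esub> \<in> carrier H \<and>
    T_coeff (foldr (\<lambda>i h. hecke_gen n a b i \<otimes>\<^bsub>H\<^esub> h) ws \<one>\<^bsub>H\<^esub>) = Lw ws (delta id)"
  using assms by (induction ws) (auto simp: T_coeff_gen_mult)

lemma T_basis_in_H [simp]: "w \<in> W n \<Longrightarrow> T_basis n a b w \<in> carrier H"
  and T_coeff_T_basis [simp]: "w \<in> W n \<Longrightarrow> T_coeff (T_basis n a b w) = delta w"
  using foldr_gen[OF reduced_exprD(2)[OF reduced_red_word[of w]]] Lw_delta_id[OF reduced_red_word[of w]]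
  unfolding T_basis_def red_word_def[symmetric] by auto

lemma T_coeff_T_mult:
  assumes "w \<in> W n" "U \<in> carrier H"
  shows "T_coeff (T_basis n a b w \<otimes>\<^bsub>H\<^esub> U) = Lw (red_word w) (T_coeff U)"
proof -
  let ?p = "Poly_Mapping.single (Free_Word (red_word w)) 1 :: 'g free_alg"
  note r = reduced_red_word[OF assms(1)]
  have p: "?p \<in> carrier F" by (rule single_in_F[OF reduced_exprD(2)[OF r]])
  have "T_basis n a b w = cl ?p"
    using T_coeff_inj[OF T_basis_in_H[OF assms(1)] cl_in_H[OF p]] p assms(1)
    by (simp add: Lw_delta_id[OF r] sc_simps)
  then show ?thesis using T_coeff_mult[OF p assms(2)] by (simp add: sc_simps)
qed


section \<open>The bar involution and the Kazhdan-Lusztig basis of the Hecke algebra\<close>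

definition barH :: "'g free_alg set \<Rightarrow> 'g free_alg set" where
  "barH = restrict (\<lambda>U. from_coeff (bar_fn (T_coeff U))) (carrier H)"

lemma barH_in_H [simp]: "U \<in> carrier H \<Longrightarrow> barH U \<in> carrier H"
  and T_coeff_barH [simp]: "U \<in> carrier H \<Longrightarrow> T_coeff (barH U) = bar_fn (T_coeff U)"
  by (simp_all add: barH_def EW_bar_fn)

text \<open>Here \<open>q\<close> is a bar conjugate of \<open>p\<close>. Its existence alone makes
  the bar map multiplicative, so no involution of the free algebra has to be constructed.\<close>

lemma bar_fn_act:
  assumes "p \<in> carrier F"
  shows "\<exists>q\<in>carrier F. \<forall>f\<in>EW. bar_fn (act p f) = act q (bar_fn f)"
  using assms
proof (induction rule: carrier_F_induct)
  case zero
  show ?case by (rule bexI[of _ 0]) (simp_all add: bar_fn_simps del: pointwise)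
next
  case (single ws c)
  then show ?case
  proof (induction ws)
    case Nil
    show ?case
      by (rule bexI[of _ "free_const (barA c)"]) (simp_all add: bar_fn_simps del: pointwise)
  next
    case (Cons i ws)
    have i: "i < n" and ws: "set ws \<subseteq> {..<n}" using Cons.prems by auto
    obtain q where q: "q \<in> carrier F"
      "\<forall>f\<in>EW. bar_fn (act (Poly_Mapping.single (Free_Word ws) c) f) = act q (bar_fn f)"
      using Cons.IH[OF ws] by blast
    show ?case
    proof (rule bexI[of _ "(free_gen i - free_const (xi i)) * q"], rule ballI)
      fix f assume f: "f \<in> EW"
      have "bar_fn (act (Poly_Mapping.single (Free_Word (i # ws)) c) f)
          = Linv i (bar_fn (act (Poly_Mapping.single (Free_Word ws) c) f))"
        unfolding single_Free_Word_Cons act_mult act_gen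
        by (rule bar_fn_L[OF i EW_act[OF single_in_F[OF ws] f]])
      then show "bar_fn (act (Poly_Mapping.single (Free_Word (i # ws)) c) f)
          = act ((free_gen i - free_const (xi i)) * q) (bar_fn f)"
        using q(2) f by (simp only: act_mult act_diff act_gen act_const Linv_def)
    next
      show "(free_gen i - free_const (xi i)) * q \<in> carrier F"
        using q(1) i F_minus by (intro in_F_closed) auto
    qed
  qed
next
  case (add p p')
  then obtain q q' where "q \<in> carrier F" "\<forall>f\<in>EW. bar_fn (act p f) = act q (bar_fn f)"
    "q' \<in> carrier F" "\<forall>f\<in>EW. bar_fn (act p' f) = act q' (bar_fn f)" by blast
  then show ?case
    by (intro bexI[of _ "q + q'"]) (simp_all add: act_add bar_fn_simps in_F_closed del: pointwise)
qed

lemma barH_mult: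
  assumes "U \<in> carrier H" "V \<in> carrier H"
  shows "barH (U \<otimes>\<^bsub>H\<^esub> V) = barH U \<otimes>\<^bsub>H\<^esub> barH V"
proof -
  obtain p where p: "p \<in> carrier F" "U = cl p" using assms(1) by (rule H_cases)
  obtain q where q: "q \<in> carrier F" "\<And>f. f \<in> EW \<Longrightarrow> bar_fn (act p f) = act q (bar_fn f)"
    using bar_fn_act[OF p(1)] by blast
  have "barH U = cl q"
    using T_coeff_inj[of "barH U" "cl q"] assms(1) q p by simp
  moreover have "T_coeff (barH (U \<otimes>\<^bsub>H\<^esub> V)) = act q (bar_fn (T_coeff V))"
    using assms p q(2)[OF EW_T_coeff[OF assms(2)]] by (simp add: T_coeff_mult)
  ultimately show ?thesis
    using T_coeff_inj[of "barH (U \<otimes>\<^bsub>H\<^esub> V)" "cl q \<otimes>\<^bsub>H\<^esub> barH V"] assms q(1) by (simp add: T_coeff_mult)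
qed

lemma barH_barH [simp]: "U \<in> carrier H \<Longrightarrow> barH (barH U) = U"
  using T_coeff_inj[of "barH (barH U)" U] by (simp add: EW_T_coeff)

lemma barH_add: "U \<in> carrier H \<Longrightarrow> V \<in> carrier H \<Longrightarrow> barH (U \<oplus>\<^bsub>H\<^esub> V) = barH U \<oplus>\<^bsub>H\<^esub> barH V"
  using T_coeff_inj[of "barH (U \<oplus>\<^bsub>H\<^esub> V)" "barH U \<oplus>\<^bsub>H\<^esub> barH V"] by (simp add: T_coeff_add bar_fn_simps)

lemma barH_1: "barH \<one>\<^bsub>H\<^esub> = \<one>\<^bsub>H\<^esub>"
  using T_coeff_inj[of "barH \<one>\<^bsub>H\<^esub>" "\<one>\<^bsub>H\<^esub>"] by simp

lemma barH_const: "barH (hecke_const n a b c) = hecke_const n a b (barA c)"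
proof -
  have "T_coeff (hecke_const n a b c) = sc c (delta id)" for c
    by (simp add: hecke_const_cl)
  then show ?thesis
    using T_coeff_inj[of "barH (hecke_const n a b c)" "hecke_const n a b (barA c)"] by (simp add: bar_fn_simps)
qed

lemma T_mult_barH_T:
  assumes "w \<in> W n"
  shows "T_basis n a b (winv w) \<otimes>\<^bsub>H\<^esub> barH (T_basis n a b w) = \<one>\<^bsub>H\<^esub>"
proof -
  note r = reduced_red_word[OF assms]
  note s = reduced_exprD(2)[OF r]
  have w': "winv w \<in> W n" using assms by (rule W_winv)
  have e: "Liw (red_word w) (delta id) \<in> EW" using s by (rule EW_Liw) simp
  have "T_coeff (T_basis n a b (winv w) \<otimes>\<^bsub>H\<^esub> barH (T_basis n a b w)) = Lw (red_word (winv w)) (Liw (red_word w) (delta id))"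
    using assms w' by (simp add: T_coeff_T_mult bar_fn_delta[OF r])
  also have "\<dots> = Lw (rev (red_word w)) (Liw (red_word w) (delta id))"
    by (rule L_relation[OF reduced_red_word[OF w'] reduced_rev[OF r] e])
  also have "\<dots> = delta id" by (rule Lw_rev_Liw[OF s]) simp
  finally show ?thesis
    using T_coeff_inj[of "T_basis n a b (winv w) \<otimes>\<^bsub>H\<^esub> barH (T_basis n a b w)" "\<one>\<^bsub>H\<^esub>"] assms w' by simp
qed

lemma barH_T:
  assumes "w \<in> W n"
  shows "barH (T_basis n a b w) = inv\<^bsub>H\<^esub> (T_basis n a b (winv w))"
proof (rule H.inv_unique')
  have w': "winv w \<in> W n" using assms by (rule W_winv)
  show "T_basis n a b (winv w) \<otimes>\<^bsub>H\<^esub> barH (T_basis n a b w) = \<one>\<^bsub>H\<^esub>" by (rule T_mult_barH_T[OF assms])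
  have "barH (T_basis n a b w \<otimes>\<^bsub>H\<^esub> barH (T_basis n a b (winv w))) = \<one>\<^bsub>H\<^esub>"
    using T_mult_barH_T[OF w'] assms by (simp add: barH_1)
  then show "barH (T_basis n a b w) \<otimes>\<^bsub>H\<^esub> T_basis n a b (winv w) = \<one>\<^bsub>H\<^esub>"
    using assms w' by (simp add: barH_mult)
qed (use assms in \<open>simp_all add: W_winv\<close>)

lemma is_bar_barH: "is_bar n a b barH"
proof -
  have "barH \<in> ring_iso H H"
  proof (rule ring_iso_memI)
    show "bij_betw barH (carrier H) (carrier H)"
      by (rule bij_betw_byWitness[where f' = barH]) auto
  qed (auto simp: barH_mult barH_add barH_1)
  moreover have "barH \<in> extensional (carrier H)" by (simp add: barH_def)
  ultimately show ?thesis
    by (auto simp: is_bar_def barH_const barH_T)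
qed

lemma H_eq_sum_T:
  assumes "U \<in> carrier H"
  shows "U = (\<Oplus>\<^bsub>H\<^esub>w\<in>W n. hecke_smult n a b (T_coeff U w) (T_basis n a b w))"
proof -
  have "T_coeff (\<Oplus>\<^bsub>H\<^esub>w\<in>W n. hecke_smult n a b (T_coeff U w) (T_basis n a b w)) = (\<Sum>w\<in>W n. sc (T_coeff U w) (delta w))
      \<and> (\<Oplus>\<^bsub>H\<^esub>w\<in>W n. hecke_smult n a b (T_coeff U w) (T_basis n a b w)) \<in> carrier H"
    using T_coeff_finsum[of "W n" "\<lambda>w. hecke_smult n a b (T_coeff U w) (T_basis n a b w)"] by (simp add: T_coeff_smult)
  then show ?thesis
    using EW_expand[OF EW_T_coeff[OF assms]] T_coeff_inj[OF assms] by metis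
qed

text \<open>A bar map is prescribed on the \<open>ee \<gamma>\<close> and on the \<open>T_w\<close>.
  Additivity carries agreement of two such maps to all constants, multiplicativity carries it to
  multiples of the \<open>T_w\<close>, and these add up to everything.\<close>

lemma is_bar_unique:
  assumes f: "is_bar n a b f" and g: "is_bar n a b g"
  shows "f = g"
proof (rule extensionalityI)
  show "f \<in> extensional (carrier H)" "g \<in> extensional (carrier H)"
    using f g by (auto simp: is_bar_def)
  have hom: "f \<in> ring_hom H H" "g \<in> ring_hom H H"
    using f g by (auto simp: is_bar_def ring_iso_def)
  define A where "A = {U \<in> carrier H. f U = g U}"
  have mult: "U \<otimes>\<^bsub>H\<^esub> V \<in> A" if "U \<in> A" "V \<in> A" for U V
    using that ring_hom_mult[OF hom(1)] ring_hom_mult[OF hom(2)] by (auto simp: A_def)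
  have add: "U \<oplus>\<^bsub>H\<^esub> V \<in> A" if "U \<in> A" "V \<in> A" for U V
    using that ring_hom_add[OF hom(1)] ring_hom_add[OF hom(2)] by (auto simp: A_def)
  have zero: "\<zero>\<^bsub>H\<^esub> \<in> A"
    using ring_hom_zero[OF hom(1)] ring_hom_zero[OF hom(2)] H.ring_axioms by (auto simp: A_def)
  have const_add: "hecke_const n a b (c + d) = hecke_const n a b c \<oplus>\<^bsub>H\<^esub> hecke_const n a b d" for c d
    by (simp add: hecke_const_cl cl_add free_const_simps)
  have ee: "hecke_const n a b (ee \<gamma>) \<in> A" for \<gamma>
    using f g by (simp add: A_def is_bar_def)
  \<comment> \<open>Integer coefficients are reached by adding and subtracting
    \<open>ee \<gamma>\<close>, so agreement at its negative is required as well.\<close>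
  have minus_ee: "hecke_const n a b (- ee \<gamma>) \<in> A" for \<gamma>
  proof -
    have neg: "hecke_const n a b (- ee \<gamma>) = \<ominus>\<^bsub>H\<^esub> hecke_const n a b (ee \<gamma>)"
    proof (rule H.minus_equality[symmetric])
      have "hecke_const n a b 0 = \<zero>\<^bsub>H\<^esub>"
        using T_coeff_inj[of "hecke_const n a b 0" "\<zero>\<^bsub>H\<^esub>"] by (simp add: hecke_const_cl sc_simps)
      then show "hecke_const n a b (- ee \<gamma>) \<oplus>\<^bsub>H\<^esub> hecke_const n a b (ee \<gamma>) = \<zero>\<^bsub>H\<^esub>"
        by (simp flip: const_add)
    qed simp_all
    have "h (\<ominus>\<^bsub>H\<^esub> U) = \<ominus>\<^bsub>H\<^esub> h U" if "h \<in> ring_hom H H" "U \<in> carrier H" for h U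
    proof -
      interpret h: ring_hom_ring H H h
        by (rule ring_hom_ringI2) (use H.ring_axioms that in auto)
      show ?thesis using that(2) by simp
    qed
    from this[OF hom(1)] this[OF hom(2)] show ?thesis using ee[of \<gamma>] by (simp add: neg A_def)
  qed
  have const: "hecke_const n a b c \<in> A" for c
  proof (induction c rule: poly_mapping_single_induct)
    case zero
    show ?case using add[OF ee[of 0] minus_ee[of 0]] by (simp flip: const_add)
  next
    case (single \<gamma> k)
    show ?case
    proof (induction k rule: int_induct[where k = 0])
      case base
      show ?case using add[OF ee[of 0] minus_ee[of 0]] by (simp flip: const_add)
    next
      case (step1 k)
      have "Poly_Mapping.single \<gamma> (k + 1) = Poly_Mapping.single \<gamma> k + ee \<gamma>"
        by (simp add: ee_def single_add)
      then show ?case using add[OF step1(2) ee[of \<gamma>]] by (simp add: const_add)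
    next
      case (step2 k)
      have "Poly_Mapping.single \<gamma> (k - 1) = Poly_Mapping.single \<gamma> k + (- ee \<gamma>)"
        by (simp add: ee_def single_diff)
      then show ?case using add[OF step2(2) minus_ee[of \<gamma>]] by (simp only: const_add)
    qed
  qed (simp add: const_add add)
  have T: "T_basis n a b w \<in> A" if "w \<in> W n" for w
    using f g that by (simp add: A_def is_bar_def)
  fix U assume U: "U \<in> carrier H"
  have "(\<Oplus>\<^bsub>H\<^esub>w\<in>S. hecke_smult n a b (c w) (T_basis n a b w)) \<in> A" if "S \<subseteq> W n" for S c
    using finite_subset[OF that finite_W] that
  proof (induction S rule: finite_induct)
    case (insert w S)
    have t: "hecke_smult n a b (c v) (T_basis n a b v) \<in> carrier H" if "v \<in> insert w S" for v
      using insert.prems that by auto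
    then have "(\<lambda>w. hecke_smult n a b (c w) (T_basis n a b w)) \<in> S \<rightarrow> carrier H" by auto
    then show ?case
      using insert t H.finsum_insert[of S w "\<lambda>w. hecke_smult n a b (c w) (T_basis n a b w)"]
        add mult[OF const T] by (simp add: hecke_smult_def)
  qed (simp add: zero)
  then have "U \<in> A" using H_eq_sum_T[OF U] by (metis order_refl)
  then show "f U = g U" by (simp add: A_def)
qed

lemma bar_eq: "bar n a b = barH"
  unfolding bar_def
proof (rule the_equality)
  show "is_bar n a b barH" by (rule is_bar_barH)
  show "f = barH" if "is_bar n a b f" for f using that is_bar_barH by (rule is_bar_unique)
qed

lemma C_basis_facts:
  assumes w: "w \<in> W n"
  shows "C_basis n a b w \<in> carrier H \<and> T_coeff (C_basis n a b w) = KL w"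
proof -
  \<comment> \<open>Since the \<open>T_y\<close> are independent, the existence of positive
    \<open>p\<close> is a condition on the coordinates of \<open>c - T_w\<close>, which is the form
    that \<open>KL_eqI\<close> asks for.\<close>
  have iff: "(\<exists>p. (\<forall>y\<in>W n. p y \<in> A_pos) \<and> c \<ominus>\<^bsub>H\<^esub> T_basis n a b w
        = (\<Oplus>\<^bsub>H\<^esub>y\<in>W n. hecke_smult n a b (p y) (T_basis n a b y)))
      \<longleftrightarrow> (\<forall>y\<in>W n. (T_coeff c - delta w) y \<in> A_pos)" if c: "c \<in> carrier H" for c
  proof -
    let ?d = "c \<ominus>\<^bsub>H\<^esub> T_basis n a b w"
    have d: "?d \<in> carrier H" "T_coeff ?d = T_coeff c - delta w" using c w by (auto simp: T_coeff_minus)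
    have s: "(\<Oplus>\<^bsub>H\<^esub>y\<in>W n. hecke_smult n a b (p y) (T_basis n a b y)) \<in> carrier H"
      "T_coeff (\<Oplus>\<^bsub>H\<^esub>y\<in>W n. hecke_smult n a b (p y) (T_basis n a b y)) = (\<Sum>y\<in>W n. sc (p y) (delta y))" for p
      using T_coeff_finsum[of "W n" "\<lambda>w. hecke_smult n a b (p w) (T_basis n a b w)"] by (simp_all add: T_coeff_smult)
    have eq: "?d = (\<Oplus>\<^bsub>H\<^esub>y\<in>W n. hecke_smult n a b (p y) (T_basis n a b y))
        \<longleftrightarrow> T_coeff c - delta w = (\<Sum>y\<in>W n. sc (p y) (delta y))" for p
      using T_coeff_inj[OF d(1) s(1)[of p], unfolded d(2) s(2)] by (rule sym)
    have val: "(\<Sum>y\<in>W n. sc (p y) (delta y)) z = p z" if "z \<in> W n" for p :: "(int \<Rightarrow> int) \<Rightarrow> 'g group_ring" and z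
      using that by (simp add: sum_fun_app delta_apply if_distrib cong: if_cong)
    have "T_coeff c - delta w \<in> EW" using c w by (intro EW_diff EW_T_coeff EW_delta)
    note ex = EW_expand[OF this]
    show ?thesis
      unfolding eq
    proof
      assume "\<exists>p. (\<forall>y\<in>W n. p y \<in> A_pos) \<and> T_coeff c - delta w = (\<Sum>y\<in>W n. sc (p y) (delta y))"
      then obtain p where p: "\<forall>y\<in>W n. p y \<in> A_pos" "T_coeff c - delta w = (\<Sum>y\<in>W n. sc (p y) (delta y))"
        by blast
      show "\<forall>y\<in>W n. (T_coeff c - delta w) y \<in> A_pos"
        using p(1) val unfolding p(2) by simp
    next
      assume "\<forall>y\<in>W n. (T_coeff c - delta w) y \<in> A_pos"
      then show "\<exists>p. (\<forall>y\<in>W n. p y \<in> A_pos) \<and> T_coeff c - delta w = (\<Sum>y\<in>W n. sc (p y) (delta y))"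
        using ex by blast
    qed
  qed
  have "C_basis n a b w = from_coeff (KL w)"
    unfolding C_basis_def bar_eq
  proof (rule the_equality)
    show "from_coeff (KL w) \<in> carrier H \<and> barH (from_coeff (KL w)) = from_coeff (KL w) \<and>
      (\<exists>p. (\<forall>y\<in>W n. p y \<in> A_pos) \<and> from_coeff (KL w) \<ominus>\<^bsub>H\<^esub> T_basis n a b w
        = (\<Oplus>\<^bsub>H\<^esub>y\<in>W n. hecke_smult n a b (p y) (T_basis n a b y)))"
      using iff[of "from_coeff (KL w)"] KL_facts(1,2)[OF w] KL_minus_delta[OF w]
      by (simp add: barH_def del: pointwise)
  next
    fix c
    assume c: "c \<in> carrier H \<and> barH c = c \<and>
      (\<exists>p. (\<forall>y\<in>W n. p y \<in> A_pos) \<and> c \<ominus>\<^bsub>H\<^esub> T_basis n a b w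
        = (\<Oplus>\<^bsub>H\<^esub>y\<in>W n. hecke_smult n a b (p y) (T_basis n a b y)))"
    then have "T_coeff c = KL w"
      using iff[of c] T_coeff_barH[of c] by (intro KL_eqI[OF w]) (auto simp del: pointwise)
    then show "c = from_coeff (KL w)" using c from_coeff_T_coeff by metis
  qed
  then show ?thesis using KL_facts(1)[OF w] by simp
qed

section \<open>The elements \<open>C_i\<close>, the preorder and spans in coordinates\<close>

lemma KL_refl: "i < n \<Longrightarrow> KL (refl_s i) = Cop i (delta id)"
proof -
  assume i: "i < n"
  have "Cop i (delta id) = KL (refl_s i)"
  proof (rule KL_eqI[OF refl_W[OF i]])
    show "Cop i (delta id) \<in> EW" "bar_fn (Cop i (delta id)) = Cop i (delta id)"
      using i by (auto simp: bar_fn_Cop)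
    show "(Cop i (delta id) - delta (refl_s i)) y \<in> A_pos" for y
      using L_delta[OF i W_id] by (auto simp: Cop_def delta_apply)
  qed
  then show ?thesis by simp
qed

lemma C_gen_in_H [simp]: "i < n \<Longrightarrow> C_gen n a b i \<in> carrier H"
  by (simp add: C_gen_def)

lemma C_gen_cl: "i < n \<Longrightarrow> C_gen n a b i = cl (free_gen i - free_const (qq i))"
  using T_coeff_inj[of "C_gen n a b i" "cl (free_gen i - free_const (qq i))"]
    F_minus[of "free_gen i" "free_const (qq i)"]
  by (simp add: C_gen_def T_coeff_minus hecke_gen_cl hecke_const_cl act_diff qq_def)

lemma C_basis_refl: "i < n \<Longrightarrow> C_basis n a b (refl_s i) = C_gen n a b i"
  using T_coeff_inj[of "C_basis n a b (refl_s i)" "C_gen n a b i"] C_basis_facts[OF refl_W[of i n]]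
    F_minus[of "free_gen i" "free_const (qq i)"]
  by (simp add: KL_refl C_gen_cl act_diff Cop_def)

lemma T_coeff_C_mult: "i < n \<Longrightarrow> U \<in> carrier H \<Longrightarrow> T_coeff (C_gen n a b i \<otimes>\<^bsub>H\<^esub> U) = Cop i (T_coeff U)"
  using F_minus[of "free_gen i" "free_const (qq i)"]
  by (simp add: C_gen_cl T_coeff_mult act_diff Cop_def)

lemma T_coeff_mult_C:
  assumes "i < n" "U \<in> carrier H"
  shows "T_coeff (U \<otimes>\<^bsub>H\<^esub> C_gen n a b i) = CRop i (T_coeff U)"
proof -
  have "U \<otimes>\<^bsub>H\<^esub> C_gen n a b i
      = U \<otimes>\<^bsub>H\<^esub> hecke_gen n a b i \<ominus>\<^bsub>H\<^esub> U \<otimes>\<^bsub>H\<^esub> hecke_const n a b (qq i)"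
    unfolding C_gen_def qq_def[symmetric] using assms
    by (simp add: a_minus_def H.r_distr H.r_minus)
  then show ?thesis using assms by (simp add: T_coeff_minus T_coeff_mult_gen T_coeff_mult_const CRop_def)
qed

lemma C_occurs_iff:
  assumes "h \<in> carrier H"
  shows "C_occurs n a b y h \<longleftrightarrow> (\<exists>m. T_coeff h = (\<Sum>z\<in>W n. sc (m z) (KL z)) \<and> m y \<noteq> 0)"
proof -
  have s: "(\<Oplus>\<^bsub>H\<^esub>y\<in>W n. hecke_smult n a b (c y) (C_basis n a b y)) \<in> carrier H \<and>
      T_coeff (\<Oplus>\<^bsub>H\<^esub>y\<in>W n. hecke_smult n a b (c y) (C_basis n a b y)) = (\<Sum>y\<in>W n. sc (c y) (KL y))" for c
    using T_coeff_finsum[of "W n" "\<lambda>w. hecke_smult n a b (c w) (C_basis n a b w)"]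
    by (simp add: T_coeff_smult C_basis_facts)
  have "h = (\<Oplus>\<^bsub>H\<^esub>y\<in>W n. hecke_smult n a b (c y) (C_basis n a b y)) \<longleftrightarrow>
      T_coeff h = (\<Sum>y\<in>W n. sc (c y) (KL y))" for c
    using T_coeff_inj[OF assms conjunct1[OF s[of c]], unfolded conjunct2[OF s[of c]]] by (rule sym)
  then show ?thesis by (simp add: C_occurs_def)
qed

lemma lr_step_iff:
  assumes "y \<in> W n" "w \<in> W n"
  shows "lr_step n a b y w \<longleftrightarrow> (\<exists>i<n. \<exists>m. m y \<noteq> 0 \<and>
    (Cop i (KL w) = (\<Sum>z\<in>W n. sc (m z) (KL z)) \<or> CRop i (KL w) = (\<Sum>z\<in>W n. sc (m z) (KL z))))"
proof -
  note C = C_basis_facts[OF assms(2)]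
  have "C_occurs n a b y (C_basis n a b (refl_s i) \<otimes>\<^bsub>H\<^esub> C_basis n a b w) \<longleftrightarrow>
      (\<exists>m. Cop i (KL w) = (\<Sum>z\<in>W n. sc (m z) (KL z)) \<and> m y \<noteq> 0)"
    "C_occurs n a b y (C_basis n a b w \<otimes>\<^bsub>H\<^esub> C_basis n a b (refl_s i)) \<longleftrightarrow>
      (\<exists>m. CRop i (KL w) = (\<Sum>z\<in>W n. sc (m z) (KL z)) \<and> m y \<noteq> 0)" if "i < n" for i
    using that C by (simp_all add: C_occurs_iff C_basis_refl T_coeff_C_mult T_coeff_mult_C)
  then show ?thesis using assms unfolding lr_step_def by blast
qed

text \<open>A member of \<open>A_span\<close> is a combination indexed by elements of the algebra.
  Reindexing it by group elements is possible because \<open>w\<close> can be read off from the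
  leading term of \<open>C_w\<close>.\<close>

lemma A_span_iff:
  assumes "S \<subseteq> W n"
  shows "U \<in> A_span n a b (C_basis n a b ` S) \<longleftrightarrow>
    U \<in> carrier H \<and> (\<exists>m. T_coeff U = (\<Sum>w\<in>S. sc (m w) (KL w)))"
proof -
  have KLinj: "u = v" if "u \<in> W n" "v \<in> W n" "KL u = KL v" for u v
  proof (rule ccontr)
    assume "u \<noteq> v"
    show False
    proof (cases "len n u \<le> len n v")
      case True
      then have "KL u v = 0" using KL_facts(5)[OF that(1,2)] \<open>u \<noteq> v\<close> by auto
      then show False using KL_facts(3)[OF that(2)] that(3) by simp
    next
      case False
      then have "KL v u = 0" using KL_facts(5)[OF that(2,1)] \<open>u \<noteq> v\<close> by auto
      then show False using KL_facts(3)[OF that(1)] that(3) by simp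
    qed
  qed
  have inj: "inj_on (C_basis n a b) S"
    using KLinj C_basis_facts assms by (intro inj_onI) (metis subsetD)
  have C: "C_basis n a b w \<in> carrier H" "T_coeff (C_basis n a b w) = KL w" if "w \<in> S" for w
    using C_basis_facts assms that by auto
  have fS: "finite S" by (rule finite_subset[OF assms finite_W])
  have sum: "(\<Oplus>\<^bsub>H\<^esub>x\<in>C_basis n a b ` S'. hecke_smult n a b (c x) x) \<in> carrier H \<and>
      T_coeff (\<Oplus>\<^bsub>H\<^esub>x\<in>C_basis n a b ` S'. hecke_smult n a b (c x) x) = (\<Sum>w\<in>S'. sc (c (C_basis n a b w)) (KL w))"
    if "S' \<subseteq> S" for S' c
  proof -
    have fin: "finite (C_basis n a b ` S')" by (rule finite_imageI[OF finite_subset[OF that fS]])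
    have "(\<Sum>x\<in>C_basis n a b ` S'. sc (c x) (T_coeff x)) = (\<Sum>w\<in>S'. sc (c (C_basis n a b w)) (KL w))"
      using C that by (subst sum.reindex[OF inj_on_subset[OF inj that]]) (auto intro!: sum.cong)
    moreover have "(\<Sum>x\<in>C_basis n a b ` S'. T_coeff (hecke_smult n a b (c x) x)) = (\<Sum>x\<in>C_basis n a b ` S'. sc (c x) (T_coeff x))"
      using C that by (intro sum.cong) (auto simp: T_coeff_smult)
    ultimately show ?thesis
      using T_coeff_finsum[OF fin, of "\<lambda>x. hecke_smult n a b (c x) x"] C(1) that
      by (metis (no_types, lifting) imageE smult_in_H subsetD)
  qed
  show ?thesis
  proof
    assume "U \<in> A_span n a b (C_basis n a b ` S)"
    then obtain c T where T: "T \<subseteq> C_basis n a b ` S" "U = (\<Oplus>\<^bsub>H\<^esub>x\<in>T. hecke_smult n a b (c x) x)"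
      unfolding A_span_def by blast
    then obtain S' where S': "S' \<subseteq> S" "T = C_basis n a b ` S'" by (meson subset_imageE)
    define m where "m w = (if w \<in> S' then c (C_basis n a b w) else 0)" for w
    have "(\<Sum>w\<in>S'. sc (c (C_basis n a b w)) (KL w)) = (\<Sum>w\<in>S. sc (m w) (KL w))"
      using S'(1) fS by (intro sum.mono_neutral_cong_left) (auto simp: m_def sc_simps)
    then show "U \<in> carrier H \<and> (\<exists>m. T_coeff U = (\<Sum>w\<in>S. sc (m w) (KL w)))"
      using sum[OF S'(1)] T(2) S'(2) by auto
  next
    assume U: "U \<in> carrier H \<and> (\<exists>m. T_coeff U = (\<Sum>w\<in>S. sc (m w) (KL w)))"
    then obtain m where m: "T_coeff U = (\<Sum>w\<in>S. sc (m w) (KL w))" by blast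
    define c where "c x = m (inv_into S (C_basis n a b) x)" for x
    have "(\<Sum>w\<in>S. sc (c (C_basis n a b w)) (KL w)) = (\<Sum>w\<in>S. sc (m w) (KL w))"
      by (intro sum.cong) (auto simp: c_def inv_into_f_f[OF inj])
    then have "T_coeff U = T_coeff (\<Oplus>\<^bsub>H\<^esub>x\<in>C_basis n a b ` S. hecke_smult n a b (c x) x)"
      using conjunct2[OF sum[OF order_refl, of c]] m by (simp only:)
    then have "U = (\<Oplus>\<^bsub>H\<^esub>x\<in>C_basis n a b ` S. hecke_smult n a b (c x) x)"
      using T_coeff_inj[OF conjunct1[OF U] conjunct1[OF sum[OF order_refl, of c]]] by blast
    then show "U \<in> A_span n a b (C_basis n a b ` S)"
      unfolding A_span_def using fS by blast
  qed
qed

text \<open>Two-sided ideals of the Hecke algebra correspond to submodules of the following kind.\<close>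

definition bimod :: "'g wfun set \<Rightarrow> bool" where
  "bimod K \<longleftrightarrow> K \<subseteq> EW \<and> 0 \<in> K \<and> (\<forall>f\<in>K. \<forall>g\<in>K. f + g \<in> K) \<and> (\<forall>f\<in>K. \<forall>c. sc c f \<in> K) \<and>
     (\<forall>f\<in>K. \<forall>i<n. Lop i f \<in> K \<and> Rop i f \<in> K)"

definition JG :: "'g wfun set" where
  "JG = (if 2 < n then {Cop 1 (Cop 2 (Cop 1 (delta id))) - Cop 1 (delta id)} else {}) \<union>
     (if 1 < n then {Cop 1 (Cop 0 (Cop 1 (delta id)))
        - sc (ee (b - a) + ee (a - b)) (Cop 1 (delta id))} else {})"

definition JH :: "'g free_alg set set" where
  "JH = (if 2 < n then {C_gen n a b 1 \<otimes>\<^bsub>H\<^esub> C_gen n a b 2 \<otimes>\<^bsub>H\<^esub> C_gen n a b 1 \<ominus>\<^bsub>H\<^esub> C_gen n a b 1} else {})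
       \<union> (if 1 < n then {C_gen n a b 1 \<otimes>\<^bsub>H\<^esub> C_gen n a b 0 \<otimes>\<^bsub>H\<^esub> C_gen n a b 1
            \<ominus>\<^bsub>H\<^esub> hecke_smult n a b (ee (b - a) + ee (a - b)) (C_gen n a b 1)} else {})"

lemma T_coeff_C_gen: "i < n \<Longrightarrow> T_coeff (C_gen n a b i) = Cop i (delta id)"
  using T_coeff_C_mult[of i "\<one>\<^bsub>H\<^esub>"] by simp

lemma JH_in_H: "JH \<subseteq> carrier H"
  by (auto simp: JH_def)

lemma T_coeff_JH: "T_coeff ` JH = JG"
  by (auto simp: JH_def JG_def T_coeff_minus H.m_assoc T_coeff_C_mult T_coeff_C_gen T_coeff_smult)

lemma J_ideal_eq: "J_ideal n a b = genideal H JH"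
  by (simp add: J_ideal_def Let_def JH_def)

text \<open>The elements with coordinates in \<open>K\<close> form a two-sided ideal that contains
  the generators.\<close>

lemma J_ideal_in_bimod:
  assumes K: "bimod K" "JG \<subseteq> K" and "U \<in> J_ideal n a b"
  shows "T_coeff U \<in> K"
proof -
  have K': "K \<subseteq> EW" "0 \<in> K" "\<And>f g. f \<in> K \<Longrightarrow> g \<in> K \<Longrightarrow> f + g \<in> K" "\<And>f c. f \<in> K \<Longrightarrow> sc c f \<in> K"
    "\<And>f i. f \<in> K \<Longrightarrow> i < n \<Longrightarrow> Lop i f \<in> K" "\<And>f i. f \<in> K \<Longrightarrow> i < n \<Longrightarrow> Rop i f \<in> K"
    using K(1) by (auto simp: bimod_def)
  have left: "act p f \<in> K" if "p \<in> carrier F" "f \<in> K" for p f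
    using that(1)
  proof (induction rule: carrier_F_induct)
    case (single ws c)
    then have "Lw ws f \<in> K" by (induction ws) (auto simp: that(2) K'(5))
    then show ?case using K'(4) by (simp del: pointwise)
  qed (simp_all add: K'(2,3) act_add del: pointwise)
  \<comment> \<open>Right multiplication by a word consumes its letters from the left, so
    \<open>V\<close> has to vary in the induction.\<close>
  have right: "T_coeff (V \<otimes>\<^bsub>H\<^esub> cl p) \<in> K" if "p \<in> carrier F" "V \<in> carrier H" "T_coeff V \<in> K" for p V
    using that
  proof (induction arbitrary: V rule: carrier_F_induct)
    case zero
    have "cl 0 = \<zero>\<^bsub>H\<^esub>" using T_coeff_inj[of "cl 0" "\<zero>\<^bsub>H\<^esub>"] by simp
    then show ?case using zero K'(2) by (simp del: pointwise)
  next
    case (single ws c)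
    then show ?case
    proof (induction ws arbitrary: V)
      case Nil
      then show ?case
        using T_coeff_mult_const[of V c] K'(4)
          by (simp add: hecke_const_cl free_const_def zero_free_word_def del: pointwise)
    next
      case (Cons i ws)
      have i: "i < n" and ws: "set ws \<subseteq> {..<n}" using Cons.prems by auto
      have "cl (Poly_Mapping.single (Free_Word (i # ws)) c)
          = hecke_gen n a b i \<otimes>\<^bsub>H\<^esub> cl (Poly_Mapping.single (Free_Word ws) c)"
        using i ws by (simp add: hecke_gen_cl cl_mult single_Free_Word_Cons)
      then have "V \<otimes>\<^bsub>H\<^esub> cl (Poly_Mapping.single (Free_Word (i # ws)) c)
          = (V \<otimes>\<^bsub>H\<^esub> hecke_gen n a b i) \<otimes>\<^bsub>H\<^esub> cl (Poly_Mapping.single (Free_Word ws) c)"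
        using i ws Cons.prems(2) by (simp add: H.m_assoc)
      moreover have "T_coeff (V \<otimes>\<^bsub>H\<^esub> hecke_gen n a b i) \<in> K"
        using T_coeff_mult_gen[OF i Cons.prems(2)] K'(6) Cons.prems(3) i by simp
      ultimately show ?case
        using Cons.IH[OF ws, of "V \<otimes>\<^bsub>H\<^esub> hecke_gen n a b i"] i Cons.prems(2) by simp
    qed
  next
    case (add p q)
    have "V \<otimes>\<^bsub>H\<^esub> cl (p + q) = V \<otimes>\<^bsub>H\<^esub> cl p \<oplus>\<^bsub>H\<^esub> V \<otimes>\<^bsub>H\<^esub> cl q"
      using add.hyps add.prems by (simp add: H.r_distr flip: cl_add)
    then show ?case using add K'(3) by (simp add: T_coeff_add del: pointwise)
  qed
  let ?K = "{U \<in> carrier H. T_coeff U \<in> K}"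
  have "ideal ?K H"
  proof (rule idealI[OF H.ring_axioms])
    show "subgroup ?K (add_monoid H)"
    proof
      fix x assume "x \<in> ?K"
      moreover have "sc (- 1) f = - f" for f :: "'g wfun" by (simp add: sc_simps)
      ultimately have "\<ominus>\<^bsub>H\<^esub> x \<in> ?K"
        using K'(4)[of "T_coeff x" "- 1"] by (auto simp: T_coeff_uminus)
      then show "inv\<^bsub>add_monoid H\<^esub> x \<in> ?K" by (simp add: a_inv_def)
    qed (auto simp: T_coeff_add K'(2,3))
  next
    fix x y assume *: "x \<in> ?K" "y \<in> carrier H"
    obtain p where "p \<in> carrier F" "y = cl p" using *(2) by (rule H_cases)
    then show "y \<otimes>\<^bsub>H\<^esub> x \<in> ?K" "x \<otimes>\<^bsub>H\<^esub> y \<in> ?K"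
      using * left right by (auto simp: T_coeff_mult)
  qed
  moreover have "JH \<subseteq> ?K" using JH_in_H T_coeff_JH K(2) by auto
  ultimately have "J_ideal n a b \<subseteq> ?K" unfolding J_ideal_eq by (rule H.genideal_minimal)
  then show ?thesis using assms(3) by auto
qed

lemma bimod_J_ideal: "bimod (T_coeff ` J_ideal n a b)" "JG \<subseteq> T_coeff ` J_ideal n a b"
  "J_ideal n a b \<subseteq> carrier H"
proof -
  interpret J: ideal "J_ideal n a b" H
    unfolding J_ideal_eq by (rule H.genideal_ideal[OF JH_in_H])
  show JH: "J_ideal n a b \<subseteq> carrier H" using J.Icarr by auto
  show "JG \<subseteq> T_coeff ` J_ideal n a b"
    using H.genideal_self[OF JH_in_H] unfolding J_ideal_eq T_coeff_JH[symmetric] by (rule image_mono)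
  show "bimod (T_coeff ` J_ideal n a b)"
    unfolding bimod_def
  proof (intro conjI ballI allI impI)
    show "T_coeff ` J_ideal n a b \<subseteq> EW" using JH by auto
    show "0 \<in> T_coeff ` J_ideal n a b" using J.zero_closed T_coeff_0 by (metis image_eqI)
  next
    fix f g assume "f \<in> T_coeff ` J_ideal n a b" "g \<in> T_coeff ` J_ideal n a b"
    then obtain U V where "U \<in> J_ideal n a b" "V \<in> J_ideal n a b" "f = T_coeff U" "g = T_coeff V" by blast
    moreover from this have "T_coeff (U \<oplus>\<^bsub>H\<^esub> V) \<in> T_coeff ` J_ideal n a b"
      by (intro imageI J.a_closed)
    moreover have "T_coeff (U \<oplus>\<^bsub>H\<^esub> V) = T_coeff U + T_coeff V"
      using \<open>U \<in> J_ideal n a b\<close> \<open>V \<in> J_ideal n a b\<close> JH by (intro T_coeff_add) auto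
    ultimately show "f + g \<in> T_coeff ` J_ideal n a b" by (simp only:)
  next
    fix f c assume "f \<in> T_coeff ` J_ideal n a b"
    then obtain U where U: "U \<in> J_ideal n a b" "f = T_coeff U" by blast
    then have "hecke_smult n a b c U \<in> J_ideal n a b"
      unfolding hecke_smult_def by (intro J.I_l_closed) auto
    then have "T_coeff (hecke_smult n a b c U) \<in> T_coeff ` J_ideal n a b" by (rule imageI)
    then show "sc c f \<in> T_coeff ` J_ideal n a b"
      unfolding U(2) T_coeff_smult[OF subsetD[OF JH U(1)]] .
  next
    fix f i assume "f \<in> T_coeff ` J_ideal n a b" and i: "i < n"
    then obtain U where U: "U \<in> J_ideal n a b" "f = T_coeff U" by blast
    then have "hecke_gen n a b i \<otimes>\<^bsub>H\<^esub> U \<in> J_ideal n a b" "U \<otimes>\<^bsub>H\<^esub> hecke_gen n a b i \<in> J_ideal n a b"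
      using i by (auto intro: J.I_l_closed J.I_r_closed)
    from this[THEN imageI[where f = T_coeff]]
    show "Lop i f \<in> T_coeff ` J_ideal n a b" "Rop i f \<in> T_coeff ` J_ideal n a b"
      unfolding U(2) T_coeff_gen_mult[OF i subsetD[OF JH U(1)]] T_coeff_mult_gen[OF i subsetD[OF JH U(1)]] .
  qed
qed

end

section \<open>Words for the elements of the set \<open>Wb\<close>\<close>

definition bad_word :: "nat \<Rightarrow> nat list \<Rightarrow> bool" where
  "bad_word n ws \<longleftrightarrow> (\<exists>us vs i j. ws = us @ [i, j, i] @ vs \<and> 1 \<le> i \<and> i < n \<and> j < n \<and> \<bar>int i - int j\<bar> = 1)"

lemma Wb_iff: "w \<in> Wb n \<longleftrightarrow> w \<in> W n \<and> (\<forall>ws. reduced_expr n w ws \<longrightarrow> \<not> bad_word n ws)"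
  unfolding Wb_def bad_word_def by blast

lemma bad_word_append: "bad_word n vs \<Longrightarrow> bad_word n (us @ vs @ zs)"
proof -
  assume "bad_word n vs"
  then obtain xs ys i j where "vs = xs @ [i, j, i] @ ys" and
    *: "1 \<le> i" "i < n" "j < n" "\<bar>int i - int j\<bar> = 1" unfolding bad_word_def by blast
  then have "us @ vs @ zs = (us @ xs) @ [i, j, i] @ (ys @ zs)" by simp
  then show ?thesis using * unfolding bad_word_def by blast
qed

lemma bad_word_rev: "bad_word n (rev ws) \<Longrightarrow> bad_word n ws"
proof -
  assume "bad_word n (rev ws)"
  then obtain xs ys i j where "rev ws = xs @ [i, j, i] @ ys" and
    *: "1 \<le> i" "i < n" "j < n" "\<bar>int i - int j\<bar> = 1" unfolding bad_word_def by blast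
  then have "ws = rev ys @ [i, j, i] @ rev xs"
    by (metis append_assoc rev.simps(1) rev.simps(2) rev_append rev_rev_ident append_Cons append_Nil)
  then show ?thesis using * unfolding bad_word_def by blast
qed

lemma Wb_winv: "w \<in> Wb n \<Longrightarrow> winv w \<in> Wb n"
  unfolding Wb_iff using reduced_rev[of n "winv w"] bad_word_rev winv_winv[of w n]
  by (metis W_winv rev_rev_ident)

lemma Wb_ldesc:
  assumes "w \<in> Wb n" "i < n" "ldesc i w"
  shows "refl_s i \<circ> w \<in> Wb n"
  unfolding Wb_iff
proof (intro conjI allI impI)
  have w: "w \<in> W n" using assms(1) by (simp add: Wb_iff)
  then show "refl_s i \<circ> w \<in> W n" using assms(2) by simp
  fix ws assume "reduced_expr n (refl_s i \<circ> w) ws"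
  then have "reduced_expr n w (i # ws)" using assms w by (simp add: reduced_Cons_iff)
  then have "\<not> bad_word n (i # ws)" using assms(1) by (simp add: Wb_iff)
  then show "\<not> bad_word n ws" using bad_word_append[of n ws "[i]" "[]"] by auto
qed

text \<open>Two such descents give a reduced word that starts with a whole side of a braid relation.
  For the indices 0 and 1 this is \<open>[0, 1, 0, 1]\<close>, where the forbidden triple begins at
  the second letter.\<close>

lemma Wb_not_two_ldesc:
  assumes w: "w \<in> Wb n" and ij: "i < n" "j < n" "\<bar>int i - int j\<bar> = 1" and d: "ldesc i w" "ldesc j w"
  shows False
proof -
  have wW: "w \<in> W n" using w by (simp add: Wb_iff)
  have good: "\<not> bad_word n ws" if "reduced_expr n w ws" for ws
    using w that by (simp add: Wb_iff)
  show False
  proof (cases "i = 0 \<or> j = 0")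
    case True
    then have "i = 0 \<and> j = 1 \<or> i = 1 \<and> j = 0" using ij(3) by auto
    then have *: "1 < n" "ldesc 0 w" "ldesc 1 w" using ij d by auto
    obtain ws where ws: "reduced_expr n (refl_s 1 \<circ> (refl_s 0 \<circ> (refl_s 1 \<circ> (refl_s 0 \<circ> w)))) ws"
      using ex_reduced[of "refl_s 1 \<circ> (refl_s 0 \<circ> (refl_s 1 \<circ> (refl_s 0 \<circ> w)))" n] wW * by auto
    have "reduced_expr n w (0 # 1 # 0 # 1 # ws)"
      using two_ldesc_4[OF wW *] ws wW * by (auto simp: reduced_Cons_iff)
    moreover have "0 # 1 # 0 # 1 # ws = [0] @ [1, 0, 1] @ ws" by simp
    moreover have "bad_word n ([0] @ [1, 0, 1] @ ws)"
      unfolding bad_word_def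
      by (rule exI[of _ "[0]"], rule exI[of _ ws], rule exI[of _ 1], rule exI[of _ 0])
        (use * in auto)
    ultimately show False using good by metis
  next
    case False
    obtain ws where ws: "reduced_expr n (refl_s i \<circ> (refl_s j \<circ> (refl_s i \<circ> w))) ws"
      using ex_reduced[of "refl_s i \<circ> (refl_s j \<circ> (refl_s i \<circ> w))" n] wW ij by auto
    have "reduced_expr n w (i # j # i # ws)"
      by (rule two_ldesc_reduced_3) (use wW ij d ws False in auto)
    moreover have "bad_word n (i # j # i # ws)"
      unfolding bad_word_def
      by (rule exI[of _ "[]"], rule exI[of _ ws], rule exI[of _ i], rule exI[of _ j])
        (use ij False in auto)
    ultimately show False using good by blast
  qed
qed

lemma refl_comm_apply: "1 < \<bar>int i - int j\<bar> \<Longrightarrow> refl_s i (refl_s j x) = refl_s j (refl_s i x)"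
  using fun_cong[OF refl_comm[of i j id], of x] by simp

lemma word_prod_commute:
  assumes "\<And>z. z \<in> set us \<Longrightarrow> 1 < \<bar>int z - int i\<bar>"
  shows "word_prod (us @ [i] @ vs) = word_prod ([i] @ us @ vs)"
proof -
  have "word_prod us (refl_s i x) = refl_s i (word_prod us x)" for x
    using assms
  proof (induction us)
    case (Cons z us)
    then have "1 < \<bar>int z - int i\<bar>" "word_prod us (refl_s i x) = refl_s i (word_prod us x)" by auto
    then show ?case using refl_comm_apply[of z i "word_prod us x"] by simp
  qed simp
  then show ?thesis by auto
qed

lemma reduced_perm:
  assumes "reduced_expr n w us" "word_prod vs = word_prod us" "mset vs = mset us"
  shows "reduced_expr n w vs"
proof -
  have "set vs = set us" "length vs = length us"
    using assms(3) mset_eq_setD mset_eq_length by blast+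
  then show ?thesis using assms(1,2) by (simp add: reduced_expr_def)
qed

lemma reduced_commute:
  assumes "reduced_expr n w (us @ zs @ [i] @ vs)" "\<And>z. z \<in> set zs \<Longrightarrow> 1 < \<bar>int z - int i\<bar>"
  shows "reduced_expr n w (us @ [i] @ zs @ vs)"
  by (rule reduced_perm[OF assms(1)])
    (simp_all only: word_prod_append[of us] word_prod_commute[OF assms(2)] mset_append union_ac)

lemma reduced_commute':
  assumes "reduced_expr n w (us @ [i] @ zs @ vs)" "\<And>z. z \<in> set zs \<Longrightarrow> 1 < \<bar>int z - int i\<bar>"
  shows "reduced_expr n w (us @ zs @ [i] @ vs)"
  by (rule reduced_perm[OF assms(1)])
    (simp_all only: word_prod_append[of us] word_prod_commute[OF assms(2)] mset_append union_ac)

text \<open>Letters other than \<open>i\<close> and its neighbours commute with \<open>i\<close>.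
  With no neighbour in between, the two \<open>i\<close> would cancel; with exactly one, they would
  form a forbidden triple, unless \<open>i = 0\<close>, where 1 is the only neighbour anyway. If the
  first two neighbours are equal, induction finds an \<open>i\<close> between them, which was
  excluded.\<close>

lemma Wb_between:
  assumes w: "w \<in> Wb n"
  shows "reduced_expr n w (us @ [i] @ zs @ [i] @ vs) \<Longrightarrow> i \<notin> set zs \<Longrightarrow>
    Suc i \<in> set zs \<and> (0 < i \<longrightarrow> i - 1 \<in> set zs)"
proof (induction "length zs" arbitrary: us i zs vs rule: less_induct)
  case less
  define adj where "adj z \<longleftrightarrow> \<bar>int z - int i\<bar> = 1" for z
  have far: "1 < \<bar>int z - int i\<bar>" if "z \<in> set xs" "set xs \<subseteq> set zs" "\<not> (\<exists>z\<in>set xs. adj z)" for z xs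
  proof -
    have "z \<noteq> i" "\<bar>int z - int i\<bar> \<noteq> 1" using that less.prems(2) by (auto simp: adj_def)
    then show ?thesis by linarith
  qed
  have "\<exists>z\<in>set zs. adj z"
  proof (rule ccontr)
    assume no: "\<not> (\<exists>z\<in>set zs. adj z)"
    have "reduced_expr n w ((us @ [i]) @ zs @ [i] @ vs)" using less.prems(1) by simp
    then have "reduced_expr n w ((us @ [i]) @ [i] @ zs @ vs)"
      by (rule reduced_commute) (use far no in blast)
    then have r: "reduced_expr n w (us @ [i, i] @ zs @ vs)" by simp
    have eq: "word_prod (us @ [i, i] @ zs @ vs) = word_prod (us @ zs @ vs)"
      by (simp add: comp_assoc)
    have "set (us @ zs @ vs) \<subseteq> {..<n}" using reduced_exprD(2)[OF r] by auto
    from len_le[OF this] have "len n w \<le> length (us @ zs @ vs)"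
      unfolding eq[symmetric] reduced_exprD(3)[OF r] .
    then show False using reduced_exprD(4)[OF r] by simp
  qed
  then obtain z1 j z2 where z: "zs = z1 @ j # z2" "adj j" "\<not> (\<exists>z\<in>set z1. adj z)"
    by (metis split_list_first_prop)
  show ?case
  proof (rule ccontr)
    assume neg: "\<not> ?thesis"
    have "\<exists>z\<in>set z2. adj z"
    proof (rule ccontr)
      assume no: "\<not> (\<exists>z\<in>set z2. adj z)"
      have "i \<noteq> 0"
      proof
        assume "i = 0"
        then have "j = 1" using z(2) by (auto simp: adj_def)
        then show False using neg \<open>i = 0\<close> z(1) by simp
      qed
      have "reduced_expr n w ((us @ [i] @ z1 @ [j]) @ z2 @ [i] @ vs)" using less.prems(1) z(1) by simp
      then have "reduced_expr n w ((us @ [i] @ z1 @ [j]) @ [i] @ z2 @ vs)"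
        by (rule reduced_commute) (use far[of _ z2] no z(1) in auto)
      then have "reduced_expr n w (us @ [i] @ z1 @ ([j, i] @ z2 @ vs))" by simp
      then have "reduced_expr n w (us @ z1 @ [i] @ ([j, i] @ z2 @ vs))"
        by (rule reduced_commute') (use far[of _ z1] z in auto)
      then have r: "reduced_expr n w ((us @ z1) @ [i, j, i] @ (z2 @ vs))" by simp
      then have "i < n" "j < n" using reduced_exprD(2)[OF r] by auto
      then have "bad_word n ((us @ z1) @ [i, j, i] @ (z2 @ vs))"
        unfolding bad_word_def
        by (intro exI[of _ "us @ z1"] exI[of _ "z2 @ vs"] exI[of _ i] exI[of _ j])
          (use \<open>i \<noteq> 0\<close> z(2) in \<open>auto simp: adj_def\<close>)
      then show False using w r by (simp add: Wb_iff)
    qed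
    then obtain z3 k z4 where z': "z2 = z3 @ k # z4" "adj k" "\<not> (\<exists>z\<in>set z3. adj z)"
      by (metis split_list_first_prop)
    have "k = j"
    proof (rule ccontr)
      assume "k \<noteq> j"
      then have "{j, k} = {Suc i, i - 1} \<and> 0 < i"
        using z(2) z'(2) by (auto simp: adj_def)
      then have "Suc i \<in> {j, k} \<and> i - 1 \<in> {j, k}" by auto
      then show False using neg z(1) z'(1) by auto
    qed
    have j3: "j \<notin> set z3" using z'(3) z(2) by auto
    have r3: "reduced_expr n w ((us @ [i] @ z1) @ [j] @ z3 @ [j] @ (z4 @ [i] @ vs))"
      using less.prems(1) z(1) z'(1) \<open>k = j\<close> by simp
    have "Suc j \<in> set z3 \<and> (0 < j \<longrightarrow> j - 1 \<in> set z3)"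
      by (rule less.hyps[OF _ r3 j3]) (simp add: z(1) z'(1))
    moreover have "i = Suc j \<or> 0 < j \<and> i = j - 1" using z(2) by (auto simp: adj_def)
    ultimately have "i \<in> set z3" by auto
    then show False using less.prems(2) z(1) z'(1) by simp
  qed
qed

text \<open>Of the two neighbours this keeps the larger one, which exists for the letter 0 too. The
  property is invariant under reversal of the word.\<close>

definition between_prop :: "nat list \<Rightarrow> bool" where
  "between_prop ws \<longleftrightarrow> (\<forall>p q. p < q \<and> q < length ws \<and> ws ! p = ws ! q \<longrightarrow>
     (\<exists>r. p < r \<and> r < q \<and> ws ! r = Suc (ws ! p)))"

lemma Wb_between_prop:
  assumes "w \<in> Wb n" "reduced_expr n w ws"
  shows "between_prop ws"
  unfolding between_prop_def
proof (intro allI impI)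
  fix p q assume *: "p < q \<and> q < length ws \<and> ws ! p = ws ! q"
  \<comment> \<open>The next occurrence of the letter after \<open>p\<close>, since
    \<open>Wb_between\<close> is about consecutive occurrences.\<close>
  define q' where "q' = (LEAST q'. p < q' \<and> ws ! q' = ws ! p)"
  have q': "p < q' \<and> ws ! q' = ws ! p" unfolding q'_def by (rule LeastI[of _ q]) (use * in auto)
  have "q' \<le> q" unfolding q'_def by (rule Least_le) (use * in auto)
  define zs where "zs = take (q' - Suc p) (drop (Suc p) ws)"
  have len: "length zs = q' - Suc p" using * \<open>q' \<le> q\<close> by (auto simp: zs_def)
  have nth: "zs ! k = ws ! (Suc p + k)" if "k < q' - Suc p" for k
    using that * \<open>q' \<le> q\<close> by (simp add: zs_def)
  have "drop (Suc p) ws = zs @ drop q' ws"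
    using q' append_take_drop_id[of "q' - Suc p" "drop (Suc p) ws"] by (simp add: zs_def)
  moreover have "drop q' ws = [ws ! p] @ drop (Suc q') ws"
    using q' * \<open>q' \<le> q\<close> Cons_nth_drop_Suc[of q' ws] by simp
  ultimately have "ws = take p ws @ [ws ! p] @ zs @ [ws ! p] @ drop (Suc q') ws"
    using * id_take_nth_drop[of p ws] by simp
  moreover have "ws ! p \<notin> set zs"
  proof
    assume "ws ! p \<in> set zs"
    then obtain k where "k < q' - Suc p" "ws ! (Suc p + k) = ws ! p"
      using nth len by (metis in_set_conv_nth)
    moreover from this have "Suc p + k < q'" by simp
    ultimately show False using not_less_Least[of "Suc p + k" "\<lambda>q'. p < q' \<and> ws ! q' = ws ! p"]
      unfolding q'_def[symmetric] by auto
  qed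
  ultimately have "Suc (ws ! p) \<in> set zs"
    using Wb_between[OF assms(1), of "take p ws" "ws ! p" zs "drop (Suc q') ws"] assms(2) by simp
  then obtain k where k: "k < q' - Suc p" "ws ! (Suc p + k) = Suc (ws ! p)"
    using nth len by (metis in_set_conv_nth)
  then show "\<exists>r. p < r \<and> r < q \<and> ws ! r = Suc (ws ! p)"
    using \<open>q' \<le> q\<close> by (intro exI[of _ "Suc p + k"]) auto
qed

section \<open>Stuck words\<close>

definition near :: "nat list \<Rightarrow> nat \<Rightarrow> nat \<Rightarrow> bool" where
  "near ws p q \<longleftrightarrow> \<bar>int (ws ! p) - int (ws ! q)\<bar> \<le> 1"

text \<open>A letter of a reduced word that is not covered commutes to the front, so it is a left
  descent.\<close>

definition covered :: "nat list \<Rightarrow> nat \<Rightarrow> bool" where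
  "covered ws p \<longleftrightarrow> p < length ws \<and> (\<exists>q<p. near ws p q)"

text \<open>
  A word is stuck if no left star operation applies to it: for \<open>y\<close> and \<open>x\<close> as below,
  removing the left descent at \<open>y\<close> would make the letter at \<open>x\<close> a left descent. The letter
  at \<open>x\<close> has to be positive because the step from \<open>1\<close> to \<open>0\<close> does not respect the preorder.
\<close>

definition stuck :: "nat list \<Rightarrow> bool" where
  "stuck ws \<longleftrightarrow> \<not> (\<exists>y x. y < x \<and> x < length ws \<and> \<not> covered ws y \<and> 0 < ws ! x \<and>
     \<bar>int (ws ! x) - int (ws ! y)\<bar> = 1 \<and> (\<forall>q<x. near ws x q \<longrightarrow> q = y))"

text \<open>All earlier letters near \<open>x\<close> are smaller by one, and there is a single such
  position \<open>y\<close>, since two would enclose a letter equal to that at \<open>x\<close>. If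
  \<open>y\<close> is not covered, a star operation applies at \<open>x\<close>; if it is, then
  \<open>y\<close> satisfies the same hypotheses, and the descent goes on.\<close>

lemma stuck_chain:
  assumes "between_prop ws" "stuck ws"
  shows "covered ws x \<Longrightarrow> \<not> (\<exists>q<x. ws ! q = ws ! x \<or> ws ! q = Suc (ws ! x)) \<Longrightarrow> False"
proof (induction x rule: less_induct)
  case (less x)
  obtain y where y: "y < x" "near ws x y" "x < length ws" using less.prems(1) by (auto simp: covered_def)
  have only: "ws ! x = Suc (ws ! q)" if "q < x" "near ws x q" for q
  proof -
    have "ws ! q \<noteq> ws ! x" "ws ! q \<noteq> Suc (ws ! x)" using less.prems(2) that(1) by auto
    then show ?thesis using that(2) by (auto simp: near_def)
  qed
  have uniq: "q = y" if "q < x" "near ws x q" for q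
  proof (rule ccontr)
    assume "q \<noteq> y"
    have e: "ws ! q = ws ! y" using only[OF that] only[OF y(1,2)] by simp
    have bp: "\<exists>r. p < r \<and> r < p' \<and> ws ! r = Suc (ws ! p)"
      if "p < p'" "p' < length ws" "ws ! p = ws ! p'" for p p'
      using assms(1) that unfolding between_prop_def by blast
    have "\<exists>r<x. ws ! r = Suc (ws ! y)"
    proof (cases "q < y")
      case True
      then show ?thesis using bp[of q y] e y by (metis less_trans)
    next
      case False
      then show ?thesis using bp[of y q] e y that(1) \<open>q \<noteq> y\<close> by (metis less_trans linorder_neqE_nat)
    qed
    then obtain r where "r < x" "ws ! r = Suc (ws ! y)" by blast
    then have "r < x" "ws ! r = ws ! x" using only[OF y(1,2)] by auto
    then show False using less.prems(2) by blast
  qed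
  show False
  proof (cases "covered ws y")
    case True
    have "\<not> (\<exists>q<y. ws ! q = ws ! y \<or> ws ! q = Suc (ws ! y))"
    proof
      assume "\<exists>q<y. ws ! q = ws ! y \<or> ws ! q = Suc (ws ! y)"
      then obtain q where q: "q < y" "ws ! q = ws ! y \<or> ws ! q = Suc (ws ! y)" by blast
      then have "near ws x q" using only[OF y(1,2)] by (auto simp: near_def)
      then show False using uniq[of q] q(1) y(1) by simp
    qed
    then show False using less.IH[OF y(1) True] by blast
  next
    case False
    have "\<bar>int (ws ! x) - int (ws ! y)\<bar> = 1" "0 < ws ! x" using only[OF y(1,2)] by auto
    then show False using assms(2) False y uniq unfolding stuck_def by blast
  qed
qed

text \<open>Take a covered \<open>x\<close> with the largest letter. \<open>stuck_chain\<close>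
  yields an earlier letter that is equal or larger by one, and equality would put a larger covered
  letter in between.\<close>

lemma stuck_max:
  assumes "between_prop ws" "stuck ws" "covered ws x0"
  shows "\<exists>r x. r < x \<and> x < length ws \<and> ws ! r = Suc (ws ! x) \<and> (\<forall>p. covered ws p \<longrightarrow> ws ! p \<le> ws ! x)"
proof -
  let ?C = "{p. covered ws p}"
  have fin: "finite ?C" by (rule finite_subset[of _ "{..<length ws}"]) (auto simp: covered_def)
  have "Max ((!) ws ` ?C) \<in> (!) ws ` ?C" using fin assms(3) by (intro Max_in) auto
  then obtain x where x: "covered ws x" "ws ! x = Max ((!) ws ` ?C)" by auto
  have max: "ws ! p \<le> ws ! x" if "covered ws p" for p unfolding x(2) using fin that by (intro Max_ge) auto
  have xl: "x < length ws" using x(1) by (simp add: covered_def)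
  obtain q where q: "q < x" "ws ! q = ws ! x \<or> ws ! q = Suc (ws ! x)"
    using stuck_chain[OF assms(1,2) x(1)] by blast
  have "ws ! q \<noteq> ws ! x"
  proof
    assume "ws ! q = ws ! x"
    then obtain r where r: "q < r" "r < x" "ws ! r = Suc (ws ! q)"
      using assms(1) q(1) xl unfolding between_prop_def by blast
    then have "covered ws r" using xl by (auto simp: covered_def near_def)
    then show False using max[of r] r(3) \<open>ws ! q = ws ! x\<close> by simp
  qed
  then show ?thesis using q xl max by blast
qed

lemma between_prop_rev:
  assumes "between_prop ws"
  shows "between_prop (rev ws)"
  unfolding between_prop_def
proof (intro allI impI)
  fix p q assume *: "p < q \<and> q < length (rev ws) \<and> rev ws ! p = rev ws ! q"
  define N where "N = length ws"
  have n: "N - Suc q < N - Suc p" "N - Suc p < length ws" "ws ! (N - Suc q) = ws ! (N - Suc p)"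
    "rev ws ! p = ws ! (N - Suc p)"
    using * by (auto simp: N_def rev_nth)
  then obtain r where r: "N - Suc q < r" "r < N - Suc p" "ws ! r = Suc (ws ! (N - Suc q))"
    using assms unfolding between_prop_def by blast
  then have "rev ws ! (N - Suc r) = Suc (rev ws ! p)" using n by (simp add: N_def rev_nth)
  moreover have "p < N - Suc r" "N - Suc r < q" using r n * by (auto simp: N_def)
  ultimately show "\<exists>r. p < r \<and> r < q \<and> rev ws ! r = Suc (rev ws ! p)" by blast
qed

text \<open>Let \<open>m\<close> be the largest covered letter. By \<open>stuck_max\<close> some
  \<open>m + 1\<close> precedes an \<open>m\<close>, so it is covered in the reversed word, whose
  largest covered letter \<open>m'\<close> satisfies \<open>m < m'\<close>. By symmetry
  \<open>m' < m\<close>, a contradiction.\<close>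

lemma stuck_both:
  assumes "between_prop ws" "stuck ws" "stuck (rev ws)" "p < q" "q < length ws"
  shows "\<not> near ws q p"
proof
  assume "near ws q p"
  then have c: "covered ws q" using assms by (auto simp: covered_def)
  obtain r x where rx: "r < x" "x < length ws" "ws ! r = Suc (ws ! x)" "\<And>p. covered ws p \<Longrightarrow> ws ! p \<le> ws ! x"
    using stuck_max[OF assms(1,2) c] by blast
  define N where "N = length ws"
  have flip: "rev ws ! k = ws ! (N - Suc k)" if "k < N" for k using that by (simp add: rev_nth N_def)
  have dr: "covered (rev ws) (N - Suc r)"
    unfolding covered_def
  proof (intro conjI exI[of _ "N - Suc x"])
    show "N - Suc r < length (rev ws)" "N - Suc x < N - Suc r" using rx by (auto simp: N_def)
    show "near (rev ws) (N - Suc r) (N - Suc x)" using rx by (auto simp: near_def flip N_def rev_nth)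
  qed
  obtain s y where sy: "s < y" "y < length ws" "rev ws ! s = Suc (rev ws ! y)"
    "\<And>p. covered (rev ws) p \<Longrightarrow> rev ws ! p \<le> rev ws ! y"
    using stuck_max[OF between_prop_rev[OF assms(1)] assms(3) dr] by auto
  have "rev ws ! (N - Suc r) = ws ! r" using rx by (simp add: N_def rev_nth)
  then have 1: "Suc (ws ! x) \<le> rev ws ! y" using sy(4)[OF dr] rx(3) by simp
  have 2: "covered ws (N - Suc s)"
    unfolding covered_def
  proof (intro conjI exI[of _ "N - Suc y"])
    show "N - Suc s < length ws" "N - Suc y < N - Suc s" using sy by (auto simp: N_def)
    show "near ws (N - Suc s) (N - Suc y)" using sy by (auto simp: near_def N_def rev_nth)
  qed
  have "ws ! (N - Suc s) = rev ws ! s" using sy by (simp add: N_def rev_nth)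
  then show False using rx(4)[OF 2] 1 sy(3) by simp
qed

lemma reduced_front:
  assumes "reduced_expr n w (us @ [j] @ vs)" "\<And>u. u \<in> set us \<Longrightarrow> 1 < \<bar>int u - int j\<bar>"
  shows "j < n" "ldesc j w" "reduced_expr n (refl_s j \<circ> w) (us @ vs)"
proof -
  have "reduced_expr n w ([] @ [j] @ us @ vs)"
    by (rule reduced_commute) (use assms in simp_all)
  then show "j < n" "ldesc j w" "reduced_expr n (refl_s j \<circ> w) (us @ vs)"
    by (simp_all add: reduced_Cons_iff)
qed

text \<open>The letter at \<open>y\<close> moves to the front, and after its removal so does the
  letter at \<open>x\<close>, for which \<open>y\<close> was the only obstruction. Before the
  removal it was no descent, because elements of \<open>Wb\<close> do not have two adjacent
  descents.\<close>

lemma not_stuck_step: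
  assumes w: "w \<in> Wb n" and r: "reduced_expr n w ws" and "\<not> stuck ws"
  shows "\<exists>i j. i < n \<and> j < n \<and> 0 < i \<and> \<not> ldesc i w \<and> ldesc j w \<and> ldesc i (refl_s j \<circ> w)"
proof -
  obtain y x where yx: "y < x" "x < length ws" "\<not> covered ws y" "0 < ws ! x"
    "\<bar>int (ws ! x) - int (ws ! y)\<bar> = 1" "\<And>q. q < x \<Longrightarrow> near ws x q \<Longrightarrow> q = y"
    using assms(3) unfolding stuck_def by blast
  define i j where "i = ws ! x" and "j = ws ! y"
  define us vs zs where "us = take y ws" and "vs = take (x - Suc y) (drop (Suc y) ws)"
    and "zs = drop (Suc x) ws"
  have "drop (Suc y) ws = vs @ [i] @ zs"
    using id_take_nth_drop[of "x - Suc y" "drop (Suc y) ws"] yx by (simp add: vs_def zs_def i_def)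
  then have ws: "ws = us @ [j] @ vs @ [i] @ zs"
    using id_take_nth_drop[of y ws] yx by (simp add: us_def j_def)
  have us: "1 < \<bar>int u - int j\<bar>" if u: "u \<in> set us" for u
  proof -
    obtain q where "q < y" "u = ws ! q" using u yx by (auto simp: us_def in_set_conv_nth)
    moreover have "\<not> near ws y q" using yx(1-3) \<open>q < y\<close> by (auto simp: covered_def)
    ultimately show ?thesis by (auto simp: near_def j_def)
  qed
  have uvs: "1 < \<bar>int u - int i\<bar>" if u: "u \<in> set (us @ vs)" for u
  proof -
    have "\<exists>q<x. q \<noteq> y \<and> u = ws ! q"
    proof (cases "u \<in> set us")
      case True
      then obtain k where "k < y" "u = ws ! k" using yx(1,2) by (auto simp: us_def in_set_conv_nth)
      then show ?thesis using yx(1) by (intro exI[of _ k]) auto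
    next
      case False
      then obtain k where "k < x - Suc y" "u = ws ! (Suc y + k)"
        using u yx(1,2) by (auto simp: vs_def in_set_conv_nth)
      then show ?thesis by (intro exI[of _ "Suc y + k"]) auto
    qed
    then obtain q where "q < x" "q \<noteq> y" "u = ws ! q" by blast
    moreover then have "\<not> near ws x q" using yx(6) by blast
    ultimately show ?thesis by (auto simp: near_def i_def)
  qed
  have r': "reduced_expr n w (us @ [j] @ (vs @ [i] @ zs))" using r ws by simp
  note f = reduced_front[OF r' us]
  have "reduced_expr n (refl_s j \<circ> w) ((us @ vs) @ [i] @ zs)" using f(3) by simp
  note g = reduced_front[OF this uvs]
  have "\<not> ldesc i w"
    using Wb_not_two_ldesc[OF w g(1) f(1) _ _ f(2)] yx(5) by (auto simp: i_def j_def)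
  then show ?thesis using f g yx(4) by (auto simp: i_def)
qed

definition sparse :: "nat list \<Rightarrow> bool" where
  "sparse ws \<longleftrightarrow> (\<forall>p q. p < q \<and> q < length ws \<longrightarrow> 1 < \<bar>int (ws ! q) - int (ws ! p)\<bar>)"

lemma stuck_both_sparse:
  assumes "w \<in> Wb n" "reduced_expr n w ws" "stuck ws" "stuck (rev ws)"
  shows "sparse ws"
  using stuck_both[OF Wb_between_prop[OF assms(1,2)] assms(3,4)]
  by (auto simp: sparse_def near_def not_le)

section \<open>Domino insertion for some special elements\<close>

definition rows :: "nat \<Rightarrow> nat \<Rightarrow> nat \<Rightarrow> cell set" where
  "rows r s t = {0} \<times> {..<r} \<union> {1} \<times> {..<s} \<union> {2} \<times> {..<t}"

lemma row_len_rows [simp]: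
  "row_len (rows r s t) 0 = r" "row_len (rows r s t) (Suc 0) = s" "row_len (rows r s t) 2 = t"
proof -
  have "{l. (0, l) \<in> rows r s t} = {..<r}" "{l. (Suc 0, l) \<in> rows r s t} = {..<s}"
    "{l. (2, l) \<in> rows r s t} = {..<t}" by (auto simp: rows_def)
  then show "row_len (rows r s t) 0 = r" "row_len (rows r s t) (Suc 0) = s" "row_len (rows r s t) 2 = t"
    by (simp_all add: row_len_def)
qed

lemma rows_row_0: "rows r s t \<union> {(0, r), (0, Suc r)} = rows (Suc (Suc r)) s t"
  and rows_row_1: "rows r s t \<union> {(Suc 0, s), (Suc 0, Suc s)} = rows r (Suc (Suc s)) t"
  by (auto simp: rows_def)

lemma rows_0: "rows 0 0 0 = {}"
  by (simp add: rows_def)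

lemma bump_horizontal:
  assumes "{(k, l), (k, Suc l)} \<subseteq> \<mu>"
  shows "bump \<mu> {(k, l), (k, Suc l)} = domino_at_row \<mu> (Suc k)"
proof -
  have "{(k, l), (k, Suc l)} \<inter> \<mu> = {(k, l), (k, Suc l)}" using assms by auto
  moreover have "\<not> is_singleton {(k, l), (k, Suc l)}" by (auto simp: is_singleton_def)
  moreover have "fst ` {(k, l), (k, Suc l)} = {k}" by auto
  ultimately show ?thesis by (simp add: bump_def)
qed

lemma tab_shape_upd: "m \<notin> dom T \<Longrightarrow> tab_shape (T(m \<mapsto> d)) = tab_shape T \<union> d"
  unfolding tab_shape_def by (auto simp: ran_map_upd domIff)

lemma tab_shape_empty [simp]: "tab_shape Map.empty = {}"
  by (simp add: tab_shape_def)

lemma restrict_all: "dom T \<subseteq> {..<m} \<Longrightarrow> T |` {..<m} = T"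
  unfolding restrict_map_def by (rule ext) (metis domIff lessThan_iff subsetD)

lemma domino_insert_largest:
  assumes "dom T \<subseteq> {..<nat \<bar>x\<bar>}"
  shows "domino_insert x T = T(nat \<bar>x\<bar> \<mapsto>
    (if x > 0 then domino_at_row (tab_shape T) 0 else domino_at_col (tab_shape T) 0))"
proof -
  have "{j \<in> dom T. nat \<bar>x\<bar> < j} = {}" using assms by auto
  then show ?thesis by (simp only: domino_insert_def Let_def restrict_all[OF assms]) simp
qed

lemma domino_insert_below:
  assumes "dom T \<subseteq> {..<m}" "0 < m" "m < j"
  shows "domino_insert (int m) (T(j \<mapsto> d)) = (let S = T(m \<mapsto> domino_at_row (tab_shape T) 0)
    in S(j \<mapsto> bump (tab_shape S) d))"
proof -
  have "{i \<in> dom (T(j \<mapsto> d)). m < i} = {j}" using assms by auto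
  moreover have "T i = None" if "\<not> i < m" for i
    using assms(1) that by (metis domIff lessThan_iff subsetD)
  then have "T(j \<mapsto> d) |` {..<m} = T"
    using assms(3) by (auto simp: restrict_map_def fun_eq_iff)
  ultimately show ?thesis
    using assms(2) by (simp add: domino_insert_def Let_def)
qed

lemma P_tableau_0 [simp]: "P_tableau 0 w = Map.empty"
  by (simp add: P_tableau_def)

lemma P_tableau_Suc: "P_tableau (Suc k) w = domino_insert (w (int k + 1)) (P_tableau k w)"
  by (simp add: P_tableau_def add.commute)

text \<open>The positions of single dominoes can be forgotten: once the labels are
  \<open>1, ..., k\<close>, all later letters have larger absolute values and leave these dominoes
  in place.\<close>

definition tab_rows :: "tableau \<Rightarrow> nat \<Rightarrow> nat \<Rightarrow> nat \<Rightarrow> nat \<Rightarrow> bool" where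
  "tab_rows T k r s t \<longleftrightarrow> dom T = {1..k} \<and> tab_shape T = rows r s t"

lemma tab_rows_0: "tab_rows (P_tableau 0 w) 0 0 0 0"
  by (simp add: tab_rows_def rows_0)

lemma tab_rows_single:
  assumes "tab_rows (P_tableau k w) k r s t" "w (int k + 1) = int k + 1"
  shows "tab_rows (P_tableau (Suc k) w) (Suc k) (Suc (Suc r)) s t"
proof -
  let ?T = "P_tableau k w"
  have d: "dom ?T = {1..k}" and sh: "tab_shape ?T = rows r s t" using assms(1) by (auto simp: tab_rows_def)
  have n: "nat \<bar>int k + 1\<bar> = Suc k" by simp
  have "domino_insert (int k + 1) ?T = ?T(Suc k \<mapsto> domino_at_row (rows r s t) 0)"
  proof -
    have "dom ?T \<subseteq> {..<nat \<bar>int k + 1\<bar>}" using d by auto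
    from domino_insert_largest[OF this] show ?thesis by (simp only: n sh) simp
  qed
  moreover have "tab_shape (?T(Suc k \<mapsto> domino_at_row (rows r s t) 0)) = rows (Suc (Suc r)) s t"
    using tab_shape_upd[of "Suc k" ?T] d sh rows_row_0[of r s t] by (simp add: domino_at_row_def)
  ultimately show ?thesis using d assms(2) by (auto simp: tab_rows_def P_tableau_Suc)
qed

lemma tab_rows_singles:
  assumes "tab_rows (P_tableau k w) k r s t" "\<And>i. k < i \<Longrightarrow> w (int i) = int i"
  shows "tab_rows (P_tableau (k + m) w) (k + m) (r + 2 * m) s t"
proof (induction m)
  case (Suc m)
  then show ?case
    using tab_rows_single[of "k + m" w "r + 2 * m" s t] assms(2)[of "k + m + 1"] by (simp add: add.commute)
qed (simp add: assms(1))

text \<open>The domino \<open>k + 2\<close> first occupies the end of the first row. There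
  \<open>k + 1\<close> takes its place and bumps it to the end of the second row.\<close>

lemma tab_rows_swap:
  assumes "tab_rows (P_tableau k w) k r s 0" "w (int k + 1) = int k + 2" "w (int k + 2) = int k + 1"
  shows "tab_rows (P_tableau (Suc (Suc k)) w) (Suc (Suc k)) (Suc (Suc r)) (Suc (Suc s)) 0"
proof -
  let ?T = "P_tableau k w" and ?d = "{(0, r), (0, Suc r)} :: cell set"
  let ?S = "?T(Suc k \<mapsto> ?d)"
  have d: "dom ?T = {1..k}" and sh: "tab_shape ?T = rows r s 0" using assms(1) by (auto simp: tab_rows_def)
  have row: "domino_at_row (rows r s 0) 0 = ?d" by (simp add: domino_at_row_def)
  have n: "nat \<bar>int k + 2\<bar> = Suc (Suc k)" by simp
  have 1: "P_tableau (Suc k) w = ?T(Suc (Suc k) \<mapsto> ?d)"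
  proof -
    have "dom ?T \<subseteq> {..<nat \<bar>int k + 2\<bar>}" using d by auto
    from domino_insert_largest[OF this] show ?thesis
      unfolding P_tableau_Suc assms(2) by (simp only: n sh row) simp
  qed
  have shS: "tab_shape ?S = rows (Suc (Suc r)) s 0"
    using tab_shape_upd[of "Suc k" ?T ?d] d sh rows_row_0[of r s 0] by simp
  have "?d \<subseteq> rows (Suc (Suc r)) s 0" by (auto simp: rows_def)
  from bump_horizontal[OF this] have b: "bump (rows (Suc (Suc r)) s 0) ?d = {(Suc 0, s), (Suc 0, Suc s)}"
    by (simp add: domino_at_row_def)
  have "P_tableau (Suc (Suc k)) w = domino_insert (int (Suc k)) (?T(Suc (Suc k) \<mapsto> ?d))"
    using assms(3) 1 by (simp add: P_tableau_Suc[of "Suc k"] add.commute)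
  also have "\<dots> = ?S(Suc (Suc k) \<mapsto> bump (tab_shape ?S) ?d)"
  proof -
    have "dom ?T \<subseteq> {..<Suc k}" using d by auto
    from domino_insert_below[OF this, of "Suc (Suc k)" ?d] show ?thesis
      by (simp add: sh row Let_def)
  qed
  finally have 2: "P_tableau (Suc (Suc k)) w = ?S(Suc (Suc k) \<mapsto> {(Suc 0, s), (Suc 0, Suc s)})"
    unfolding shS b .
  have "tab_shape (P_tableau (Suc (Suc k)) w) = rows (Suc (Suc r)) (Suc (Suc s)) 0"
    using tab_shape_upd[of "Suc (Suc k)" ?S "{(Suc 0, s), (Suc 0, Suc s)}"] d shS rows_row_1 unfolding 2 by auto
  moreover have "dom (P_tableau (Suc (Suc k)) w) = {1..Suc (Suc k)}" unfolding 2 using d by auto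
  ultimately show ?thesis by (simp add: tab_rows_def)
qed

lemma tab_rows_neg_1:
  assumes "w 1 = - 1"
  shows "tab_rows (P_tableau 1 w) 1 1 1 0"
proof -
  have "P_tableau 1 w = Map.empty(1 \<mapsto> {(0, 0), (1, 0)})"
    using domino_insert_largest[of Map.empty "- 1"] P_tableau_Suc[of 0 w] assms
    by (simp add: domino_at_col_def col_len_def)
  then show ?thesis
    using tab_shape_upd[of 1 Map.empty "{(0, 0), (1, 0)}"] by (auto simp: tab_rows_def rows_def)
qed

lemma Sh_tab_rows:
  assumes "tab_rows (P_tableau n w) n r s t"
  shows "Sh n w 0 = r" "Sh n w 1 = s"
  using assms by (simp_all add: Sh_def tab_rows_def)

section \<open>Shapes of products of distinct commuting generators\<close>

lemma sparse_Cons: "sparse (i # ws) \<Longrightarrow> sparse ws \<and> (\<forall>j\<in>set ws. 1 < \<bar>int j - int i\<bar>)"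
proof -
  assume *: "sparse (i # ws)"
  have "1 < \<bar>int (ws ! q) - int (ws ! p)\<bar>" if "p < q" "q < length ws" for p q
    using *[unfolded sparse_def, rule_format, of "Suc p" "Suc q"] that by simp
  moreover have "1 < \<bar>int (ws ! q) - int i\<bar>" if "q < length ws" for q
    using *[unfolded sparse_def, rule_format, of 0 "Suc q"] that by simp
  ultimately show ?thesis by (auto simp: sparse_def in_set_conv_nth)
qed

lemma sparse_set: "sparse ws \<Longrightarrow> i \<in> set ws \<Longrightarrow> Suc i \<notin> set ws"
proof (induction ws)
  case (Cons j ws)
  then show ?case using sparse_Cons[of j ws] by fastforce
qed simp

lemma word_prod_sparse_fixed:
  assumes "\<And>i. i \<in> set ws \<Longrightarrow> x \<notin> {lo i, hi i, - lo i, - hi i}"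
  shows "word_prod ws x = x"
  using assms by (induction ws) (auto simp: refl_s_fixes)

lemma word_prod_sparse_moved:
  assumes "sparse ws" "i \<in> set ws" "x \<in> {lo i, hi i}"
  shows "word_prod ws x = refl_s i x"
  using assms
proof (induction ws)
  case (Cons k ws)
  note s = sparse_Cons[OF Cons.prems(1)]
  have far: "z \<notin> {lo j, hi j, - lo j, - hi j}" if "z \<in> {lo i, hi i}" "1 < \<bar>int j - int i\<bar>" for z j
    using that by (auto simp: lo_def hi_def split: if_splits)
  show ?case
  proof (cases "i = k")
    case True
    have "word_prod ws x = x"
      by (rule word_prod_sparse_fixed, rule far[OF Cons.prems(3)]) (use s True in auto)
    then show ?thesis using True by simp
  next
    case False
    then have i: "i \<in> set ws" using Cons.prems(2) by simp
    then have "1 < \<bar>int k - int i\<bar>" using s by (auto simp: abs_minus_commute)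
    moreover have "refl_s i x \<in> {lo i, hi i}" using Cons.prems(3) by (auto simp: refl_s_moves)
    ultimately have "refl_s k (refl_s i x) = refl_s i x" using far refl_s_fixes by blast
    then show ?thesis using Cons.IH[OF conjunct1[OF s] i Cons.prems(3)] by simp
  qed
qed simp

text \<open>The condition on \<open>k\<close> says that no factor mixes \<open>1, ..., k\<close>
  with larger numbers, so the first \<open>k\<close> letters split into complete blocks. A block is
  a fixed point, a swapped pair or the sign change at 1, and none of these reaches a third
  row.\<close>

lemma Sh_sparse:
  assumes sp: "sparse ws" and ws: "set ws \<subseteq> {..<n}"
  shows "Sh n (word_prod ws) 0 + Sh n (word_prod ws) 1 = 2 * n"
proof -
  let ?w = "word_prod ws"
  have "\<exists>r s. tab_rows (P_tableau k ?w) k r s 0 \<and> r + s = 2 * k" if "k = 0 \<or> k \<notin> set ws" for k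
    using that
  proof (induction k rule: less_induct)
    case (less k)
    consider "k = 0" | "k = 1 \<and> 0 \<in> set ws"
      | l where "k = Suc (Suc l)" "Suc l \<in> set ws"
      | l where "k = Suc l" "l \<notin> set ws"
      by (metis One_nat_def not0_implies_Suc)
    then show ?case
    proof cases
      case 1
      then show ?thesis using tab_rows_0 by auto
    next
      case 2
      have "refl_s 0 1 = - 1" using refl_s_moves(2)[of 0] by (simp add: lo_def hi_def)
      then have "?w 1 = - 1" using word_prod_sparse_moved[OF sp, of 0 1] 2 by (simp add: hi_def)
      then show ?thesis using tab_rows_neg_1 2 by fastforce
    next
      case (3 l)
      have "l \<notin> set ws" using sparse_set[OF sp, of l] 3(2) by auto
      then obtain r s where rs: "tab_rows (P_tableau l ?w) l r s 0" "r + s = 2 * l"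
        using less.IH[of l] 3(1) by auto
      have lh: "lo (Suc l) = int l + 1" "hi (Suc l) = int l + 2" by (auto simp: lo_def hi_def)
      have "?w (int l + 1) = int l + 2" "?w (int l + 2) = int l + 1"
        using word_prod_sparse_moved[OF sp 3(2)] refl_s_moves(1,2)[of "Suc l"] unfolding lh by simp_all
      then show ?thesis using tab_rows_swap[OF rs(1)] rs(2) 3(1) by fastforce
    next
      case (4 l)
      obtain r s where rs: "tab_rows (P_tableau l ?w) l r s 0" "r + s = 2 * l"
        using less.IH[of l] 4 by auto
      have "?w (int l + 1) = int l + 1"
      proof (rule word_prod_sparse_fixed)
        fix i assume "i \<in> set ws"
        then have "i \<noteq> l" "i \<noteq> Suc l" using 4 less.prems by auto
        then show "int l + 1 \<notin> {lo i, hi i, - lo i, - hi i}" by (auto simp: lo_def hi_def)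
      qed
      then show ?thesis using tab_rows_single[OF rs(1)] rs(2) 4(1) by fastforce
    qed
  qed
  moreover have "n \<notin> set ws" using ws by auto
  ultimately obtain r s where "tab_rows (P_tableau n ?w) n r s 0" "r + s = 2 * n" by blast
  then show ?thesis using Sh_tab_rows[of n ?w r s 0] by simp
qed

section \<open>Shapes of the elements that generate \<open>J\<close>\<close>

abbreviation w101 :: "int \<Rightarrow> int" where "w101 \<equiv> refl_s 1 \<circ> (refl_s 0 \<circ> refl_s 1)"
abbreviation w121 :: "int \<Rightarrow> int" where "w121 \<equiv> refl_s 1 \<circ> (refl_s 2 \<circ> refl_s 1)"

text \<open>The values are \<open>1, - 2, 3, ..., n\<close>. The vertical domino with label 2 goes
  below the horizontal one with label 1, so one of its cells lies in the third row.\<close>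

lemma Sh_101:
  assumes "1 < n" and w_def: "w = w101"
  shows "Sh n w 0 + Sh n w 1 < 2 * n"
proof -
  have w: "w 1 = 1" "w 2 = - 2" "\<And>i. 2 < i \<Longrightarrow> w (int i) = int i"
    by (auto simp: w_def refl_s_apply lo_def hi_def)
  have 1: "P_tableau 1 w = Map.empty(1 \<mapsto> {(0, 0), (0, 1)})"
    using domino_insert_largest[of Map.empty 1] P_tableau_Suc[of 0 w] w(1)
    by (simp add: domino_at_row_def row_len_def)
  have sh: "tab_shape (Map.empty(1 \<mapsto> {(0, 0), (0, 1)})) = rows 2 0 0"
    using tab_shape_upd[of 1 Map.empty "{(0, 0), (0, 1)}"] rows_row_0[of 0 0 0]
    by (simp add: rows_0 numeral_2_eq_2)
  have "{k. (k, 0) \<in> rows 2 0 0} = {0}" by (auto simp: rows_def)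
  then have col: "domino_at_col (rows 2 0 0) 0 = {(1, 0), (2, 0)}"
    by (simp add: domino_at_col_def col_len_def numeral_2_eq_2)
  have 2: "P_tableau 2 w = Map.empty(1 \<mapsto> {(0, 0), (0, 1)}, 2 \<mapsto> {(1, 0), (2, 0)})"
  proof -
    have "P_tableau 2 w = domino_insert (- 2) (Map.empty(1 \<mapsto> {(0, 0), (0, 1)}))"
      using P_tableau_Suc[of 1 w] w(2) 1 by (simp add: numeral_2_eq_2)
    then show ?thesis
      using domino_insert_largest[of "Map.empty(1 \<mapsto> {(0, 0), (0, 1)})" "- 2"] sh col by simp
  qed
  have "tab_shape (P_tableau 2 w) = rows 2 0 0 \<union> {(1, 0), (2, 0)}"
    unfolding 2 using tab_shape_upd[of 2 "Map.empty(1 \<mapsto> {(0, 0), (0, 1)})"] sh by simp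
  also have "\<dots> = rows 2 1 1" by (auto simp: rows_def)
  finally have "tab_rows (P_tableau 2 w) 2 2 1 1"
    unfolding tab_rows_def 2 by auto
  from tab_rows_singles[OF this w(3), of "n - 2"] have t: "tab_rows (P_tableau n w) n (2 + 2 * (n - 2)) 1 1"
    using le_add_diff_inverse[of 2 n] assms(1) by (simp only: Suc_1[symmetric] Suc_le_eq)
  show ?thesis unfolding Sh_tab_rows[OF t] using assms(1) by simp
qed

text \<open>The values are \<open>3, 2, 1, 4, ..., n\<close>. Each of the first three letters pushes
  the earlier dominoes down by one row, which leaves a whole domino in the third row.\<close>

lemma Sh_121:
  assumes "2 < n" and w_def: "w = w121"
  shows "Sh n w 0 + Sh n w 1 < 2 * n"
proof -
  have w: "w 1 = 3" "w 2 = 2" "w 3 = 1" "\<And>i. 3 < i \<Longrightarrow> w (int i) = int i"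
    by (auto simp: w_def refl_s_apply lo_def hi_def)
  let ?a = "{(0, 0), (0, 1)} :: cell set" and ?b = "{(1, 0), (1, 1)} :: cell set"
    and ?c = "{(2, 0), (2, 1)} :: cell set"
  have row0: "domino_at_row {} 0 = ?a" by (simp add: domino_at_row_def row_len_def)
  have sh1: "tab_shape (Map.empty(j \<mapsto> ?a)) = rows 2 0 0" for j
    using tab_shape_upd[of j Map.empty ?a] rows_row_0[of 0 0 0] by (simp add: rows_0 numeral_2_eq_2)
  have "{(0, 0), (0, Suc 0)} \<subseteq> rows 2 0 0" by (auto simp: rows_def)
  from bump_horizontal[OF this] have b1: "bump (rows 2 0 0) ?a = ?b"
    by (simp add: domino_at_row_def)
  have "{(1, 0), (1, Suc 0)} \<subseteq> rows 2 2 0" by (auto simp: rows_def)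
  from bump_horizontal[OF this] have b2: "bump (rows 2 2 0) ?b = ?c"
    using row_len_rows(3)[of 2 2 0] by (simp add: domino_at_row_def numeral_2_eq_2)
  have 1: "P_tableau 1 w = Map.empty(3 \<mapsto> ?a)"
    using domino_insert_largest[of Map.empty 3] P_tableau_Suc[of 0 w] w(1) row0 by simp
  have "P_tableau 2 w = domino_insert (int 2) (Map.empty(3 \<mapsto> ?a))"
    using P_tableau_Suc[of 1 w] w(2) 1 by (simp add: numeral_2_eq_2)
  also have "\<dots> = Map.empty(2 \<mapsto> ?a, 3 \<mapsto> ?b)"
    using domino_insert_below[of Map.empty 2 3 ?a] sh1[of 2] b1 row0 by (simp add: Let_def)
  finally have 2: "P_tableau 2 w = Map.empty(2 \<mapsto> ?a, 3 \<mapsto> ?b)" .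
  have 3: "P_tableau 3 w = Map.empty(1 \<mapsto> ?a, 2 \<mapsto> ?b, 3 \<mapsto> ?c)"
  proof -
    let ?T = "Map.empty(2 \<mapsto> ?a, 3 \<mapsto> ?b) :: tableau"
    have "P_tableau 3 w = domino_insert 1 ?T"
      using P_tableau_Suc[of 2 w] w(3) 2 by (simp add: numeral_3_eq_3 numeral_2_eq_2)
    moreover have "{j \<in> dom ?T. 1 < j} = {2, 3}" by auto
    moreover have "sorted_list_of_set {2, 3 :: nat} = [2, 3]" by simp
    moreover have "?T |` {..<1} = Map.empty" by (auto simp: restrict_map_def fun_eq_iff)
    moreover have "tab_shape (Map.empty(1 \<mapsto> ?a, 2 \<mapsto> ?b)) = rows 2 2 0"
      using tab_shape_upd[of 2 "Map.empty(1 \<mapsto> ?a)" ?b] sh1[of 1] rows_row_1[of 2 0 0]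
      by (simp add: numeral_2_eq_2)
    ultimately show ?thesis
      using sh1[of 1] b1 b2 row0 by (simp add: domino_insert_def Let_def)
  qed
  have "tab_shape (P_tableau 3 w) = ?a \<union> ?b \<union> ?c"
    unfolding 3 by (simp add: tab_shape_upd tab_shape_def) blast
  also have "\<dots> = rows 2 2 2" by (auto simp: rows_def)
  finally have "tab_rows (P_tableau 3 w) 3 2 2 2"
    unfolding tab_rows_def 3 by auto
  from tab_rows_singles[OF this w(4), of "n - 3"] have t: "tab_rows (P_tableau n w) n (2 + 2 * (n - 3)) 2 2"
    using assms(1) by simp
  show ?thesis unfolding Sh_tab_rows[OF t] using assms(1) by simp
qed

context hecke_B
begin

section \<open>The ideal generated by the special elements\<close>

text \<open>Left multiplication by \<open>C_i C_j C_i - c C_i\<close>, the common form of the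
  generators of \<open>J\<close> and of their shifts to other indices.\<close>

definition Clin :: "nat \<Rightarrow> nat \<Rightarrow> 'g group_ring \<Rightarrow> 'g wfun \<Rightarrow> 'g wfun" where
  "Clin i j c f = Cop i (Cop j (Cop i f)) - sc c (Cop i f)"

lemma lin_Clin [intro]: "lin (Clin i j c)"
  unfolding Clin_def[abs_def] by (intro lin_comp_diff lin_comp_sc lin_comp[OF lin_Cop] lin_ident)

lemma EW_Clin [intro]: "i < n \<Longrightarrow> j < n \<Longrightarrow> f \<in> EW \<Longrightarrow> Clin i j c f \<in> EW"
  by (auto simp: Clin_def)

lemmas lin_L = lin_add[OF lin_Lop] lin_sc[OF lin_Lop] lin_diff[OF lin_Lop]

lemma Clin_expand:
  assumes "i < n" "f \<in> EW"
  shows "Clin i j c f = Lop i (Lop j (Lop i f))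
    - sc (qq i) (Lop i (Lop j f)) - sc (qq i) (Lop j (Lop i f)) + sc (qq i * qq i) (Lop j f)
    + sc (qq i * qq j + qi i * qq j - c) (Lop i f) + sc (c * qq i - qq j - qq i * qq i * qq j) f"
proof -
  have "Clin i j c f = Lop i (Lop j (Lop i f))
    - sc (qq i) (Lop i (Lop j f)) - sc (qq i) (Lop j (Lop i f)) + sc (qq i * qq i) (Lop j f)
    - sc (qq j) (Lop i (Lop i f)) + sc (qq j * qq i) (Lop i f) + sc (qq i * qq j) (Lop i f)
    - sc (qq i * qq j * qq i) f - sc c (Lop i f) + sc (c * qq i) f"
    by (simp add: Clin_def Cop_def lin_L sc_simps algebra_simps del: pointwise)
  also have "sc (qq j) (Lop i (Lop i f)) = sc (qq j) f + sc (qq j * xi i) (Lop i f)"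
    unfolding L_quad[OF assms] by (simp add: sc_simps)
  finally show ?thesis
    by (auto simp: fun_eq_iff xi_def algebra_simps)
qed

text \<open>The coefficients at products of two generators and at \<open>refl_s j\<close> are in
  \<open>A_pos\<close> for any \<open>c\<close>. The condition \<open>pos\<close> concerns the
  remaining two, where a bar invariant \<open>c\<close> has to cancel the nonpositive part of
  \<open>qi i * qq j\<close>.\<close>

lemma Clin_delta_id:
  assumes ij: "i < n" "j < n" and r: "reduced_expr n w [i, j, i]" and c: "barA c = c"
    and pos: "qq i * qq j + qi i * qq j - c \<in> A_pos" "c * qq i - qq j - qq i * qq i * qq j \<in> A_pos"
  shows "Clin i j c (delta id) = KL w"
proof (rule KL_eqI)
  note w = reduced_exprD[OF r]
  show "w \<in> W n" by fact
  let ?d = "delta id :: 'g wfun"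
  show "Clin i j c ?d \<in> EW" using ij by auto
  show "bar_fn (Clin i j c ?d) = Clin i j c ?d"
    using ij c by (simp add: Clin_def bar_fn_simps bar_fn_Cop EW_Cop del: pointwise)
  have r1: "reduced_expr n (refl_s j \<circ> refl_s i) [j, i]" "reduced_expr n (refl_s i) [i]"
    using reduced_append_right[of n w "[i]" "[j, i]"] reduced_append_right[of n w "[i, j]" "[i]"] r by simp_all
  have r2: "reduced_expr n (refl_s i \<circ> refl_s j) [i, j]"
    using reduced_rev[OF r1(1)] winv_comp[of "refl_s j" n "refl_s i"] ij by (simp add: refl_W)
  have r3: "reduced_expr n (refl_s j) [j]"
    using reduced_append_right[of n _ "[i]" "[j]"] r2 by simp
  have L: "Lop i (Lop j (Lop i ?d)) = delta w" "Lop i (Lop j ?d) = delta (refl_s i \<circ> refl_s j)"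
    "Lop j (Lop i ?d) = delta (refl_s j \<circ> refl_s i)" "Lop j ?d = delta (refl_s j)" "Lop i ?d = delta (refl_s i)"
    using Lw_delta_id[OF r] Lw_delta_id[OF r1(1)] Lw_delta_id[OF r1(2)] Lw_delta_id[OF r2] Lw_delta_id[OF r3]
    by simp_all
  note L' = L(4,5) L(2)[unfolded L(4)] L(3)[unfolded L(5)] L(1)[unfolded L(5) L(3)[unfolded L(5)]]
  have p: "sc c (delta u) y \<in> A_pos" if "c \<in> A_pos" for c u y
    using that by (simp add: delta_apply)
  have q: "qq i * qq i \<in> A_pos" by auto
  fix y
  have eq: "Clin i j c ?d - delta w = sc (qq i * qq i) (delta (refl_s j))
      + sc (qq i * qq j + qi i * qq j - c) (delta (refl_s i))
      + sc (c * qq i - qq j - qq i * qq i * qq j) ?d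
      - sc (qq i) (delta (refl_s i \<circ> refl_s j)) - sc (qq i) (delta (refl_s j \<circ> refl_s i))"
    unfolding Clin_expand[OF ij(1) EW_delta_id] L' by (simp add: algebra_simps del: pointwise)
  show "(Clin i j c ?d - delta w) y \<in> A_pos"
    by (subst eq, unfold plus_fun_apply minus_fun_app, intro A_pos_add A_pos_diff p pos q qq_A_pos)
qed

text \<open>For \<open>i = 1\<close>, \<open>j = 0\<close> the term to be cancelled is
  \<open>ee (b - a)\<close>, with a negative exponent. Adding its mirror image makes it bar
  invariant, and this is the origin of the constant in the second generator of
  \<open>J\<close>.\<close>

definition two_Qq :: "'g group_ring" where "two_Qq = ee (b - a) + ee (a - b)"

lemma Clin_101:
  assumes "1 < n"
  shows "Clin 1 0 two_Qq (delta id) = KL w101"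
proof (rule Clin_delta_id)
  show "reduced_expr n w101 [1, 0, 1]" using reduced_01(3)[OF assms] by simp
  show "barA two_Qq = two_Qq" by (simp add: two_Qq_def add.commute)
  have q: "qq 1 = ee a" "qq 0 = ee b" "qi 1 = ee (- a)" by (simp_all add: qq_def qi_def param_def)
  note q = q q[unfolded One_nat_def]
  have 1: "qq 1 * qq 0 + qi 1 * qq 0 - two_Qq = ee (a + b) - ee (a - b)"
    by (simp add: q two_Qq_def ee_add add.commute)
  have 2: "two_Qq * qq 1 - qq 0 - qq 1 * qq 1 * qq 0 = ee (a - b + a) - ee (a + a + b)"
    by (simp add: q two_Qq_def ee_add distrib_right)
  have p: "0 < a + b" "0 < a - b" "0 < a - b + a" "0 < a + a + b"
    using a_pos b_pos b_less_a by (simp_all add: add_pos_pos)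
  show "qq 1 * qq 0 + qi 1 * qq 0 - two_Qq \<in> A_pos"
    unfolding 1 by (intro A_pos_diff A_pos_ee p)
  show "two_Qq * qq 1 - qq 0 - qq 1 * qq 1 * qq 0 \<in> A_pos"
    unfolding 2 by (intro A_pos_diff A_pos_ee p)
qed (use assms in auto)

text \<open>With equal parameters the term to be cancelled is \<open>qi i * qq j = 1\<close>, which
  is bar invariant already.\<close>

lemma Clin_iji:
  assumes "i < n" "j < n" "0 < i" "0 < j" "\<bar>int i - int j\<bar> = 1"
  shows "Clin i j 1 (delta id) = KL (refl_s i \<circ> (refl_s j \<circ> refl_s i))"
proof (rule Clin_delta_id)
  show "reduced_expr n (refl_s i \<circ> (refl_s j \<circ> refl_s i)) [i, j, i]" by (rule reduced_braid_3[OF assms])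
  have q: "qq i = ee a" "qq j = ee a" "qi i = ee (- a)" using assms by (simp_all add: qq_def qi_def param_def)
  show "qq i * qq j + qi i * qq j - 1 \<in> A_pos"
    using add_pos_pos[OF a_pos a_pos] by (auto simp: q ee_add)
  show "1 * qq i - qq j - qq i * qq i * qq j \<in> A_pos"
    using add_pos_pos[OF add_pos_pos[OF a_pos a_pos] a_pos] by (auto simp: q ee_add)
qed (use assms in auto)

lemma JG_eq: "JG = (if 1 < n then {KL w101} else {}) \<union> (if 2 < n then {KL w121} else {})"
proof -
  have "Cop 1 (Cop 0 (Cop 1 (delta id))) - sc (ee (b - a) + ee (a - b)) (Cop 1 (delta id)) = KL w101" if "1 < n"
    using Clin_101[OF that] by (simp only: Clin_def two_Qq_def)
  moreover have "Cop 1 (Cop 2 (Cop 1 (delta id))) - Cop 1 (delta id) = KL w121" if "2 < n"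
    using Clin_iji[of 1 2] that by (simp add: Clin_def sc_simps)
  ultimately show ?thesis by (auto simp: JG_def)
qed

section \<open>Stability of two-sided submodules and the forbidden triples\<close>

lemma bimodD:
  assumes "bimod K"
  shows "K \<subseteq> EW" "0 \<in> K" "f \<in> K \<Longrightarrow> g \<in> K \<Longrightarrow> f + g \<in> K" "f \<in> K \<Longrightarrow> sc c f \<in> K"
    "f \<in> K \<Longrightarrow> i < n \<Longrightarrow> Lop i f \<in> K" "f \<in> K \<Longrightarrow> i < n \<Longrightarrow> Rop i f \<in> K"
    "f \<in> K \<Longrightarrow> g \<in> K \<Longrightarrow> f - g \<in> K" "(\<And>x. x \<in> S \<Longrightarrow> h x \<in> K) \<Longrightarrow> sum h S \<in> K"
proof -
  show *: "K \<subseteq> EW" "0 \<in> K" "\<And>f g. f \<in> K \<Longrightarrow> g \<in> K \<Longrightarrow> f + g \<in> K" "\<And>f c. f \<in> K \<Longrightarrow> sc c f \<in> K"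
    "f \<in> K \<Longrightarrow> i < n \<Longrightarrow> Lop i f \<in> K" "f \<in> K \<Longrightarrow> i < n \<Longrightarrow> Rop i f \<in> K"
    using assms by (auto simp: bimod_def)
  show "f - g \<in> K" if "f \<in> K" "g \<in> K"
    using *(3)[OF that(1) *(4)[OF that(2), of "- 1"]] by (simp add: sc_simps)
  show "sum h S \<in> K" if "\<And>x. x \<in> S \<Longrightarrow> h x \<in> K"
    using that by (induction S rule: infinite_finite_induct) (auto simp: *(2,3) simp del: pointwise)
qed

text \<open>An operator that commutes with right multiplication is left multiplication by the
  element with coordinates \<open>P (delta id)\<close>. Thus \<open>P f\<close> is a right multiple
  of an element of \<open>K\<close>.\<close>

lemma right_stable:
  assumes K: "bimod K" and P: "lin P" "\<And>j f. j < n \<Longrightarrow> f \<in> EW \<Longrightarrow> P (Rop j f) = Rop j (P f)"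
    and "P (delta id) \<in> K" and f: "f \<in> EW"
  shows "P f \<in> K"
proof -
  have "P (delta w) \<in> K" if "w \<in> W n" for w
  proof -
    have "P (Lw ws (delta id)) \<in> K" if "set ws \<subseteq> {..<n}" for ws
    proof -
      define e where "e = (delta id :: 'g wfun)"
      have e: "e \<in> EW" "P e \<in> K" using assms(4) by (simp_all add: e_def)
      have R: "Lop i e = Rop i e" if "i < n" for i using Rop_delta_id[OF that] by (simp add: e_def)
      have "P (Lw ws e) \<in> K"
        using that
      proof (induction ws rule: rev_induct)
        case Nil
        then show ?case using e by simp
      next
        case (snoc i ws)
        then have i: "i < n" and ws: "set ws \<subseteq> {..<n}" by auto
        have "Lw (ws @ [i]) e = Rop i (Lw ws e)"
          using LwR_comm[OF ws i e(1)] R[OF i] by simp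
        then show ?case
          using P(2)[OF i EW_Lw[OF ws e(1)]] bimodD(6)[OF K snoc.IH[OF ws] i] by (simp only:)
      qed
      then show ?thesis by (simp add: e_def)
    qed
    from this[OF reduced_exprD(2)[OF reduced_red_word[OF that]]] show ?thesis
      by (simp add: Lw_delta_id[OF reduced_red_word[OF that]])
  qed
  then have "(\<Sum>w\<in>W n. sc (f w) (P (delta w))) \<in> K"
    by (intro bimodD(8)[OF K] bimodD(4)[OF K])
  moreover have "P f = (\<Sum>w\<in>W n. sc (f w) (P (delta w)))"
    by (subst EW_expand[OF f]) (simp only: lin_sum[OF P(1)] lin_sc[OF P(1)])
  ultimately show ?thesis by (simp only:)
qed

lemma CR_comm: "i < n \<Longrightarrow> j < n \<Longrightarrow> f \<in> EW \<Longrightarrow> Cop i (Rop j f) = Rop j (Cop i f)"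
  by (simp add: Cop_def LR_comm lin_diff[OF lin_Rop] lin_sc[OF lin_Rop])

lemma Clin_in_bimod:
  assumes "bimod K" "i < n" "j < n" "Clin i j c (delta id) \<in> K" "f \<in> EW"
  shows "Clin i j c f \<in> K"
proof (rule right_stable[OF assms(1) lin_Clin _ assms(4,5)])
  fix k f assume "k < n" "f \<in> EW"
  then show "Clin i j c (Rop k f) = Rop k (Clin i j c f)"
    using assms(2,3) by (simp add: Clin_def CR_comm EW_Cop lin_diff[OF lin_Rop] lin_sc[OF lin_Rop] del: pointwise)
qed

text \<open>
  The generator with indices 1 and 2 yields the ones with indices \<open>i\<close> and \<open>i + 1\<close>, because
  conjugation with the product of three consecutive generators shifts the first two of them.
\<close>

lemma Clin_shift:
  assumes K: "bimod K" and i: "0 < i" "Suc (Suc i) < n" and Ci: "Clin i (Suc i) 1 (delta id) \<in> K"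
  shows "Clin (Suc i) (Suc (Suc i)) 1 (delta id) \<in> K"
proof -
  let ?j = "Suc i" and ?k = "Suc (Suc i)"
  have n: "i < n" "?j < n" "?k < n" using i by auto
  define T where "T f = Lop i (Lop ?j (Lop ?k f))" for f
  have lin_T: "lin T" unfolding T_def[abs_def] by (intro lin_comp[OF lin_Lop] lin_ident)
  have br: "Lop x (Lop y (Lop x f)) = Lop y (Lop x (Lop y f))"
    if "x < n" "y < n" "0 < x" "0 < y" "\<bar>int x - int y\<bar> = 1" "f \<in> EW" for x y f
  proof -
    have e: "refl_s x \<circ> (refl_s y \<circ> refl_s x) = refl_s y \<circ> (refl_s x \<circ> refl_s y)"
      using refl_braid_3[OF that(3,4,5), of id] by simp
    have "\<bar>int y - int x\<bar> = 1" using that(5) by simp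
    from L_relation[OF reduced_braid_3[OF that(1-5)] reduced_braid_3[OF that(2,1,4,3) this, folded e] that(6)]
    show ?thesis by simp
  qed
  have cm: "Lop i (Lop ?k f) = Lop ?k (Lop i f)" if "f \<in> EW" for f
  proof -
    have 1: "1 < \<bar>int i - int ?k\<bar>" and 2: "1 < \<bar>int ?k - int i\<bar>" by auto
    have e: "refl_s i \<circ> refl_s ?k = refl_s ?k \<circ> refl_s i" using refl_comm[OF 1, of id] by simp
    from L_relation[OF reduced_comm[OF n(1,3) 1] reduced_comm[OF n(3,1) 2, folded e] that] show ?thesis by simp
  qed
  have T1: "T (Lop i f) = Lop ?j (T f)" if f: "f \<in> EW" for f
  proof -
    have kf: "Lop ?k f \<in> EW" using f n by auto
    have "T (Lop i f) = Lop i (Lop ?j (Lop i (Lop ?k f)))" by (simp only: T_def cm[OF f])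
    also have "\<dots> = Lop ?j (T f)" unfolding T_def by (rule br[OF n(1,2) i(1) _ _ kf]) auto
    finally show ?thesis .
  qed
  have T2: "T (Lop ?j f) = Lop ?k (T f)" if f: "f \<in> EW" for f
  proof -
    have kf: "Lop ?j (Lop ?k f) \<in> EW" using f n by auto
    have "Lop ?j (Lop ?k (Lop ?j f)) = Lop ?k (Lop ?j (Lop ?k f))" by (rule br[OF n(2,3) _ _ _ f]) auto
    then show ?thesis by (simp only: T_def cm[OF kf])
  qed
  have qeq: "qq ?k = qq i" "qq ?j = qq i" using i by (simp_all add: qq_def param_def)
  have C1: "T (Cop i f) = Cop ?j (T f)" and C2: "T (Cop ?j f) = Cop ?k (T f)" if "f \<in> EW" for f
    using T1[OF that] T2[OF that] by (simp_all add: Cop_def lin_diff[OF lin_T] lin_sc[OF lin_T] qeq)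
  have CT: "T (Clin i ?j 1 f) = Clin ?j ?k 1 (T f)" if f: "f \<in> EW" for f
    using n f by (simp add: Clin_def lin_diff[OF lin_T] lin_sc[OF lin_T] C1 C2 EW_Cop del: pointwise)
  \<comment> \<open>The preimage of \<open>delta id\<close> under \<open>T\<close>. Evaluating the
    intertwining relation \<open>CT\<close> there turns it into conjugation of the unit vector's
    image.\<close>
  define g where "g = Linv ?k (Linv ?j (Linv i (delta id)))"
  have gE: "g \<in> EW" unfolding g_def by (intro EW_Linv EW_delta_id n)
  have Tg: "T g = delta id" using n by (simp add: T_def g_def EW_Linv del: pointwise)
  have "T (Clin i ?j 1 g) \<in> K"
    unfolding T_def using n by (intro bimodD(5)[OF K] Clin_in_bimod[OF K n(1,2) Ci gE])
  then show ?thesis by (simp only: CT[OF gE] Tg)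
qed

text \<open>Indices \<open>i, i + 1\<close> are reached from 1, 2 by shifting. In the opposite order
  they give the Kazhdan-Lusztig element of the same group element, by the braid relation. The index
  \<open>j = 0\<close> forces \<open>i = 1\<close>, which is a generator.\<close>

lemma Clin_bad_in_bimod:
  assumes K: "bimod K" "JG \<subseteq> K" and ij: "1 \<le> i" "i < n" "j < n" "\<bar>int i - int j\<bar> = 1" and f: "f \<in> EW"
  shows "\<exists>c. Clin i j c f \<in> K"
proof (cases "j = 0")
  case True
  then have "i = 1" using ij by auto
  then have "Clin i j two_Qq (delta id) \<in> K"
    using True ij K(2) Clin_101 by (auto simp: JG_eq)
  then show ?thesis using Clin_in_bimod[OF K(1) ij(2,3) _ f] by blast
next
  case False
  have up: "Clin k (Suc k) 1 (delta id) \<in> K" if "1 \<le> k" "Suc k < n" for k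
    using that
  proof (induction k rule: nat_induct_at_least)
    case base
    then have "2 < n" by simp
    then have "KL w121 \<in> K" "Clin 1 2 1 (delta id) = KL w121"
      using K(2) Clin_iji[of 1 2] by (auto simp: JG_eq)
    then show ?case by (simp only: Suc_1)
  next
    case (Suc k)
    show ?case by (rule Clin_shift[OF K(1) _ _ Suc.IH]) (use Suc in auto)
  qed
  have "Clin i j 1 (delta id) \<in> K"
  proof (cases "j = Suc i")
    case True
    then show ?thesis using up[of i] ij by simp
  next
    case no: False
    then have i: "i = Suc j" using ij by auto
    have "Clin j i 1 (delta id) = KL (refl_s j \<circ> (refl_s i \<circ> refl_s j))"
      "Clin i j 1 (delta id) = KL (refl_s i \<circ> (refl_s j \<circ> refl_s i))"
      by (rule Clin_iji; use ij False i in simp)+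
    moreover have "refl_s j \<circ> (refl_s i \<circ> refl_s j) = refl_s i \<circ> (refl_s j \<circ> refl_s i)"
      using refl_braid_3[of j i id] False i by simp
    ultimately show ?thesis using up[of j] ij i False by simp
  qed
  then show ?thesis using Clin_in_bimod[OF K(1) ij(2,3) _ f] by blast
qed

section \<open>Spanning modulo the ideal\<close>

definition supp :: "nat \<Rightarrow> 'g wfun \<Rightarrow> bool" where
  "supp k f \<longleftrightarrow> f \<in> EW \<and> (\<forall>z\<in>W n. k < len n z \<longrightarrow> f z = 0)"

lemma supp_L:
  assumes "supp k f" "i < n"
  shows "supp (Suc k) (Lop i f)"
  unfolding supp_def
proof (intro conjI ballI impI)
  show "Lop i f \<in> EW" using assms by (auto simp: supp_def)
  fix z assume z: "z \<in> W n" "Suc k < len n z"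
  have "len n z \<le> len n (refl_s i \<circ> z) + 1"
    using len_refl_le[OF assms(2), of "refl_s i \<circ> z"] z(1) assms(2) by simp
  then have "f (refl_s i \<circ> z) = 0" "f z = 0" using assms z by (auto simp: supp_def)
  then show "Lop i f z = 0" by (simp add: Lop_def)
qed

lemma supp_mono: "supp k f \<Longrightarrow> k \<le> l \<Longrightarrow> supp l f"
  by (auto simp: supp_def)

lemma supp_ops: "supp k f \<Longrightarrow> supp k g \<Longrightarrow> supp k (f + g)" "supp k f \<Longrightarrow> supp k (sc c f)"
  "supp k f \<Longrightarrow> supp k g \<Longrightarrow> supp k (f - g)"
  by (auto simp: supp_def)

lemma supp_Lw: "supp k f \<Longrightarrow> set ws \<subseteq> {..<n} \<Longrightarrow> supp (k + length ws) (Lw ws f)"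
  by (induction ws) (auto dest: supp_L)

lemma supp_delta: "v \<in> W n \<Longrightarrow> supp (len n v) (delta v)"
  by (auto simp: supp_def delta_apply)

definition Wspan :: "'g wfun set" where "Wspan = {g \<in> EW. \<forall>z. z \<notin> Wb n \<longrightarrow> g z = 0}"

text \<open>A forbidden triple in a reduced word of \<open>w\<close> may be replaced, modulo
  \<open>K\<close>, by the lower terms of \<open>Clin i j c\<close>, which contain at most two of
  its three letters. With the rest of the word in front and behind, these terms have length below
  that of \<open>w\<close>, and induction applies.\<close>

lemma Wb_spans:
  assumes K: "bimod K" "JG \<subseteq> K" and "f \<in> EW"
  shows "\<exists>g\<in>Wspan. f - g \<in> K"
proof -
  define KW where "KW = {f. \<exists>g\<in>Wspan. f - g \<in> K}"
  have add: "f + f' \<in> KW" if ff: "f \<in> KW" "f' \<in> KW" for f f'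
  proof -
    obtain g g' where g: "g \<in> Wspan" "f - g \<in> K" "g' \<in> Wspan" "f' - g' \<in> K"
      using ff unfolding KW_def by blast
    have "(f - g) + (f' - g') \<in> K" using g by (intro bimodD(3)[OF K(1)])
    moreover have "(f - g) + (f' - g') = (f + f') - (g + g')" by (simp add: algebra_simps)
    moreover have "g + g' \<in> Wspan" using g by (auto simp: Wspan_def)
    ultimately show ?thesis unfolding KW_def by auto
  qed
  have smul: "sc c f \<in> KW" if f: "f \<in> KW" for c f
  proof -
    obtain g where g: "g \<in> Wspan" "f - g \<in> K" using f unfolding KW_def by blast
    have "sc c f - sc c g \<in> K" using bimodD(4)[OF K(1) g(2), of c] by (simp add: sc_simps)
    moreover have "sc c g \<in> Wspan" using g by (auto simp: Wspan_def)
    ultimately show ?thesis unfolding KW_def by blast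
  qed
  have Wsub: "f \<in> KW" if "f \<in> Wspan" for f
    unfolding KW_def using that bimodD(2)[OF K(1)] by (intro CollectI bexI[of _ f]) auto
  have Ksub: "f \<in> KW" if "f \<in> K" for f
    unfolding KW_def using that by (intro CollectI bexI[of _ 0]) (auto simp: Wspan_def)
  have sumKW: "sum h S \<in> KW" if "\<And>x. x \<in> S \<Longrightarrow> h x \<in> KW" for h :: "(int \<Rightarrow> int) \<Rightarrow> 'g wfun" and S
    using that
    by (induction S rule: infinite_finite_induct) (auto intro: add Ksub bimodD(2)[OF K(1)] simp del: pointwise)
  have "delta w \<in> KW" if "w \<in> W n" for w
    using that
  proof (induction "len n w" arbitrary: w rule: less_induct)
    case less
    show ?case
    proof (cases "w \<in> Wb n")
      case True
      then show ?thesis using less.prems by (intro Wsub) (auto simp: Wspan_def delta_apply)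
    next
      case False
      then obtain us vs i j where r: "reduced_expr n w (us @ [i, j, i] @ vs)"
        and ij: "1 \<le> i" "i < n" "j < n" "\<bar>int i - int j\<bar> = 1"
        using less.prems unfolding Wb_iff bad_word_def by blast
      define v where "v = word_prod vs"
      have rv: "reduced_expr n v vs"
        using reduced_append_right[of n w "us @ [i, j, i]" vs] r by (simp add: v_def)
      note v = reduced_exprD[OF rv]
      have us: "set us \<subseteq> {..<n}" using reduced_exprD(2)[OF r] by auto
      have lw: "len n w = length us + 3 + len n v" using reduced_exprD(4)[OF r] v(4) by simp
      have vE: "delta v \<in> EW" using v(1) by auto
      obtain c where c: "Clin i j c (delta v) \<in> K" using Clin_bad_in_bimod[OF K ij vE] by blast
      define low where "low = Lop i (Lop j (Lop i (delta v))) - Clin i j c (delta v)"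
      have low: "low = sc (qq i) (Lop i (Lop j (delta v))) + sc (qq i) (Lop j (Lop i (delta v)))
          - sc (qq i * qq i) (Lop j (delta v))
          - sc (qq i * qq j + qi i * qq j - c) (Lop i (delta v))
          - sc (c * qq i - qq j - qq i * qq i * qq j) (delta v)"
        unfolding low_def Clin_expand[OF ij(2) vE] by (simp add: algebra_simps del: pointwise)
      have s0: "supp (len n v) (delta v)" by (rule supp_delta[OF v(1)])
      have s1: "supp (Suc (len n v)) (Lop i (delta v))" "supp (Suc (len n v)) (Lop j (delta v))"
        using s0 ij by (auto intro: supp_L)
      have s2: "supp (Suc (Suc (len n v))) (Lop i (Lop j (delta v)))"
        "supp (Suc (Suc (len n v))) (Lop j (Lop i (delta v)))" using s1 ij by (auto intro: supp_L)
      have s2': "supp (Suc (Suc (len n v))) (Lop i (delta v))" "supp (Suc (Suc (len n v))) (Lop j (delta v))"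
        "supp (Suc (Suc (len n v))) (delta v)" using s0 s1 by (auto elim: supp_mono)
      have sl: "supp (Suc (Suc (len n v))) low"
        unfolding low by (intro supp_ops s2 s2')
      have sl': "supp (len n w - 1) (Lw us low)"
        using supp_Lw[OF sl us] lw by (simp add: add.commute)
      have "Lw us low \<in> EW" using sl' by (simp add: supp_def)
      from EW_expand[OF this] have "Lw us low = (\<Sum>z\<in>W n. sc (Lw us low z) (delta z))" .
      also have "\<dots> \<in> KW"
      proof (rule sumKW)
        fix z assume z: "z \<in> W n"
        show "sc (Lw us low z) (delta z) \<in> KW"
        proof (cases "len n z < len n w")
          case True
          then show ?thesis using less.hyps[OF True z] smul by blast
        next
          case False
          then have "Lw us low z = 0" using sl' z lw by (auto simp: supp_def)
          then show ?thesis using Ksub[OF bimodD(2)[OF K(1)]] by (simp add: sc_simps del: pointwise)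
        qed
      qed
      finally have 1: "Lw us low \<in> KW" .
      have "Lw us (Clin i j c (delta v)) \<in> K"
        using us c by (induction us) (auto intro: bimodD(5)[OF K(1)])
      from add[OF Ksub[OF this] 1] have "Lw us (Clin i j c (delta v) + low) \<in> KW"
        by (simp only: lin_add[OF lin_Lw])
      moreover have "Clin i j c (delta v) + low = Lop i (Lop j (Lop i (delta v)))" by (simp add: low_def)
      moreover have "delta w = Lw us (Lop i (Lop j (Lop i (delta v))))"
        using Lw_delta_id[OF r] Lw_delta_id[OF rv] by simp
      ultimately show ?thesis by (simp only:)
    qed
  qed
  then have "(\<Sum>w\<in>W n. sc (f w) (delta w)) \<in> KW" by (intro sumKW smul)
  then have "f \<in> KW" using EW_expand[OF assms(3)] by (simp only:)
  then show ?thesis by (simp add: KW_def)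
qed

text \<open>Each star operation removes a left or right descent, so it shortens the element and
  stays in \<open>Wb\<close>; the parameters permit it because the new descent \<open>i\<close> is
  positive. When no operation is left on either side, \<open>stuck_both_sparse\<close>
  applies.\<close>

lemma Wb_reduces:
  assumes "w \<in> Wb n"
  shows "\<exists>u ws. (lr_step n a b)\<^sup>*\<^sup>* u w \<and> u \<in> W n \<and> reduced_expr n u ws \<and> sparse ws"
  using assms
proof (induction "len n w" arbitrary: w rule: less_induct)
  case less
  have w: "w \<in> W n" using less.prems by (simp add: Wb_iff)
  obtain ws where r: "reduced_expr n w ws" using ex_reduced[OF w] by blast
  have par: "param a b j \<le> param a b i" if "0 < i" for i j
    using that b_less_a by (auto simp: param_def less_imp_le)
  consider "stuck ws" "stuck (rev ws)" | "\<not> stuck ws" | "\<not> stuck (rev ws)" by blast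
  then show ?case
  proof cases
    case 1
    then show ?thesis using stuck_both_sparse[OF less.prems r] r w by blast
  next
    case 2
    obtain i j where ij: "i < n" "j < n" "0 < i" "\<not> ldesc i w" "ldesc j w" "ldesc i (refl_s j \<circ> w)"
      using not_stuck_step[OF less.prems r 2] by blast
    let ?y = "refl_s j \<circ> w"
    have "lr_step n a b ?y w"
      using Cop_KL_occurs[OF ij(1,2) w ij(4-6) par[OF ij(3)]] lr_step_iff[of ?y w] w ij(1,2) by auto
    moreover have "\<exists>u ws. (lr_step n a b)\<^sup>*\<^sup>* u ?y \<and> u \<in> W n \<and> reduced_expr n u ws \<and> sparse ws"
      using len_ldesc[OF ij(2) w ij(5)] Wb_ldesc[OF less.prems ij(2,5)] by (intro less.hyps) auto
    ultimately show ?thesis by (meson rtranclp.rtrancl_into_rtrancl)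
  next
    case 3
    have w': "winv w \<in> Wb n" "winv w \<in> W n" using Wb_winv[OF less.prems] w by auto
    obtain i j where ij: "i < n" "j < n" "0 < i" "\<not> ldesc i (winv w)" "ldesc j (winv w)"
        "ldesc i (refl_s j \<circ> winv w)"
      using not_stuck_step[OF w'(1) reduced_rev[OF r] 3] by blast
    let ?y = "w \<circ> refl_s j"
    have eq: "refl_s j \<circ> winv w = winv ?y" using ij w by (simp add: winv_comp_refl)
    have y: "?y \<in> W n" using ij w by simp
    have "lr_step n a b ?y w"
      using CRop_KL_occurs[OF ij(1,2) w ij(4,5) ij(6)[unfolded eq] par[OF ij(3)]] lr_step_iff[OF y w] ij(1) by auto
    moreover have "winv ?y \<in> Wb n" using Wb_ldesc[OF w'(1) ij(2,5)] by (simp only: eq)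
    then have "?y \<in> Wb n" using Wb_winv[of "winv ?y" n] winv_winv[OF y] by simp
    moreover have "len n ?y < len n w"
      using len_ldesc[OF ij(2) w'(2) ij(5)] len_winv[OF y] len_winv[OF w] eq by simp
    then have "\<exists>u ws. (lr_step n a b)\<^sup>*\<^sup>* u ?y \<and> u \<in> W n \<and> reduced_expr n u ws \<and> sparse ws"
      using \<open>?y \<in> Wb n\<close> by (rule less.hyps)
    ultimately show ?thesis by (meson rtranclp.rtrancl_into_rtrancl)
  qed
qed

theorem span_eq_J_ideal:
  assumes hyp: "\<forall>y\<in>W n. \<forall>w\<in>W n. le_LR n a b y w \<longleftrightarrow> Sh n y \<unlhd> Sh n w"
  shows "A_span n a b (C_basis n a b ` (W n - Wb n)) = J_ideal n a b"
proof -
  define G where "G = (if 1 < n then {w101} else {}) \<union> (if 2 < n then {w121} else {})"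
  define D where "D = {y \<in> W n. \<exists>g\<in>G. le_LR n a b y g}"
  \<comment> \<open>As \<open>D\<close> is closed downwards in the preorder, this span is stable
    under multiplication from both sides.\<close>
  define ID where "ID = {f. \<exists>m. f = (\<Sum>z\<in>D. sc (m z) (KL z))}"
  have GW: "G \<subseteq> W n"
    by (auto simp: G_def intro!: W_comp refl_W)
  have DW: "D \<subseteq> W n" by (auto simp: D_def)
  have fD: "finite D" by (rule finite_subset[OF DW finite_W])
  have JG: "JG = KL ` G" by (auto simp: JG_eq G_def)
  have KL_ID: "KL w \<in> ID" if "w \<in> D" for w
  proof -
    have "(\<Sum>z\<in>D. sc (if z = w then 1 else 0) (KL z)) = (\<Sum>z\<in>D. if z = w then KL w else 0)"
      by (rule sum.cong) (auto simp: sc_simps)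
    also have "\<dots> = KL w" using that fD by simp
    finally have "KL w = (\<Sum>z\<in>D. sc (if z = w then 1 else 0) (KL z))" by (rule sym)
    then show ?thesis unfolding ID_def by (intro CollectI exI[of _ "\<lambda>z. if z = w then 1 else 0"])
  qed
  have ID_add: "f + g \<in> ID" if fg: "f \<in> ID" "g \<in> ID" for f g
  proof -
    obtain m m' where "f = (\<Sum>z\<in>D. sc (m z) (KL z))" "g = (\<Sum>z\<in>D. sc (m' z) (KL z))"
      using fg by (auto simp: ID_def)
    then have "f + g = (\<Sum>z\<in>D. sc (m z + m' z) (KL z))" by (simp add: sc_simps sum.distrib)
    then show ?thesis unfolding ID_def by (intro CollectI exI[of _ "\<lambda>z. m z + m' z"])
  qed
  have ID_sc: "sc c f \<in> ID" if f: "f \<in> ID" for c f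
  proof -
    obtain m where "f = (\<Sum>z\<in>D. sc (m z) (KL z))" using f by (auto simp: ID_def)
    then have "sc c f = (\<Sum>z\<in>D. sc (c * m z) (KL z))" by (simp add: sc_simps sc_sum)
    then show ?thesis unfolding ID_def by (intro CollectI exI[of _ "\<lambda>z. c * m z"])
  qed
  have ID_0: "0 \<in> ID" unfolding ID_def by (intro CollectI exI[of _ "\<lambda>z. 0"]) (simp add: sc_simps)
  have ID_sum: "sum h S \<in> ID" if "\<And>x. x \<in> S \<Longrightarrow> h x \<in> ID" for h :: "(int \<Rightarrow> int) \<Rightarrow> 'g wfun" and S
    using that by (induction S rule: infinite_finite_induct) (auto simp: ID_0 ID_add simp del: pointwise)
  have step_ID: "f \<in> ID" if w: "w \<in> D" and i: "i < n" and f: "f = Cop i (KL w) \<or> f = CRop i (KL w)" for w i f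
  proof -
    have wW: "w \<in> W n" using w DW by auto
    have "f \<in> EW" using f i KL_facts(1)[OF wW] by (auto simp: CRop_def)
    then obtain m where m: "f = (\<Sum>z\<in>W n. sc (m z) (KL z))" using KL_expand' by blast
    have "z \<in> D" if z: "z \<in> W n" "m z \<noteq> 0" for z
    proof -
      have "lr_step n a b z w"
        unfolding lr_step_iff[OF z(1) wW]
      proof (intro exI[of _ i] exI[of _ m] conjI i z(2))
        from f have "Cop i (KL w) = f \<or> CRop i (KL w) = f" by auto
        then show "Cop i (KL w) = (\<Sum>z\<in>W n. sc (m z) (KL z)) \<or>
            CRop i (KL w) = (\<Sum>z\<in>W n. sc (m z) (KL z))" by (simp only: m)
      qed
      then show ?thesis using w z(1) unfolding D_def le_LR_def
        by (auto intro: converse_rtranclp_into_rtranclp)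
    qed
    then have "sc (m z) (KL z) \<in> ID" if "z \<in> W n" for z
      using that KL_ID ID_sc ID_0 sc_simps(5)[of "KL z"] by (cases "m z = 0") (simp_all del: pointwise)
    then show ?thesis unfolding m by (rule ID_sum)
  qed
  have ID_bimod: "bimod ID"
    unfolding bimod_def
  proof (intro conjI ballI allI impI)
    show "ID \<subseteq> EW"
      using KL_facts(1) DW by (auto simp: ID_def intro!: EW_sum EW_sc)
    fix f i assume f: "f \<in> ID" and i: "i < n"
    obtain m where m: "f = (\<Sum>z\<in>D. sc (m z) (KL z))" using f by (auto simp: ID_def)
    have "Lop i (KL z) \<in> ID" if "z \<in> D" for z
    proof -
      have "Cop i (KL z) + sc (qq i) (KL z) \<in> ID"
        using step_ID[OF that i] KL_ID[OF that] by (intro ID_add ID_sc) simp_all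
      then show ?thesis by (simp add: Cop_def)
    qed
    then show "Lop i f \<in> ID" unfolding m lin_sum[OF lin_Lop] lin_sc[OF lin_Lop] by (intro ID_sum ID_sc)
    have "Rop i (KL z) \<in> ID" if "z \<in> D" for z
    proof -
      have "CRop i (KL z) + sc (qq i) (KL z) \<in> ID"
        using step_ID[OF that i] KL_ID[OF that] by (intro ID_add ID_sc) simp_all
      then show ?thesis by (simp add: CRop_def)
    qed
    then show "Rop i f \<in> ID" unfolding m lin_sum[OF lin_Rop] lin_sc[OF lin_Rop] by (intro ID_sum ID_sc)
  qed (auto simp: ID_0 ID_add ID_sc)
  have JG_ID: "JG \<subseteq> ID"
    using GW by (auto simp: JG D_def le_LR_def intro!: KL_ID)
  have disj: "w \<notin> D" if w: "w \<in> Wb n" for w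
  proof
    assume "w \<in> D"
    then obtain g where g: "g \<in> G" "le_LR n a b w g" by (auto simp: D_def)
    obtain u ws where u: "(lr_step n a b)\<^sup>*\<^sup>* u w" "u \<in> W n" "reduced_expr n u ws" "sparse ws"
      using Wb_reduces[OF w] by blast
    have "le_LR n a b u g" using u(1) g(2) unfolding le_LR_def by (rule rtranclp_trans)
    then have "Sh n u \<unlhd> Sh n g" using hyp u(2) g(1) GW by blast
    \<comment> \<open>Dominance is tested at the first two parts: their sum is \<open>2 * n\<close>
      for a shape with at most two rows and smaller once a third row is occupied.\<close>
    then have "(\<Sum>i<2. Sh n u i) \<le> (\<Sum>i<2. Sh n g i)" unfolding dominance_le_def by blast
    then have "Sh n u 0 + Sh n u 1 \<le> Sh n g 0 + Sh n g 1" by (simp add: numeral_2_eq_2)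
    moreover have "Sh n u 0 + Sh n u 1 = 2 * n"
      using Sh_sparse[OF u(4) reduced_exprD(2)[OF u(3)]] reduced_exprD(3)[OF u(3)] by simp
    moreover have "Sh n g 0 + Sh n g 1 < 2 * n"
      using g(1) Sh_101[of n g] Sh_121[of n g] by (auto simp: G_def split: if_splits)
    ultimately show False by simp
  qed
  \<comment> \<open>The coefficients of \<open>f\<close> at the \<open>KL z\<close> live on
    \<open>D\<close>, those at the \<open>delta z\<close> outside \<open>D\<close>. This is the
    situation of \<open>KL_sum_eq_0\<close>.\<close>
  have ID_zero: "f = 0" if f: "f \<in> ID" "\<And>z. z \<in> D \<Longrightarrow> f z = 0" for f
  proof -
    obtain m where m: "f = (\<Sum>z\<in>D. sc (m z) (KL z))" using f(1) by (auto simp: ID_def)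
    have "(\<Sum>z\<in>D. sc (m z) (KL z)) = (\<Sum>z\<in>W n. sc (if z \<in> D then m z else 0) (KL z))"
      using DW by (intro sum.mono_neutral_cong_left) (auto simp: sc_simps)
    with m have "f = (\<Sum>z\<in>W n. sc (if z \<in> D then m z else 0) (KL z))" by simp
    then show ?thesis by (rule KL_sum_eq_0) (use f(2) in auto)
  qed
  define K where "K = T_coeff ` J_ideal n a b"
  have K: "bimod K" "JG \<subseteq> K" using bimod_J_ideal by (auto simp: K_def)
  have K_ID: "K \<subseteq> ID" using J_ideal_in_bimod[OF ID_bimod JG_ID] by (auto simp: K_def)
  have D_eq: "D = W n - Wb n"
  proof
    show "D \<subseteq> W n - Wb n" using DW disj by auto
    show "W n - Wb n \<subseteq> D"
    proof
      fix w assume w: "w \<in> W n - Wb n"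
      show "w \<in> D"
      proof (rule ccontr)
        assume wD: "w \<notin> D"
        have "delta w \<in> EW" using w by auto
        then obtain g where g: "g \<in> Wspan" "delta w - g \<in> K" using Wb_spans[OF K] by blast
        \<comment> \<open>All coefficients of this vector lie outside \<open>D\<close>:
          \<open>w\<close> is outside by assumption, and \<open>g\<close> is supported on
          \<open>Wb\<close>. Yet the coefficient at \<open>w\<close> is 1, since \<open>w\<close> is
          not in \<open>Wb\<close>.\<close>
        have "delta w - g = 0"
        proof (rule ID_zero)
          show "delta w - g \<in> ID" using g(2) K_ID by auto
          fix z assume z: "z \<in> D"
          then have "z \<noteq> w" "z \<notin> Wb n" using wD disj by auto
          then show "(delta w - g) z = 0" using g(1) by (simp add: Wspan_def delta_apply)
        qed
        then have "(delta w - g) w = 0" by simp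
        then show False using g(1) w by (simp add: Wspan_def delta_apply)
      qed
    qed
  qed
  have span: "U \<in> A_span n a b (C_basis n a b ` (W n - Wb n)) \<longleftrightarrow> U \<in> carrier H \<and> T_coeff U \<in> ID" for U
    using A_span_iff[OF DW, of U] by (simp add: D_eq ID_def)
  show ?thesis
  proof
    show "J_ideal n a b \<subseteq> A_span n a b (C_basis n a b ` (W n - Wb n))"
      using bimod_J_ideal(3) K_ID span by (auto simp: K_def)
    show "A_span n a b (C_basis n a b ` (W n - Wb n)) \<subseteq> J_ideal n a b"
    proof
      fix U assume "U \<in> A_span n a b (C_basis n a b ` (W n - Wb n))"
      then have U: "U \<in> carrier H" "T_coeff U \<in> ID" using span by auto
      obtain g where g: "g \<in> Wspan" "T_coeff U - g \<in> K" using Wb_spans[OF K EW_T_coeff[OF U(1)]] by blast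
      \<comment> \<open>\<open>g\<close> is supported on \<open>Wb\<close>, hence off
        \<open>D\<close>, and as a difference of two elements of \<open>ID\<close> it belongs to
        \<open>ID\<close>.\<close>
      have "g = 0"
      proof (rule ID_zero)
        have "T_coeff U - (T_coeff U - g) \<in> ID" 
          by (rule bimodD(7)[OF ID_bimod U(2) subsetD[OF K_ID g(2)]])
        then show "g \<in> ID" by simp
        show "g z = 0" if "z \<in> D" for z using that disj g(1) by (auto simp: Wspan_def)
      qed
      then have "T_coeff U \<in> K" using g(2) by simp
      then obtain V where "V \<in> J_ideal n a b" "T_coeff U = T_coeff V" by (auto simp: K_def)
      then show "U \<in> J_ideal n a b" using T_coeff_inj[OF U(1)] bimod_J_ideal(3) by auto
    qed
  qed
qed

end

theorem theorem3p2:
  fixes n :: nat and a b :: "'g::linordered_ab_group_add"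
  assumes "fg_free_group TYPE('g)"
    and "0 < b" and "b < a"
    and "\<forall>y\<in>W n. \<forall>w\<in>W n. le_LR n a b y w \<longleftrightarrow> Sh n y \<unlhd> Sh n w"
  shows "A_span n a b (C_basis n a b ` (W n - Wb n)) = J_ideal n a b"
proof -
  interpret hecke_B n a b by standard fact+
  show ?thesis by (rule span_eq_J_ideal) fact
qed

end
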